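(* \textsc{Exactly-Double Threading} is polynomial-time equivalent to the \textsc{Traveling Salesperson} problem: the \textsc{Traveling Salesperson} problem reduces in polynomial time to \textsc{Exactly-Double Threading}, and \textsc{Exactly-Double Threading} can be solved in polynomial time using an algorithm for the \textsc{Traveling Salesperson} problem.
   Context: All graphs are connected with minimum degree at least $2$; $G=(V,E)$. A turn at a vertex $v$ is an unordered pair of distinct edges both incident to $v$. Turn costs for $G$ are a function $\alpha$ assigning a nonnegative real number to every turn of $G$. For a closed walk $W$, its turn cost $\alpha(W)$ is the sum of the costs of all consecutive pairs of edges of $W$, taken cyclically. The junction graph $J(v)$ induced by a closed walk at vertex $v$ has one vertex for each edge incident to $v$, and an edge between two of these vertices every time the walk visits $v$ immediately in between traversing the corresponding two edges. A threading of $G$ is a closed walk in $G$ that traverses every edge at least once, has no U-turns (never traverses the same edge twice in immediate succession, cyclically), and induces a connected junction graph at every vertex. \textsc{Exactly-Double Threading}: given $(G,\alpha)$, find a threading of $G$ of minimum turn cost among threadings that traverse every edge exactly twice (decision version: with a bound $c$, decide whether such a threading of cost at most $c$ exists). \textsc{Traveling Salesperson}: given $n$ cities with distances $d(i,j)$ and a constant $C\ge 0$, decide whether there is a tour visiting each city exactly once of total length at most $C$.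
   Formalization: Turn costs, distances and bounds are taken to be nonnegative rationals written in binary instead of arbitrary reals, since polynomial time is not defined for inputs containing arbitrary real numbers. *)

theory Defs
  imports
    Complex_Main
    "HOL-Library.Multiset"
    "HOL-Library.Log_Nat"
    "HOL-Computational_Algebra.Polynomial"
begin

section \<open>Polynomial time\<close>

text \<open>
  The model of computation is a small while language over binary trees whose leaves are natural
  numbers, under the logarithmic cost criterion: producing a value costs its size, where a number
  counts with its binary length. Hence the total cost of a run bounds the sizes of all values that
  it produces, every single step can be simulated by a Turing machine in time polynomial in
  the sizes of the values involved, and ``polynomial time'' has its usual meaning.
\<close>

datatype data = Leaf nat | Node data data

fun data_size :: "data \<Rightarrow> nat" where
  "data_size (Leaf n) = 1 + floorlog 2 n"
| "data_size (Node a b) = 1 + data_size a + data_size b"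

fun to_nat_data :: "data \<Rightarrow> nat" where
  "to_nat_data (Leaf n) = n"
| "to_nat_data (Node a b) = 0"

fun left :: "data \<Rightarrow> data" where
  "left (Leaf n) = Leaf 0"
| "left (Node a b) = a"

fun right :: "data \<Rightarrow> data" where
  "right (Leaf n) = Leaf 0"
| "right (Node a b) = b"

fun is_node :: "data \<Rightarrow> bool" where
  "is_node (Leaf n) = False"
| "is_node (Node a b) = True"

datatype arith = Add | Sub | Mul | Div | Leq

fun arith_fun :: "arith \<Rightarrow> nat \<Rightarrow> nat \<Rightarrow> nat" where
  "arith_fun Add m n = m + n"
| "arith_fun Sub m n = m - n"
| "arith_fun Mul m n = m * n"
| "arith_fun Div m n = m div n"
| "arith_fun Leq m n = of_bool (m \<le> n)"

text \<open>
  Variables are de Bruijn indices into the environment, which is a list of values. \<open>While c b\<close> acts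
  on variable 0: as long as \<open>c\<close> does not evaluate to 0 that variable is replaced by the
  value of \<open>b\<close>; the result is its final value.
\<close>

datatype prog =
    Var nat
  | Const nat
  | Arith arith prog prog
  | MkNode prog prog
  | Left prog
  | Right prog
  | IsNode prog
  | Bind prog prog
  | Cond prog prog prog
  | While prog prog
  | Query prog

text \<open>
  \<open>eval O \<rho> p v t\<close>: in environment \<open>\<rho>\<close> and with oracle \<open>O\<close>, the program \<open>p\<close> terminates with
  value \<open>v\<close> and cost \<open>t\<close>. The oracle is a partial function; a query outside its domain gets the
  computation stuck. The cost of writing down a query is included in the cost \<open>t\<close> of evaluating
  the argument of \<open>Query\<close>. Programs that use no oracle are those run with \<open>Map.empty\<close>.
\<close>

inductive eval :: "(data \<rightharpoonup> data) \<Rightarrow> data list \<Rightarrow> prog \<Rightarrow> data \<Rightarrow> nat \<Rightarrow> bool"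
  for orc :: "data \<rightharpoonup> data" where
  eval_Var: "i < length \<rho> \<Longrightarrow> eval orc \<rho> (Var i) (\<rho> ! i) (data_size (\<rho> ! i))"
| eval_Const: "eval orc \<rho> (Const n) (Leaf n) (data_size (Leaf n))"
| eval_Arith: "\<lbrakk>eval orc \<rho> p u s; eval orc \<rho> q v t;
    r = Leaf (arith_fun f (to_nat_data u) (to_nat_data v))\<rbrakk>
    \<Longrightarrow> eval orc \<rho> (Arith f p q) r (s + t + data_size r)"
| eval_MkNode: "\<lbrakk>eval orc \<rho> p u s; eval orc \<rho> q v t\<rbrakk>
    \<Longrightarrow> eval orc \<rho> (MkNode p q) (Node u v) (s + t + data_size (Node u v))"
| eval_Left: "eval orc \<rho> p u t \<Longrightarrow> eval orc \<rho> (Left p) (left u) (t + data_size (left u))"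
| eval_Right: "eval orc \<rho> p u t \<Longrightarrow> eval orc \<rho> (Right p) (right u) (t + data_size (right u))"
| eval_IsNode: "\<lbrakk>eval orc \<rho> p u t; r = Leaf (of_bool (is_node u))\<rbrakk>
    \<Longrightarrow> eval orc \<rho> (IsNode p) r (t + data_size r)"
| eval_Bind: "\<lbrakk>eval orc \<rho> p u s; eval orc (u # \<rho>) q v t\<rbrakk>
    \<Longrightarrow> eval orc \<rho> (Bind p q) v (s + t + 1)"
| eval_Cond_true: "\<lbrakk>eval orc \<rho> c u s; u \<noteq> Leaf 0; eval orc \<rho> p v t\<rbrakk>
    \<Longrightarrow> eval orc \<rho> (Cond c p q) v (s + t + 1)"
| eval_Cond_false: "\<lbrakk>eval orc \<rho> c (Leaf 0) s; eval orc \<rho> q v t\<rbrakk>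
    \<Longrightarrow> eval orc \<rho> (Cond c p q) v (s + t + 1)"
| eval_While_false: "eval orc (x # \<rho>) c (Leaf 0) s
    \<Longrightarrow> eval orc (x # \<rho>) (While c b) x (s + data_size x)"
| eval_While_true: "\<lbrakk>eval orc (x # \<rho>) c u s; u \<noteq> Leaf 0; eval orc (x # \<rho>) b y t;
    eval orc (y # \<rho>) (While c b) z w\<rbrakk>
    \<Longrightarrow> eval orc (x # \<rho>) (While c b) z (s + t + w + 1)"
| eval_Query: "\<lbrakk>eval orc \<rho> p u t; orc u = Some v\<rbrakk>
    \<Longrightarrow> eval orc \<rho> (Query p) v (t + data_size v)"

lemma eval_deterministic:
  "eval orc \<rho> p v t \<Longrightarrow> eval orc \<rho> p v' t' \<Longrightarrow> v' = v \<and> t' = t"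
proof (induction arbitrary: v' t' rule: eval.induct)
  case (eval_Var i \<rho>)
  then show ?case by (auto elim: eval.cases)
next
  case (eval_Const \<rho> n)
  then show ?case by (auto elim: eval.cases)
next
  case (eval_Arith \<rho> p u s q v t r f)
  from eval_Arith.prems show ?case
    by (cases rule: eval.cases) (use eval_Arith in blast)
next
  case (eval_MkNode \<rho> p u s q v t)
  from eval_MkNode.prems show ?case
    by (cases rule: eval.cases) (use eval_MkNode in blast)
next
  case (eval_Left \<rho> p u t)
  from eval_Left.prems show ?case
    by (cases rule: eval.cases) (use eval_Left in blast)
next
  case (eval_Right \<rho> p u t)
  from eval_Right.prems show ?case
    by (cases rule: eval.cases) (use eval_Right in blast)
next
  case (eval_IsNode \<rho> p u t r)
  from eval_IsNode.prems show ?case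
    by (cases rule: eval.cases) (use eval_IsNode in blast)
next
  case (eval_Bind \<rho> p u s q v t)
  from eval_Bind.prems show ?case
    by (cases rule: eval.cases) (use eval_Bind in blast)
next
  case (eval_Cond_true \<rho> c u s p v t q)
  from eval_Cond_true.prems show ?case
    by (cases rule: eval.cases) (use eval_Cond_true in blast)+
next
  case (eval_Cond_false \<rho> c s q v t p)
  from eval_Cond_false.prems show ?case
    by (cases rule: eval.cases) (use eval_Cond_false in blast)+
next
  case (eval_While_false x \<rho> c s b)
  from eval_While_false.prems show ?case
    by (cases rule: eval.cases) (use eval_While_false in blast)+
next
  case (eval_While_true x \<rho> c u s b y t z w)
  from eval_While_true.prems show ?case
    by (cases rule: eval.cases) (use eval_While_true in blast)+
next
  case (eval_Query \<rho> p u t v)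
  from eval_Query.prems show ?case
    by (cases rule: eval.cases) (use eval_Query in \<open>metis option.inject\<close>)
qed


section \<open>Problems and reductions\<close>

record 'i problem =
  instances :: "'i set"
  encode :: "'i \<Rightarrow> data"
  answer :: "'i \<Rightarrow> data \<Rightarrow> bool"

definition decision_problem :: "'i set \<Rightarrow> ('i \<Rightarrow> data) \<Rightarrow> ('i \<Rightarrow> bool) \<Rightarrow> 'i problem" where
  "decision_problem I enc yes =
    \<lparr>instances = I, encode = enc, answer = (\<lambda>i y. y = Leaf (of_bool (yes i)))\<rparr>"

definition solves :: "(data \<rightharpoonup> data) \<Rightarrow> 'i problem \<Rightarrow> bool" where
  "solves orc P \<longleftrightarrow> (\<forall>i\<in>instances P. \<exists>y. orc (encode P i) = Some y \<and> answer P i y)"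

text \<open>
  The program and its time bound must not depend on which algorithm for \<open>Q\<close> is plugged in. The
  oracle may be undefined off the encodings of instances of \<open>Q\<close>, so only these can be
  queried safely.
\<close>

definition polytime_turing_reducible :: "'i problem \<Rightarrow> 'j problem \<Rightarrow> bool" where
  "polytime_turing_reducible P Q \<longleftrightarrow>
    (\<exists>p (T :: nat poly). \<forall>orc. solves orc Q \<longrightarrow>
      (\<forall>i\<in>instances P. \<exists>y t. eval orc [encode P i] p y t \<and> answer P i y \<and>
         t \<le> poly T (data_size (encode P i))))"

definition polytime_many_one_reducible :: "'i problem \<Rightarrow> 'j problem \<Rightarrow> bool" where
  "polytime_many_one_reducible P Q \<longleftrightarrow>
    (\<exists>p (T :: nat poly). \<forall>i\<in>instances P. \<exists>j\<in>instances Q. \<exists>t.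
       eval Map.empty [encode P i] p (encode Q j) t \<and>
       t \<le> poly T (data_size (encode P i)) \<and>
       (\<forall>y. answer P i y \<longleftrightarrow> answer Q j y))"

definition enc_list :: "('a \<Rightarrow> data) \<Rightarrow> 'a list \<Rightarrow> data" where
  "enc_list enc xs = foldr (\<lambda>x. Node (enc x)) xs (Leaf 0)"

text \<open>Nonnegative rationals in lowest terms.\<close>

definition enc_rat :: "rat \<Rightarrow> data" where
  "enc_rat q = (case quotient_of q of (a, b) \<Rightarrow> Node (Leaf (nat a)) (Leaf (nat b)))"


section \<open>Graphs and threadings\<close>

definition connected_graph :: "'a set \<Rightarrow> 'a set set \<Rightarrow> bool" where
  "connected_graph V E \<longleftrightarrow> (\<forall>u\<in>V. \<forall>v\<in>V. (u, v) \<in> {(x, y). {x, y} \<in> E}\<^sup>*)"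

definition incident_edges :: "'a set set \<Rightarrow> 'a \<Rightarrow> 'a set set" where
  "incident_edges E v = {e \<in> E. v \<in> e}"

definition admissible_graph :: "'a set \<Rightarrow> 'a set set \<Rightarrow> bool" where
  "admissible_graph V E \<longleftrightarrow> finite V \<and> V \<noteq> {} \<and> (\<forall>e\<in>E. e \<subseteq> V \<and> card e = 2) \<and>
     connected_graph V E \<and> (\<forall>v\<in>V. card (incident_edges E v) \<ge> 2)"

definition turns :: "'a set set \<Rightarrow> 'a \<Rightarrow> 'a set set set" where
  "turns E v = {{e, f} | e f. e \<in> incident_edges E v \<and> f \<in> incident_edges E v \<and> e \<noteq> f}"

definition turn_costs :: "'a set \<Rightarrow> 'a set set \<Rightarrow> ('a set set \<Rightarrow> 'c::linordered_field) \<Rightarrow> bool" where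
  "turn_costs V E \<alpha> \<longleftrightarrow> (\<forall>v\<in>V. \<forall>\<tau>\<in>turns E v. \<alpha> \<tau> \<ge> 0)"

text \<open>A closed walk is the cyclic sequence of its vertices; indices are taken modulo its length.\<close>

definition walk_vertex :: "'a list \<Rightarrow> nat \<Rightarrow> 'a" where
  "walk_vertex w i = w ! (i mod length w)"

definition walk_edge :: "'a list \<Rightarrow> nat \<Rightarrow> 'a set" where
  "walk_edge w i = {walk_vertex w i, walk_vertex w (Suc i)}"

definition closed_walk :: "'a set \<Rightarrow> 'a set set \<Rightarrow> 'a list \<Rightarrow> bool" where
  "closed_walk V E w \<longleftrightarrow> w \<noteq> [] \<and> set w \<subseteq> V \<and> (\<forall>i<length w. walk_edge w i \<in> E)"

definition traversals :: "'a list \<Rightarrow> 'a set \<Rightarrow> nat" where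
  "traversals w e = card {i. i < length w \<and> walk_edge w i = e}"

definition no_U_turns :: "'a list \<Rightarrow> bool" where
  "no_U_turns w \<longleftrightarrow> (\<forall>i<length w. walk_edge w i \<noteq> walk_edge w (Suc i))"

text \<open>The edges of the junction graph, a multigraph, at a vertex.\<close>

definition junction_edges :: "'a list \<Rightarrow> 'a \<Rightarrow> 'a set set multiset" where
  "junction_edges w v = {# {walk_edge w i, walk_edge w (Suc i)}.
     i \<in># mset_set {i. i < length w \<and> walk_vertex w (Suc i) = v} #}"

definition threading :: "'a set \<Rightarrow> 'a set set \<Rightarrow> 'a list \<Rightarrow> bool" where
  "threading V E w \<longleftrightarrow> closed_walk V E w \<and> (\<forall>e\<in>E. traversals w e \<ge> 1) \<and> no_U_turns w \<and>
     (\<forall>v\<in>V. connected_graph (incident_edges E v) (set_mset (junction_edges w v)))"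

definition exactly_double_threading :: "'a set \<Rightarrow> 'a set set \<Rightarrow> 'a list \<Rightarrow> bool" where
  "exactly_double_threading V E w \<longleftrightarrow> threading V E w \<and> (\<forall>e\<in>E. traversals w e = 2)"

definition walk_cost :: "('a set set \<Rightarrow> 'c::linordered_field) \<Rightarrow> 'a list \<Rightarrow> 'c" where
  "walk_cost \<alpha> w = (\<Sum>i<length w. \<alpha> {walk_edge w i, walk_edge w (Suc i)})"


section \<open>The two problems\<close>

text \<open>
  Instances are finite objects: weights are rationals, and the vertices of a graph, like the
  cities, are the numbers below \<open>n\<close>. The graph is given by its adjacency matrix, and the turn
  costs by the table of the costs of the turns \<open>u - v - w\<close>, with 0 in place of non-turns.
\<close>

definition enc_graph :: "nat \<times> nat set set \<times> (nat set set \<Rightarrow> rat) \<Rightarrow> data" where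
  "enc_graph = (\<lambda>(n, E, \<alpha>).
     Node (Leaf n)
       (Node
         (enc_list (\<lambda>u. enc_list (\<lambda>v. Leaf (of_bool ({u, v} \<in> E))) [0..<n]) [0..<n])
         (enc_list (\<lambda>v. enc_list (\<lambda>u. enc_list (\<lambda>w.
            enc_rat (if {{u, v}, {v, w}} \<in> turns E v then \<alpha> {{u, v}, {v, w}} else 0))
            [0..<n]) [0..<n]) [0..<n])))"

definition graph_instances :: "(nat \<times> nat set set \<times> (nat set set \<Rightarrow> rat)) set" where
  "graph_instances = {(n, E, \<alpha>). admissible_graph {..<n} E \<and> turn_costs {..<n} E \<alpha>}"

definition exactly_double_threading_problem ::
    "(nat \<times> nat set set \<times> (nat set set \<Rightarrow> rat)) problem" where
  "exactly_double_threading_problem =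
    \<lparr>instances = graph_instances,
     encode = enc_graph,
     answer = (\<lambda>(n, E, \<alpha>) y. \<exists>w. y = enc_list Leaf w \<and>
       exactly_double_threading {..<n} E w \<and>
       (\<forall>w'. exactly_double_threading {..<n} E w' \<longrightarrow> walk_cost \<alpha> w \<le> walk_cost \<alpha> w'))\<rparr>"

definition exactly_double_threading_decision ::
    "((nat \<times> nat set set \<times> (nat set set \<Rightarrow> rat)) \<times> rat) problem" where
  "exactly_double_threading_decision =
    decision_problem {(G, c). G \<in> graph_instances \<and> c \<ge> 0}
      (\<lambda>(G, c). Node (enc_graph G) (enc_rat c))
      (\<lambda>((n, E, \<alpha>), c). \<exists>w. exactly_double_threading {..<n} E w \<and> walk_cost \<alpha> w \<le> c)"

definition tour :: "nat \<Rightarrow> nat list \<Rightarrow> bool" where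
  "tour n p \<longleftrightarrow> distinct p \<and> set p = {..<n}"

definition tour_length :: "(nat \<Rightarrow> nat \<Rightarrow> rat) \<Rightarrow> nat list \<Rightarrow> rat" where
  "tour_length d p = (\<Sum>i<length p. d (p ! i) (p ! (Suc i mod length p)))"

definition traveling_salesperson :: "(nat \<times> (nat \<Rightarrow> nat \<Rightarrow> rat) \<times> rat) problem" where
  "traveling_salesperson =
    decision_problem
      {(n, d, C). n \<ge> 1 \<and> C \<ge> 0 \<and>
        (\<forall>i<n. d i i = 0 \<and> (\<forall>j<n. d i j \<ge> 0 \<and> d i j = d j i))}
      (\<lambda>(n, d, C). Node (Leaf n)
        (Node (enc_list (\<lambda>i. enc_list (\<lambda>j. enc_rat (d i j)) [0..<n]) [0..<n]) (enc_rat C)))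
      (\<lambda>(n, d, C). \<exists>p. tour n p \<and> tour_length d p \<le> C)"

lemma enc_rat_inject:
  assumes "enc_rat q = enc_rat r" "q \<ge> 0" "r \<ge> 0"
  shows "q = r"
proof -
  obtain a b c d where ab: "quotient_of q = (a, b)" and cd: "quotient_of r = (c, d)"
    by (meson surj_pair)
  have "b > 0" "d > 0" using quotient_of_denom_pos ab cd by blast+
  moreover have "a \<ge> 0" "c \<ge> 0"
    using quotient_of_div[OF ab] quotient_of_div[OF cd] assms \<open>b > 0\<close> \<open>d > 0\<close>
    by (auto simp: zero_le_divide_iff)
  moreover have "nat a = nat c" "nat b = nat d"
    using assms(1) ab cd by (auto simp: enc_rat_def)
  ultimately have "a = c" "b = d" by auto
  then show ?thesis using quotient_of_div[OF ab] quotient_of_div[OF cd] by simp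
qed

lemma enc_list_inject:
  assumes "enc_list f xs = enc_list g xs" "x \<in> set xs"
  shows "f x = g x"
  using assms by (induction xs) (auto simp: enc_list_def)

text \<open>
  Encodings determine the yes-instances, so algorithms for the problem exist and reductions to it
  are not vacuous.
\<close>

lemma traveling_salesperson_solvable: "\<exists>orc. solves orc traveling_salesperson"
proof -
  let ?P = traveling_salesperson
  have yes: "answer ?P x y \<longleftrightarrow> answer ?P x' y"
    if "x \<in> instances ?P" "x' \<in> instances ?P" "encode ?P x = encode ?P x'" for x x' y
  proof -
    obtain n d C n' d' C' where x: "x = (n, d, C)" and x': "x' = (n', d', C')"
      by (metis prod_cases3)
    have n: "n' = n" and C: "enc_rat C = enc_rat C'"
      using that(3) by (auto simp: x x' traveling_salesperson_def decision_problem_def)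
    have l: "enc_list (\<lambda>i. enc_list (\<lambda>j. enc_rat (d i j)) [0..<n]) [0..<n] =
        enc_list (\<lambda>i. enc_list (\<lambda>j. enc_rat (d' i j)) [0..<n]) [0..<n]"
      using that(3) by (auto simp: x x' traveling_salesperson_def decision_problem_def)
    have d: "d i j = d' i j" if ij: "i < n" "j < n" for i j
    proof -
      have "enc_rat (d i j) = enc_rat (d' i j)"
        using enc_list_inject[OF enc_list_inject[OF l, of i], of j] ij by simp
      then show ?thesis
        using that \<open>x \<in> _\<close> \<open>x' \<in> _\<close> ij
        by (intro enc_rat_inject)
          (auto simp: x x' n traveling_salesperson_def decision_problem_def)
    qed
    have "C = C'"
      using C that(1,2) by (intro enc_rat_inject)
        (auto simp: x x' traveling_salesperson_def decision_problem_def)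
    moreover have "tour_length d p = tour_length d' p" if "tour n p" for p
    proof -
      have "p ! i < n" if "i < length p" for i
        using that \<open>tour n p\<close> nth_mem[of i p] by (auto simp: tour_def)
      moreover have "Suc i mod length p < length p" if "i < length p" for i
        using that by (intro mod_less_divisor) auto
      ultimately show ?thesis
        unfolding tour_length_def by (intro sum.cong) (auto intro!: d)
    qed
    ultimately show ?thesis
      by (auto simp: x x' n traveling_salesperson_def decision_problem_def)
  qed
  define orc where "orc z = Some (SOME y. \<exists>x\<in>instances ?P. encode ?P x = z \<and> answer ?P x y)" for z
  have "answer ?P x (SOME y. \<exists>x'\<in>instances ?P. encode ?P x' = encode ?P x \<and> answer ?P x' y)"
    if x: "x \<in> instances ?P" for x
  proof -
    have "\<exists>y. answer ?P x y"
      by (auto simp: traveling_salesperson_def decision_problem_def)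
    then have "\<exists>y. \<exists>x'\<in>instances ?P. encode ?P x' = encode ?P x \<and> answer ?P x' y"
      using x by blast
    from someI_ex[OF this] show ?thesis using yes x by blast
  qed
  then have "solves orc ?P" by (auto simp: solves_def orc_def)
  then show ?thesis by (rule exI[of "\<lambda>orc. solves orc ?P"])
qed

end

theory Submission
  imports Defs
begin

text \<open>
  An exactly-double threading visits each vertex \<open>v\<close> in turns that form a connected 2-regular
  multigraph on the edges at \<open>v\<close>, that is, a cyclic order of these edges. Conversely any choice of
  one cyclic order per vertex is realised by a single closed walk: the two traversals of an edge
  can be joined to the turns at its two ends in two ways, and as long as the turns do not all lie
  on one closed walk, two closed walks share an edge and can be merged there. So the minimum cost
  is the sum over the vertices of the optimal tour lengths of independent instances of the
  Traveling Salesperson problem. In one direction, a complete graph in which only the turns at a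
  single vertex are costly encodes an arbitrary instance. In the other direction, the costs are
  scaled to integers and perturbed so that the optimal length, found by binary search, also
  encodes an optimal tour.
\<close>

section \<open>Polynomial-time computability\<close>

text \<open>A reduction has to be an actual program, with a polynomial cost bound that is the same
  for all oracles. Programs are not written out: closure properties of computability from an
  encoding are proved, and each later function is assembled from its subterms. The delicate point is
  the size of intermediate values, so loops carry an explicit bound on their state as a premise. The
  oracle only says yes or no, hence the optimal value is all that can be extracted from it. A pair
  occurs at most twice in a cycle, and twice exactly at a vertex of degree 2, so base 4 digits never
  carry. The digits give multiplicities of turns; no optimal tour is ever written down as a list.
  The walk is therefore traced from multiplicities alone. Instead of merging closed walks, a single
  path grows greedily and is rotated whenever it is stuck. This one procedure serves twice: it
  proves that prescribed cyclic orders are realisable, and, run for a fixed number of steps, it is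
  the program that outputs the threading.\<close>

lemma poly_nat_mono:
  fixes T :: "nat poly"
  assumes "x \<le> y"
  shows "poly T x \<le> poly T y"
  by (induction T) (auto intro!: mult_mono assms)

lemma data_size_left: "data_size (left x) \<le> data_size x"
  by (cases x) (auto simp: floorlog_def)

lemma data_size_right: "data_size (right x) \<le> data_size x"
  by (cases x) (auto simp: floorlog_def)

lemma eval_size: "eval orc \<rho> p v t \<Longrightarrow> data_size v \<le> t"
  by (induction rule: eval.induct) auto

text \<open>Variables are counted from the front, so a run that succeeds never looks at values
  appended behind the environment. Programs can thus be built for a one-element environment and used
  below further binders.\<close>

lemma eval_weaken: "eval orc \<rho> p v t \<Longrightarrow> eval orc (\<rho> @ \<rho>') p v t"
proof (induction rule: eval.induct)
  case (eval_Var i \<rho>)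
  then show ?case using eval.eval_Var[of i "\<rho> @ \<rho>'" orc] by (simp add: nth_append)
qed (unfold append_Cons, (blast intro: eval.intros)+)

lemma eval_weaken_single: "eval orc [x] p v t \<Longrightarrow> eval orc (x # \<rho>) p v t"
  using eval_weaken[of orc "[x]"] by simp

lemma floorlog2_add: "floorlog 2 (m + n) \<le> Suc (floorlog 2 m + floorlog 2 n)"
proof (rule floorlog_leI)
  have "m < 2 ^ floorlog 2 m" "n < 2 ^ floorlog 2 n" by (auto intro: floorlog_leD)
  moreover have "(2::nat) ^ floorlog 2 m \<le> 2 ^ (floorlog 2 m + floorlog 2 n)"
    "(2::nat) ^ floorlog 2 n \<le> 2 ^ (floorlog 2 m + floorlog 2 n)"
    by (auto intro!: power_increasing)
  ultimately show "m + n < 2 ^ Suc (floorlog 2 m + floorlog 2 n)"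
    unfolding power_Suc by linarith
qed auto

lemma floorlog2_mult: "floorlog 2 (m * n) \<le> floorlog 2 m + floorlog 2 n"
proof (rule floorlog_leI)
  have "m < 2 ^ floorlog 2 m" "n < 2 ^ floorlog 2 n" by (auto intro: floorlog_leD)
  then show "m * n < 2 ^ (floorlog 2 m + floorlog 2 n)"
    by (auto simp: power_add intro!: mult_strict_mono)
qed auto

text \<open>The second leaf contributes a spare unit, which absorbs the carry of an addition.
  Because the bound is additive with no extra constant, iterated arithmetic only adds up the sizes
  of its operands.\<close>

lemma data_size_arith:
  "data_size (Leaf (arith_fun f m n)) \<le> data_size (Leaf m) + data_size (Leaf n)"
proof (cases f)
  case Leq
  then show ?thesis by (auto simp: of_bool_def floorlog_def)
next
  case Add
  then show ?thesis using floorlog2_add[of m n] by simp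
next
  case Mul
  then show ?thesis using floorlog2_mult[of m n] by simp
qed (auto intro!: trans_le_add1 floorlog_mono le_SucI)

section \<open>Polynomial bounds in the size of an encoding\<close>

definition poly_bounded :: "'a set \<Rightarrow> ('a \<Rightarrow> data) \<Rightarrow> ('a \<Rightarrow> nat) \<Rightarrow> bool" where
  "poly_bounded X e k \<longleftrightarrow> (\<exists>T :: nat poly. \<forall>a\<in>X. k a \<le> poly T (data_size (e a)))"

lemma bounded_size: "poly_bounded X e (\<lambda>a. data_size (e a))"
  unfolding poly_bounded_def by (intro exI[of _ "[:0, 1:]"]) auto

lemma bounded_const: "poly_bounded X e (\<lambda>_. n)"
  unfolding poly_bounded_def by (intro exI[of _ "[:n:]"]) auto

lemma bounded_mono: "poly_bounded X e k \<Longrightarrow> (\<And>a. a \<in> X \<Longrightarrow> k' a \<le> k a) \<Longrightarrow> poly_bounded X e k'"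
  unfolding poly_bounded_def by (meson order_trans)

lemma bounded_add: "poly_bounded X e k \<Longrightarrow> poly_bounded X e k' \<Longrightarrow> poly_bounded X e (\<lambda>a. k a + k' a)"
  unfolding poly_bounded_def
proof (elim exE)
  fix T T' :: "nat poly"
  assume "\<forall>a\<in>X. k a \<le> poly T (data_size (e a))" "\<forall>a\<in>X. k' a \<le> poly T' (data_size (e a))"
  then show "\<exists>T. \<forall>a\<in>X. k a + k' a \<le> poly T (data_size (e a))"
    by (intro exI[of _ "T + T'"]) (auto intro: add_mono)
qed

lemma bounded_Suc: "poly_bounded X e k \<Longrightarrow> poly_bounded X e (\<lambda>a. Suc (k a))"
  using bounded_add[OF bounded_const[of _ _ 1]] by simp

lemma bounded_mult: "poly_bounded X e k \<Longrightarrow> poly_bounded X e k' \<Longrightarrow> poly_bounded X e (\<lambda>a. k a * k' a)"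
  unfolding poly_bounded_def
proof (elim exE)
  fix T T' :: "nat poly"
  assume "\<forall>a\<in>X. k a \<le> poly T (data_size (e a))" "\<forall>a\<in>X. k' a \<le> poly T' (data_size (e a))"
  then show "\<exists>T. \<forall>a\<in>X. k a * k' a \<le> poly T (data_size (e a))"
    by (intro exI[of _ "T * T'"]) (auto intro: mult_mono)
qed

text \<open>Polynomials over the naturals are monotone, so a bound on the size of \<open>f a\<close>
  may be substituted into a bound that is expressed in this size.\<close>

lemma bounded_trans:
  assumes "poly_bounded X e (\<lambda>a. data_size (f a))" "poly_bounded X f k"
  shows "poly_bounded X e k"
proof -
  obtain T T' where
    T: "\<forall>a\<in>X. data_size (f a) \<le> poly T (data_size (e a))" and
    T': "\<forall>a\<in>X. k a \<le> poly T' (data_size (f a))"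
    using assms unfolding poly_bounded_def by blast
  have "k a \<le> poly (pcompose T' T) (data_size (e a))" if "a \<in> X" for a
    using T T' that poly_nat_mono[of "data_size (f a)" "poly T (data_size (e a))" T']
    by (force simp: poly_pcompose)
  then show ?thesis unfolding poly_bounded_def by blast
qed

lemma bounded_poly: "poly_bounded X e k \<Longrightarrow> poly_bounded X e (\<lambda>a. poly T (k a))"
  unfolding poly_bounded_def
proof (elim exE)
  fix T' :: "nat poly"
  assume "\<forall>a\<in>X. k a \<le> poly T' (data_size (e a))"
  then show "\<exists>T'. \<forall>a\<in>X. poly T (k a) \<le> poly T' (data_size (e a))"
    by (intro exI[of _ "pcompose T T'"]) (auto simp: poly_pcompose intro: poly_nat_mono)
qed

lemma bounded_reindex:
  "poly_bounded X e k \<Longrightarrow> (\<And>z. z \<in> Y \<Longrightarrow> h z \<in> X) \<Longrightarrow>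
    poly_bounded Y (\<lambda>z. e (h z)) (\<lambda>z. k (h z))"
  unfolding poly_bounded_def by blast

lemma bounded_enlarge:
  assumes "poly_bounded X e k" "\<And>a. a \<in> X \<Longrightarrow> data_size (e a) \<le> data_size (e' a)"
  shows "poly_bounded X e' k"
  using assms unfolding poly_bounded_def by (meson order_trans poly_nat_mono)

lemma bounded_weak:
  "poly_bounded X e k \<Longrightarrow> (\<And>z. z \<in> Y \<Longrightarrow> fst z \<in> X) \<Longrightarrow>
    poly_bounded Y (\<lambda>z. Node (e (fst z)) (q z)) (\<lambda>z. k (fst z))"
  by (rule bounded_enlarge, rule bounded_reindex) auto

section \<open>Programs running in polynomial time, uniformly over a set of oracles\<close>

locale oracles =
  fixes Os :: "(data \<rightharpoonup> data) set"
  assumes nonempty: "Os \<noteq> {}"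
begin

text \<open>One program and one polynomial serve all oracles in \<open>Os\<close>, and the result
  \<open>f a\<close> does not mention the oracle. The set is \<open>{Map.empty}\<close> for many-one
  reductions and the set of all solvers for Turing reductions.\<close>

abbreviation runs :: "prog \<Rightarrow> nat poly \<Rightarrow> 'a set \<Rightarrow> ('a \<Rightarrow> data) \<Rightarrow> ('a \<Rightarrow> data) \<Rightarrow> bool" where
  "runs p T X e f \<equiv> \<forall>orc\<in>Os. \<forall>a\<in>X. \<exists>t.
     eval orc [e a] p (f a) t \<and> t \<le> poly T (data_size (e a))"

text \<open>
  The program sees only the encoding \<open>e a\<close>. Letting \<open>a\<close> range over an arbitrary type allows
  contexts with several variables, which are tuples encoded componentwise.
\<close>

definition ptime :: "'a set \<Rightarrow> ('a \<Rightarrow> data) \<Rightarrow> ('a \<Rightarrow> data) \<Rightarrow> bool" where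
  "ptime X e f \<longleftrightarrow> (\<exists>p T. runs p T X e f)"

lemma ptimeI:
  assumes "\<And>orc a. orc \<in> Os \<Longrightarrow> a \<in> X \<Longrightarrow>
    \<exists>t. eval orc [e a] p (f a) t \<and> t \<le> poly T (data_size (e a))"
  shows "ptime X e f"
  unfolding ptime_def using assms by blast

lemma ptimeE:
  assumes "ptime X e f"
  obtains p T where "runs p T X e f"
  using assms unfolding ptime_def by blast

text \<open>Producing a value costs at least its size, so the time bound is also a size bound. This
  takes one actual run, hence some oracle.\<close>

lemma ptime_size:
  assumes "ptime X e f"
  shows "poly_bounded X e (\<lambda>a. data_size (f a))"
proof -
  obtain orc where "orc \<in> Os" using nonempty by blast
  moreover obtain p T where "runs p T X e f" using assms by (rule ptimeE)
  ultimately show ?thesis unfolding poly_bounded_def by (meson eval_size order_trans)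
qed

lemma ptime_id: "ptime X e e"
proof (rule ptimeI)
  fix orc a
  show "\<exists>t. eval orc [e a] (Var 0) (e a) t \<and> t \<le> poly [:0, 1:] (data_size (e a))"
    using eval_Var[of 0 "[e a]" orc] by auto
qed

lemma ptime_nat: "ptime X e (\<lambda>_. Leaf n)"
proof (rule ptimeI)
  fix orc a
  show "\<exists>t. eval orc [e a] (Const n) (Leaf n) t \<and> t \<le> poly [:data_size (Leaf n):] (data_size (e a))"
    using eval_Const[of orc "[e a]" n] by auto
qed

text \<open>\<open>Bind\<close> puts the intermediate value in front of the input, and the second
  program, built for that value alone, tolerates the input behind it. The bounds compose since the
  size of \<open>f a\<close> is at most the cost of computing it. The intermediate result
  \<open>f\<close> plays the role of an encoding in the second premise.\<close>

lemma ptime_trans: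
  assumes "ptime X e f" "ptime X f g"
  shows "ptime X e g"
proof -
  obtain p T where p: "runs p T X e f" using assms(1) by (rule ptimeE)
  obtain q U where q: "runs q U X f g" using assms(2) by (rule ptimeE)
  show ?thesis
  proof (rule ptimeI)
    fix orc a assume *: "orc \<in> Os" "a \<in> X"
    obtain s where s: "eval orc [e a] p (f a) s" "s \<le> poly T (data_size (e a))"
      using p * by blast
    obtain t where t: "eval orc [f a] q (g a) t" "t \<le> poly U (data_size (f a))"
      using q * by blast
    have "eval orc [f a, e a] q (g a) t" using t(1) by (rule eval_weaken_single)
    with s(1) have "eval orc [e a] (Bind p q) (g a) (s + t + 1)" by (rule eval_Bind)
    moreover have "t \<le> poly U (poly T (data_size (e a)))"
      using t(2) s poly_nat_mono[of "data_size (f a)" "poly T (data_size (e a))" U]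
        eval_size[OF s(1)] by linarith
    ultimately show "\<exists>t. eval orc [e a] (Bind p q) (g a) t \<and>
        t \<le> poly (T + pcompose U T + 1) (data_size (e a))"
      using s(2) by (auto simp: poly_pcompose)
  qed
qed

text \<open>A program sees \<open>e a\<close> and not \<open>a\<close>, so the same program works
  however the inputs are indexed.\<close>

lemma ptime_reindex:
  assumes "ptime X e f" "\<And>z. z \<in> Y \<Longrightarrow> h z \<in> X"
  shows "ptime Y (\<lambda>z. e (h z)) (\<lambda>z. f (h z))"
  using assms unfolding ptime_def by blast

lemma ptime_subset:
  assumes "ptime X e f" "Y \<subseteq> X"
  shows "ptime Y e f"
  using ptime_reindex[OF assms(1), of Y "\<lambda>z. z"] assms(2) by blast

lemma ptime_cong:
  assumes "ptime X e f" "\<And>a. a \<in> X \<Longrightarrow> f' a = f a"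
  shows "ptime X e f'"
  using assms unfolding ptime_def by simp

lemma ptime_pair:
  assumes "ptime X e f" "ptime X e g"
  shows "ptime X e (\<lambda>a. Node (f a) (g a))"
proof -
  obtain p T where p: "runs p T X e f" using assms(1) by (rule ptimeE)
  obtain q U where q: "runs q U X e g" using assms(2) by (rule ptimeE)
  show ?thesis
  proof (rule ptimeI)
    fix orc a assume *: "orc \<in> Os" "a \<in> X"
    obtain s where s: "eval orc [e a] p (f a) s" "s \<le> poly T (data_size (e a))"
      using p * by blast
    obtain t where t: "eval orc [e a] q (g a) t" "t \<le> poly U (data_size (e a))"
      using q * by blast
    show "\<exists>t. eval orc [e a] (MkNode p q) (Node (f a) (g a)) t \<and>
        t \<le> poly (T + T + U + U + 1) (data_size (e a))"
      using eval_MkNode[OF s(1) t(1)] s(2) t(2) eval_size[OF s(1)] eval_size[OF t(1)]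
      by (intro exI conjI) (assumption, simp)
  qed
qed

lemma ptime_unary:
  assumes "ptime X e f"
    and eval: "\<And>orc \<rho> q u t. eval orc \<rho> q u t \<Longrightarrow> eval orc \<rho> (c q) (F u) (t + data_size (F u))"
    and size: "\<And>u. data_size (F u) \<le> data_size u + 2"
  shows "ptime X e (\<lambda>a. F (f a))"
proof -
  obtain p T where p: "runs p T X e f" using assms(1) by (rule ptimeE)
  show ?thesis
  proof (rule ptimeI)
    fix orc a assume *: "orc \<in> Os" "a \<in> X"
    obtain s where s: "eval orc [e a] p (f a) s" "s \<le> poly T (data_size (e a))"
      using p * by blast
    show "\<exists>t. eval orc [e a] (c p) (F (f a)) t \<and> t \<le> poly (T + T + [:2:]) (data_size (e a))"
      using eval[OF s(1)] s(2) eval_size[OF s(1)] size[of "f a"] by (intro exI conjI) (assumption, simp)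
  qed
qed

lemma ptime_left: "ptime X e f \<Longrightarrow> ptime X e (\<lambda>a. left (f a))"
  by (erule ptime_unary[where c = Left], erule eval_Left, rule trans_le_add1, rule data_size_left)

lemma ptime_right: "ptime X e f \<Longrightarrow> ptime X e (\<lambda>a. right (f a))"
  by (erule ptime_unary[where c = Right], erule eval_Right, rule trans_le_add1, rule data_size_right)

lemma ptime_is_node: "ptime X e f \<Longrightarrow> ptime X e (\<lambda>a. Leaf (of_bool (is_node (f a))))"
  by (erule ptime_unary[where c = IsNode and F = "\<lambda>u. Leaf (of_bool (is_node u))"])
    (rule eval_IsNode[OF _ refl], assumption, simp add: of_bool_def floorlog_def)

lemma ptime_arith:
  assumes "ptime X e (\<lambda>a. Leaf (m a))" "ptime X e (\<lambda>a. Leaf (n a))"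
  shows "ptime X e (\<lambda>a. Leaf (arith_fun op (m a) (n a)))"
proof -
  obtain p T where p: "runs p T X e (\<lambda>a. Leaf (m a))" using assms(1) by (rule ptimeE)
  obtain q U where q: "runs q U X e (\<lambda>a. Leaf (n a))" using assms(2) by (rule ptimeE)
  show ?thesis
  proof (rule ptimeI)
    fix orc a assume *: "orc \<in> Os" "a \<in> X"
    obtain s where s: "eval orc [e a] p (Leaf (m a)) s" "s \<le> poly T (data_size (e a))"
      using p * by blast
    obtain t where t: "eval orc [e a] q (Leaf (n a)) t" "t \<le> poly U (data_size (e a))"
      using q * by blast
    have "eval orc [e a] (Arith op p q) (Leaf (arith_fun op (m a) (n a)))
       (s + t + data_size (Leaf (arith_fun op (m a) (n a))))"
      using eval_Arith[OF s(1) t(1) refl] by simp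
    moreover have "s + t + data_size (Leaf (arith_fun op (m a) (n a)))
        \<le> poly (T + T + U + U) (data_size (e a))"
      using s(2) t(2) eval_size[OF s(1)] eval_size[OF t(1)] data_size_arith[of op "m a" "n a"]
      unfolding poly_add by linarith
    ultimately show "\<exists>t. eval orc [e a] (Arith op p q) (Leaf (arith_fun op (m a) (n a))) t \<and>
        t \<le> poly (T + T + U + U) (data_size (e a))" by blast
  qed
qed

text \<open>Each branch needs to be computable only where it is taken. This matters for table
  accesses that are in range only under the condition.\<close>

lemma ptime_if:
  assumes "ptime X e (\<lambda>a. Leaf (of_bool (b a)))"
    "ptime {a \<in> X. b a} e f" "ptime {a \<in> X. \<not> b a} e g"
  shows "ptime X e (\<lambda>a. if b a then f a else g a)"
proof -
  obtain r S where r: "runs r S X e (\<lambda>a. Leaf (of_bool (b a)))" using assms(1) by (rule ptimeE)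
  obtain p T where p: "runs p T {a \<in> X. b a} e f" using assms(2) by (rule ptimeE)
  obtain q U where q: "runs q U {a \<in> X. \<not> b a} e g" using assms(3) by (rule ptimeE)
  show ?thesis
  proof (rule ptimeI)
    fix orc a assume *: "orc \<in> Os" "a \<in> X"
    obtain s where s: "eval orc [e a] r (Leaf (of_bool (b a))) s" "s \<le> poly S (data_size (e a))"
      using r * by blast
    show "\<exists>t. eval orc [e a] (Cond r p q) (if b a then f a else g a) t \<and>
        t \<le> poly (S + T + U + 1) (data_size (e a))"
    proof (cases "b a")
      case True
      then obtain t where t: "eval orc [e a] p (f a) t" "t \<le> poly T (data_size (e a))"
        using p * by blast
      have "eval orc [e a] (Cond r p q) (f a) (s + t + 1)"
        using eval_Cond_true[OF s(1) _ t(1)] True by simp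
      then show ?thesis using s(2) t(2) True by (intro exI conjI) (simp, simp)
    next
      case False
      then obtain t where t: "eval orc [e a] q (g a) t" "t \<le> poly U (data_size (e a))"
        using q * by blast
      have "eval orc [e a] (Cond r p q) (g a) (s + t + 1)"
        using eval_Cond_false[OF _ t(1)] s(1) False by simp
      then show ?thesis using s(2) t(2) False by (intro exI conjI) (simp, simp)
    qed
  qed
qed

text \<open>All oracles must give the same answer \<open>g a\<close> to the query, which holds for
  decision problems. The size of the answer is bounded separately because reading it is charged to
  the run.\<close>

lemma ptime_query:
  assumes "ptime X e f" "\<And>orc a. orc \<in> Os \<Longrightarrow> a \<in> X \<Longrightarrow> orc (f a) = Some (g a)"
    "poly_bounded X e (\<lambda>a. data_size (g a))"
  shows "ptime X e g"
proof -
  obtain p T where p: "runs p T X e f" using assms(1) by (rule ptimeE)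
  obtain U where U: "\<forall>a\<in>X. data_size (g a) \<le> poly U (data_size (e a))"
    using assms(3) unfolding poly_bounded_def by blast
  show ?thesis
  proof (rule ptimeI)
    fix orc a assume *: "orc \<in> Os" "a \<in> X"
    obtain s where s: "eval orc [e a] p (f a) s" "s \<le> poly T (data_size (e a))"
      using p * by blast
    show "\<exists>t. eval orc [e a] (Query p) (g a) t \<and> t \<le> poly (T + U) (data_size (e a))"
      using eval_Query[OF s(1) assms(2)[OF *]] s(2) U *
      by (intro exI conjI) (assumption, simp add: add_mono)
  qed
qed

text \<open>The loop state is the input, which stays available, together with \<open>D a i\<close>.
  The round \<open>i\<close> is visible only as far as \<open>D a i\<close> shows it, so test and
  step are computed from that pair. A cheap step could still double the state in every round, hence
  the bound on all \<open>D a i\<close>.\<close>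

lemma ptime_while:
  fixes D :: "'a \<Rightarrow> nat \<Rightarrow> data"
  assumes k: "poly_bounded X e k"
    and D: "poly_bounded {z. fst z \<in> X \<and> snd z \<le> k (fst z)} (\<lambda>z. e (fst z))
      (\<lambda>z. data_size (D (fst z) (snd z)))"
    and init: "ptime X e (\<lambda>a. D a 0)"
    and test: "ptime {z. fst z \<in> X \<and> snd z \<le> k (fst z)} (\<lambda>z. Node (e (fst z)) (D (fst z) (snd z)))
      (\<lambda>z. Leaf (of_bool (snd z < k (fst z))))"
    and step: "ptime {z. fst z \<in> X \<and> snd z < k (fst z)} (\<lambda>z. Node (e (fst z)) (D (fst z) (snd z)))
      (\<lambda>z. D (fst z) (Suc (snd z)))"
  shows "ptime X e (\<lambda>a. D a (k a))"
proof -
  obtain K where K: "\<And>a. a \<in> X \<Longrightarrow> k a \<le> poly K (data_size (e a))"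
    using k unfolding poly_bounded_def by blast
  obtain B where B: "\<And>a i. a \<in> X \<Longrightarrow> i \<le> k a \<Longrightarrow> data_size (D a i) \<le> poly B (data_size (e a))"
    using D unfolding poly_bounded_def by auto
  obtain p T where p: "runs p T X e (\<lambda>a. D a 0)" using init by (rule ptimeE)
  let ?e = "\<lambda>z. Node (e (fst z)) (D (fst z) (snd z))"
  obtain c U where c: "runs c U {z. fst z \<in> X \<and> snd z \<le> k (fst z)} ?e
      (\<lambda>z. Leaf (of_bool (snd z < k (fst z))))" using test by (rule ptimeE)
  obtain b V where b: "runs b V {z. fst z \<in> X \<and> snd z < k (fst z)} ?e
      (\<lambda>z. D (fst z) (Suc (snd z)))" using step by (rule ptimeE)
  define b' where "b' = MkNode (Left (Var 0)) b"
  \<comment> \<open>\<open>M\<close> bounds the size of the loop state, and \<open>Z\<close> the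
    cost of one round consisting of test and body, as well as the cost of the final failing
    test.\<close>
  define M where "M = [:1, 1:] + B"
  define Z where "Z = pcompose U M + pcompose V M + smult 4 M + 1"
  show ?thesis
  proof (rule ptimeI)
    fix orc a assume *: "orc \<in> Os" "a \<in> X"
    let ?x = "data_size (e a)"
    let ?s = "\<lambda>i. Node (e a) (D a i)"
    have size: "data_size (?s i) \<le> poly M ?x" if "i \<le> k a" for i
      using B[OF *(2) that] by (simp add: M_def)
    have test': "\<exists>t. eval orc (?s i # \<rho>) c (Leaf (of_bool (i < k a))) t \<and> t \<le> poly (pcompose U M) ?x"
      if "i \<le> k a" for i \<rho>
    proof -
      have ai: "(a, i) \<in> {z. fst z \<in> X \<and> snd z \<le> k (fst z)}" using *(2) that by simp
      obtain t where t: "eval orc [?s i] c (Leaf (of_bool (i < k a))) t" "t \<le> poly U (data_size (?s i))"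
        using c[rule_format, OF *(1) ai, unfolded fst_conv snd_conv] by blast
      then show ?thesis
        using eval_weaken_single[OF t(1)] poly_nat_mono[OF size[OF that], of U]
        unfolding poly_pcompose by (meson order_trans)
    qed
    have step': "\<exists>t. eval orc (?s i # \<rho>) b' (?s (Suc i)) t \<and>
        t \<le> poly (pcompose V M + smult 3 M) ?x" if "i < k a" for i \<rho>
    proof -
      have ai: "(a, i) \<in> {z. fst z \<in> X \<and> snd z < k (fst z)}" using *(2) that by simp
      obtain t where t: "eval orc [?s i] b (D a (Suc i)) t" "t \<le> poly V (data_size (?s i))"
        using b[rule_format, OF *(1) ai, unfolded fst_conv snd_conv] by blast
      have "eval orc (?s i # \<rho>) (Left (Var 0)) (e a) (data_size (?s i) + data_size (e a))"
        using eval_Left[OF eval_Var[of 0 "?s i # \<rho>" orc]] by simp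
      from eval_MkNode[OF this eval_weaken_single[OF t(1)]]
      have ev: "eval orc (?s i # \<rho>) b' (?s (Suc i))
        (data_size (?s i) + data_size (e a) + t + data_size (?s (Suc i)))"
        unfolding b'_def .
      have "poly V (data_size (?s i)) \<le> poly V (poly M ?x)"
        using size[of i] that by (intro poly_nat_mono) auto
      moreover have "data_size (e a) \<le> poly M ?x" by (simp add: M_def)
      ultimately have "data_size (?s i) + data_size (e a) + t + data_size (?s (Suc i)) \<le>
          poly (pcompose V M + smult 3 M) ?x"
        using size[of i] size[of "Suc i"] that t(2)
        by (simp add: poly_pcompose del: data_size.simps)
      with ev show ?thesis by blast
    qed
    have loop: "\<exists>t. eval orc (?s i # \<rho>) (While c b') (?s (k a)) t \<and> t \<le> Suc (k a - i) * poly Z ?x"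
      if "i \<le> k a" for i \<rho>
      using that
    proof (induction "k a - i" arbitrary: i)
      case 0
      then have i: "i = k a" by simp
      obtain s where "eval orc (?s i # \<rho>) c (Leaf (of_bool (i < k a))) s" "s \<le> poly (pcompose U M) ?x"
        using test'[OF 0(2)] by blast
      then show ?case
        using size[OF 0(2)] i eval_While_false[of orc "?s i" \<rho> c s b']
        by (intro exI[of _ "s + data_size (?s i)"]) (simp add: Z_def del: data_size.simps)
    next
      case (Suc j)
      then have i: "i < k a" and j: "j = k a - Suc i" by simp_all
      obtain s where s: "eval orc (?s i # \<rho>) c (Leaf 1) s" "s \<le> poly (pcompose U M) ?x"
        using test'[OF Suc(3)] i by force
      obtain t where t: "eval orc (?s i # \<rho>) b' (?s (Suc i)) t"
        "t \<le> poly (pcompose V M + smult 3 M) ?x"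
        using step'[OF i] by blast
      obtain w where w: "eval orc (?s (Suc i) # \<rho>) (While c b') (?s (k a)) w"
        "w \<le> Suc (k a - Suc i) * poly Z ?x"
        using Suc(1)[OF j] i by auto
      have ev: "eval orc (?s i # \<rho>) (While c b') (?s (k a)) (s + t + w + 1)"
        using eval_While_true[OF s(1) _ t(1) w(1)] by simp
      have "s + t + 1 \<le> poly Z ?x" using s(2) t(2) by (simp add: Z_def)
      moreover have "Suc (k a - i) = Suc (Suc (k a - Suc i))" using i by simp
      ultimately have "s + t + w + 1 \<le> Suc (k a - i) * poly Z ?x" using w(2) by simp
      with ev show ?case by blast
    qed
    obtain s where s: "eval orc [e a] p (D a 0) s" "s \<le> poly T ?x" using p * by blast
    have "eval orc [e a] (Var 0) (e a) ?x" using eval_Var[of 0 "[e a]" orc] by simp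
    from eval_MkNode[OF this s(1)]
    have init': "eval orc [e a] (MkNode (Var 0) p) (?s 0) (?x + s + data_size (?s 0))" .
    obtain w where w: "eval orc [?s 0, e a] (While c b') (?s (k a)) w" "w \<le> Suc (k a) * poly Z ?x"
      using loop[of 0 "[e a]"] by auto
    \<comment> \<open>\<open>While\<close> works on variable 0, so the initial state is bound first;
      \<open>Right\<close> then strips the input from the final state.\<close>
    have ev: "eval orc [e a] (Bind (MkNode (Var 0) p) (Right (While c b'))) (D a (k a))
      (?x + s + data_size (?s 0) + (w + data_size (D a (k a))) + 1)"
      using eval_Bind[OF init' eval_Right[OF w(1)]] by simp
    have "w \<le> poly ((1 + K) * Z) ?x"
    proof -
      have "Suc (k a) * poly Z ?x \<le> poly ((1 + K) * Z) ?x"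
        unfolding poly_mult using K[OF *(2)] by (intro mult_right_mono) auto
      with w(2) show ?thesis by linarith
    qed
    moreover have "data_size (D a (k a)) \<le> poly M ?x"
      using size[of "k a"] by simp
    moreover have "?x \<le> poly M ?x" by (simp add: M_def)
    ultimately have "?x + s + data_size (?s 0) + (w + data_size (D a (k a))) + 1 \<le>
        poly (T + smult 3 M + (1 + K) * Z + 1) ?x"
      using s(2) size[of 0] by (simp del: data_size.simps poly_mult)
    with ev show "\<exists>t. eval orc [e a] (Bind (MkNode (Var 0) p) (Right (While c b'))) (D a (k a)) t \<and>
        t \<le> poly (T + smult 3 M + (1 + K) * Z + 1) ?x" by blast
  qed
qed

end

section \<open>Encoded lists and contexts with loop indices\<close>

lemma data_size_enc_list: "data_size (enc_list f xs) = 1 + (\<Sum>x\<leftarrow>xs. Suc (data_size (f x)))"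
  by (induction xs) (auto simp: enc_list_def floorlog_def)

lemma enc_list_Nil [simp]: "enc_list f [] = Leaf 0"
  and enc_list_Cons [simp]: "enc_list f (x # xs) = Node (f x) (enc_list f xs)"
  by (auto simp: enc_list_def)

lemma enc_list_map: "enc_list f (map g xs) = enc_list (\<lambda>x. f (g x)) xs"
  by (induction xs) auto

lemma enc_list_cong: "(\<And>x. x \<in> set xs \<Longrightarrow> f x = g x) \<Longrightarrow> enc_list f xs = enc_list g xs"
  by (induction xs) auto

lemma length_le_data_size: "length xs \<le> data_size (enc_list f xs)"
  by (induction xs) auto

lemma data_size_enc_list_drop: "data_size (enc_list f (drop i xs)) \<le> data_size (enc_list f xs)"
  by (induction xs arbitrary: i) (auto simp: drop_Cons' le_SucI trans_le_add2)

text \<open>True past the end as well, since the empty list is \<open>Leaf 0\<close> and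
  \<open>right\<close> maps it to itself.\<close>

lemma right_enc_list_drop: "right (enc_list f (drop i xs)) = enc_list f (drop (Suc i) xs)"
  by (cases "drop i xs") (auto simp: drop_Suc tl_drop[symmetric])

lemma data_size_enc_list_le:
  assumes "\<And>x. x \<in> set xs \<Longrightarrow> data_size (f x) \<le> B"
  shows "data_size (enc_list f xs) \<le> 1 + length xs * Suc B"
  using assms by (induction xs) (force simp: floorlog_def)+

lemma floorlog2_le: "floorlog 2 n \<le> n"
  by (intro floorlog_leI) auto

text \<open>A context is extended by an index below \<open>k\<close>, encoded as one more leaf next
  to the input. Nesting \<open>ext\<close> gives several index variables; \<open>base2\<close> and
  \<open>base3\<close> reach the input below two and three of them.\<close>

abbreviation idx :: "'a set \<Rightarrow> ('a \<Rightarrow> nat) \<Rightarrow> ('a \<times> nat) set" where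
  "idx X k \<equiv> {z. fst z \<in> X \<and> snd z < k (fst z)}"

abbreviation ext :: "('a \<Rightarrow> data) \<Rightarrow> 'a \<times> nat \<Rightarrow> data" where
  "ext e \<equiv> \<lambda>z. Node (e (fst z)) (Leaf (snd z))"

abbreviation "base2 z \<equiv> fst (fst z)"
abbreviation "base3 z \<equiv> fst (fst (fst z))"

text \<open>An index below \<open>k\<close> enlarges the encoding by at most \<open>k + 2\<close>,
  so a bound valid inside a loop body is a bound in terms of the input alone.\<close>

lemma bounded_ext:
  assumes "poly_bounded (idx X k) (ext e) h" "poly_bounded X e k"
  shows "poly_bounded (idx X k) (\<lambda>z. e (fst z)) h"
proof (rule bounded_trans)
  have "poly_bounded (idx X k) (\<lambda>z. e (fst z)) (\<lambda>z. data_size (e (fst z)) + (k (fst z) + 2))"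
    by (intro bounded_add bounded_const bounded_size bounded_reindex[OF assms(2)]) auto
  then show "poly_bounded (idx X k) (\<lambda>z. e (fst z)) (\<lambda>z. data_size (ext e z))"
    by (rule bounded_mono) (auto intro: order_trans[OF floorlog2_le])
  show "poly_bounded (idx X k) (ext e) h" by fact
qed

lemma bounded_sum:
  assumes "poly_bounded (idx X k) (ext e) (\<lambda>z. h (fst z) (snd z))" "poly_bounded X e k"
  shows "poly_bounded X e (\<lambda>a. \<Sum>i<k a. h a i)"
proof -
  obtain T where T: "\<And>a i. a \<in> X \<Longrightarrow> i < k a \<Longrightarrow> h a i \<le> poly T (data_size (e a))"
    using bounded_ext[OF assms] unfolding poly_bounded_def by force
  have "poly_bounded X e (\<lambda>a. k a * poly T (data_size (e a)))"
    by (intro bounded_mult assms bounded_poly bounded_size)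
  then show ?thesis
  proof (rule bounded_mono)
    fix a assume "a \<in> X"
    then have "(\<Sum>i<k a. h a i) \<le> (\<Sum>i<k a. poly T (data_size (e a)))"
      by (intro sum_mono T) auto
    then show "(\<Sum>i<k a. h a i) \<le> k a * poly T (data_size (e a))" by simp
  qed
qed

context oracles
begin

section \<open>Arithmetic, conditions and counted loops\<close>

lemma ptime_add: "ptime X e (\<lambda>a. Leaf (m a)) \<Longrightarrow> ptime X e (\<lambda>a. Leaf (n a)) \<Longrightarrow> ptime X e (\<lambda>a. Leaf (m a + n a))"
  using ptime_arith[of X e m n Add] by simp

lemma ptime_diff: "ptime X e (\<lambda>a. Leaf (m a)) \<Longrightarrow> ptime X e (\<lambda>a. Leaf (n a)) \<Longrightarrow> ptime X e (\<lambda>a. Leaf (m a - n a))"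
  using ptime_arith[of X e m n Sub] by simp

lemma ptime_mult: "ptime X e (\<lambda>a. Leaf (m a)) \<Longrightarrow> ptime X e (\<lambda>a. Leaf (n a)) \<Longrightarrow> ptime X e (\<lambda>a. Leaf (m a * n a))"
  using ptime_arith[of X e m n Mul] by simp

lemma ptime_div: "ptime X e (\<lambda>a. Leaf (m a)) \<Longrightarrow> ptime X e (\<lambda>a. Leaf (n a)) \<Longrightarrow> ptime X e (\<lambda>a. Leaf (m a div n a))"
  using ptime_arith[of X e m n Div] by simp

lemma ptime_mod:
  assumes "ptime X e (\<lambda>a. Leaf (m a))" "ptime X e (\<lambda>a. Leaf (n a))"
  shows "ptime X e (\<lambda>a. Leaf (m a mod n a))"
proof -
  have "ptime X e (\<lambda>a. Leaf (m a - m a div n a * n a))"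
    by (intro ptime_diff ptime_mult ptime_div assms)
  then show ?thesis by (simp add: minus_div_mult_eq_mod)
qed

lemma ptime_le:
  "ptime X e (\<lambda>a. Leaf (m a)) \<Longrightarrow> ptime X e (\<lambda>a. Leaf (n a)) \<Longrightarrow> ptime X e (\<lambda>a. Leaf (of_bool (m a \<le> n a)))"
  using ptime_arith[of X e m n Leq] by simp

lemma ptime_less:
  "ptime X e (\<lambda>a. Leaf (m a)) \<Longrightarrow> ptime X e (\<lambda>a. Leaf (n a)) \<Longrightarrow> ptime X e (\<lambda>a. Leaf (of_bool (m a < n a)))"
  using ptime_le[OF ptime_add[OF _ ptime_nat[of X e 1]]] by (simp add: Suc_le_eq)

lemma ptime_not:
  assumes "ptime X e (\<lambda>a. Leaf (of_bool (b a)))"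
  shows "ptime X e (\<lambda>a. Leaf (of_bool (\<not> b a)))"
  using ptime_diff[OF ptime_nat[of X e 1] assms] by (rule ptime_cong) auto

lemma ptime_conj:
  assumes "ptime X e (\<lambda>a. Leaf (of_bool (b a)))" "ptime X e (\<lambda>a. Leaf (of_bool (c a)))"
  shows "ptime X e (\<lambda>a. Leaf (of_bool (b a \<and> c a)))"
  using ptime_mult[OF assms] by (rule ptime_cong) auto

lemma ptime_disj:
  assumes "ptime X e (\<lambda>a. Leaf (of_bool (b a)))" "ptime X e (\<lambda>a. Leaf (of_bool (c a)))"
  shows "ptime X e (\<lambda>a. Leaf (of_bool (b a \<or> c a)))"
  using ptime_not[OF ptime_conj[OF assms[THEN ptime_not]]] by simp

lemma ptime_eq:
  assumes "ptime X e (\<lambda>a. Leaf (m a))" "ptime X e (\<lambda>a. Leaf (n a))"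
  shows "ptime X e (\<lambda>a. Leaf (of_bool (m a = n a)))"
  using ptime_conj[OF ptime_le[OF assms] ptime_le[OF assms(2,1)]] by (simp add: eq_iff)

text \<open>Selection by arithmetic as \<open>b * m + (1 - b) * n\<close>. In contrast to
  \<open>ptime_if\<close>, both branches are evaluated and must be computable on all of
  \<open>X\<close>.\<close>

lemma ptime_if_nat:
  assumes "ptime X e (\<lambda>a. Leaf (of_bool (b a)))" "ptime X e (\<lambda>a. Leaf (m a))" "ptime X e (\<lambda>a. Leaf (n a))"
  shows "ptime X e (\<lambda>a. Leaf (if b a then m a else n a))"
  using ptime_add[OF ptime_mult[OF assms(1,2)] ptime_mult[OF ptime_not[OF assms(1)] assms(3)]]
  by (rule ptime_cong) auto

lemma ptime_min:
  "ptime X e (\<lambda>a. Leaf (m a)) \<Longrightarrow> ptime X e (\<lambda>a. Leaf (n a)) \<Longrightarrow> ptime X e (\<lambda>a. Leaf (min (m a) (n a)))"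
  unfolding min_def by (intro ptime_if_nat ptime_le)

lemma ptime_max:
  "ptime X e (\<lambda>a. Leaf (m a)) \<Longrightarrow> ptime X e (\<lambda>a. Leaf (n a)) \<Longrightarrow> ptime X e (\<lambda>a. Leaf (max (m a) (n a)))"
  unfolding max_def by (intro ptime_if_nat ptime_le)

lemma ptime_fst: "ptime Y (\<lambda>z. Node (p z) (q z)) p"
  using ptime_left[OF ptime_id, of Y "\<lambda>z. Node (p z) (q z)"] by simp

lemma ptime_snd: "ptime Y (\<lambda>z. Node (p z) (q z)) q"
  using ptime_right[OF ptime_id, of Y "\<lambda>z. Node (p z) (q z)"] by simp

lemma ptime_weak:
  assumes "ptime X e f" "\<And>z. z \<in> Y \<Longrightarrow> fst z \<in> X"
  shows "ptime Y (\<lambda>z. Node (e (fst z)) (q z)) (\<lambda>z. f (fst z))"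
proof (rule ptime_trans[OF ptime_fst])
  show "ptime Y (\<lambda>z. e (fst z)) (\<lambda>z. f (fst z))" by (rule ptime_reindex[where h = fst, OF assms])
qed

text \<open>The counter is stored in the state, because \<open>ptime_while\<close> does not reveal
  the round. \<open>B\<close> bounds the accumulator at every stage of the loop.\<close>

lemma ptime_for:
  assumes k: "ptime X e (\<lambda>a. Leaf (k a))" and pb: "poly_bounded X e k"
    and init: "ptime X e (\<lambda>a. D a 0)"
    and step: "ptime (idx X k) (\<lambda>z. Node (e (fst z)) (Node (Leaf (snd z)) (D (fst z) (snd z))))
      (\<lambda>z. D (fst z) (Suc (snd z)))"
    and B: "poly_bounded X e B" "\<And>a i. a \<in> X \<Longrightarrow> i \<le> k a \<Longrightarrow> data_size (D a i) \<le> B a"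
  shows "ptime X e (\<lambda>a. D a (k a))"
proof -
  let ?D = "\<lambda>a i. Node (Leaf i) (D a i)"
  have "ptime X e (\<lambda>a. ?D a (k a))"
  proof (rule ptime_while[OF pb])
    have "poly_bounded {z. fst z \<in> X \<and> snd z \<le> k (fst z)} (\<lambda>z. e (fst z))
        (\<lambda>z. k (fst z) + B (fst z) + 2)"
      by (intro bounded_add bounded_const bounded_reindex[OF pb] bounded_reindex[OF B(1)]) auto
    then show "poly_bounded {z. fst z \<in> X \<and> snd z \<le> k (fst z)} (\<lambda>z. e (fst z))
        (\<lambda>z. data_size (?D (fst z) (snd z)))"
    proof (rule bounded_mono)
      fix z assume "z \<in> {z. fst z \<in> X \<and> snd z \<le> k (fst z)}"
      then show "data_size (?D (fst z) (snd z)) \<le> k (fst z) + B (fst z) + 2"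
        using B(2)[of "fst z" "snd z"] floorlog2_le[of "snd z"] by simp
    qed
    show "ptime X e (\<lambda>a. ?D a 0)" by (intro ptime_pair ptime_nat init)
    let ?e = "\<lambda>z. Node (e (fst z)) (?D (fst z) (snd z))"
    have i: "ptime Y ?e (\<lambda>z. Leaf (snd z))" for Y by (rule ptime_trans[OF ptime_snd ptime_fst])
    show "ptime {z. fst z \<in> X \<and> snd z \<le> k (fst z)} ?e (\<lambda>z. Leaf (of_bool (snd z < k (fst z))))"
      by (intro ptime_less i ptime_weak[OF k]) auto
    have "ptime (idx X k) ?e (\<lambda>z. Leaf (snd z + 1))" by (intro ptime_add i ptime_nat)
    then show "ptime (idx X k) ?e (\<lambda>z. ?D (fst z) (Suc (snd z)))"
      by (intro ptime_pair step) simp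
  qed
  from ptime_right[OF this] show ?thesis by simp
qed

lemma ptime_loop_index:
  assumes "ptime Y (ext e) g"
  shows "ptime Y (\<lambda>z. Node (e (fst z)) (Node (Leaf (snd z)) (q z))) g"
  by (rule ptime_trans[OF ptime_pair[OF ptime_fst ptime_trans[OF ptime_snd ptime_fst]] assms])

lemma ptime_loop_acc: "ptime Y (\<lambda>z. Node (p z) (Node (r z) (q z))) q"
  by (rule ptime_trans[OF ptime_snd ptime_snd])

text \<open>By \<open>data_size_arith\<close> each round enlarges the accumulator by at most the
  size of its operand, so the sum of the operand sizes bounds it. This covers long products, whose
  values may be exponential.\<close>

lemma ptime_iterate_arith:
  assumes k: "ptime X e (\<lambda>a. Leaf (k a))" and pb: "poly_bounded X e k"
    and g: "ptime (idx X k) (ext e) (\<lambda>z. Leaf (g (fst z) (snd z)))"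
    and r: "\<And>a. r a 0 = c" "\<And>a i. r a (Suc i) = arith_fun op (r a i) (g a i)"
  shows "ptime X e (\<lambda>a. Leaf (r a (k a)))"
proof (rule ptime_for[OF k pb, where D = "\<lambda>a i. Leaf (r a i)"])
  show "ptime X e (\<lambda>a. Leaf (r a 0))" unfolding r(1) by (rule ptime_nat)
  show "ptime (idx X k) (\<lambda>z. Node (e (fst z)) (Node (Leaf (snd z)) (Leaf (r (fst z) (snd z)))))
     (\<lambda>z. Leaf (r (fst z) (Suc (snd z))))"
    unfolding r(2) by (intro ptime_arith ptime_loop_acc ptime_loop_index g)
  show "poly_bounded X e (\<lambda>a. data_size (Leaf c) + (\<Sum>i<k a. data_size (Leaf (g a i))))"
    by (intro bounded_add bounded_const bounded_sum pb ptime_size[OF g])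
  show "data_size (Leaf (r a i)) \<le> data_size (Leaf c) + (\<Sum>i<k a. data_size (Leaf (g a i)))"
    if "i \<le> k a" for a i
  proof -
    have "data_size (Leaf (r a i)) \<le> data_size (Leaf c) + (\<Sum>j<i. data_size (Leaf (g a j)))"
    proof (induction i)
      case (Suc i)
      then show ?case
        using data_size_arith[of op "r a i" "g a i"] unfolding r(2) sum.lessThan_Suc by linarith
    qed (simp add: r(1))
    moreover have "(\<Sum>j<i. data_size (Leaf (g a j))) \<le> (\<Sum>j<k a. data_size (Leaf (g a j)))"
      using that by (intro sum_mono2) auto
    ultimately show ?thesis by linarith
  qed
qed

lemma ptime_sum:
  assumes "ptime X e (\<lambda>a. Leaf (k a))" "poly_bounded X e k"
    and "ptime (idx X k) (ext e) (\<lambda>z. Leaf (g (fst z) (snd z)))"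
  shows "ptime X e (\<lambda>a. Leaf (\<Sum>i<k a. g a i))"
  by (rule ptime_iterate_arith[OF assms, where r = "\<lambda>a k. \<Sum>i<k. g a i" and op = Add]) auto

lemma ptime_prod:
  assumes "ptime X e (\<lambda>a. Leaf (k a))" "poly_bounded X e k"
    and "ptime (idx X k) (ext e) (\<lambda>z. Leaf (g (fst z) (snd z)))"
  shows "ptime X e (\<lambda>a. Leaf (\<Prod>i<k a. g a i))"
  by (rule ptime_iterate_arith[OF assms, where r = "\<lambda>a k. \<Prod>i<k. g a i" and op = Mul]) auto

text \<open>The exponent is bounded in value and not just in length, since the power needs about
  that many bits.\<close>

lemma ptime_power:
  assumes "ptime X e (\<lambda>a. Leaf (b a))" "ptime X e (\<lambda>a. Leaf (k a))" "poly_bounded X e k"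
  shows "ptime X e (\<lambda>a. Leaf (b a ^ k a))"
proof -
  have "ptime X e (\<lambda>a. Leaf (\<Prod>i<k a. b a))"
    by (rule ptime_prod[OF assms(2,3)], rule ptime_weak[OF assms(1)]) auto
  then show ?thesis by simp
qed

text \<open>Loops count upwards while an encoded list grows at its front. Lists are therefore built
  from their last entry, and round \<open>i\<close> deals with position
  \<open>k - Suc i\<close>.\<close>

lemma ptime_for_down:
  assumes k: "ptime X e (\<lambda>a. Leaf (k a))" and g: "ptime (idx X k) (ext e) g"
  shows "ptime (idx X k) (\<lambda>z. Node (e (fst z)) (Node (Leaf (snd z)) (q z)))
     (\<lambda>z. g (fst z, k (fst z) - Suc (snd z)))"
proof (rule ptime_loop_index)
  have "ptime (idx X k) (ext e) (\<lambda>z. Node (e (fst z)) (Leaf (k (fst z) - (snd z + 1))))"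
    by (intro ptime_pair ptime_fst ptime_diff ptime_add ptime_weak[OF k] ptime_snd ptime_nat) auto
  moreover have "ptime (idx X k) (\<lambda>z. ext e (fst z, k (fst z) - (snd z + 1)))
     (\<lambda>z. g (fst z, k (fst z) - (snd z + 1)))"
    by (rule ptime_reindex[OF g, where h = "\<lambda>z. (fst z, k (fst z) - (snd z + 1))"]) auto
  ultimately show "ptime (idx X k) (ext e) (\<lambda>z. g (fst z, k (fst z) - Suc (snd z)))"
    by (simp add: ptime_trans)
qed

lemma upt_diff_Suc: "i < k \<Longrightarrow> [k - Suc i..<k] = (k - Suc i) # [k - i..<k]"
  by (subst upt_conv_Cons) (auto simp: Suc_diff_Suc)

lemma ptime_tabulate:
  assumes k: "ptime X e (\<lambda>a. Leaf (k a))" and pb: "poly_bounded X e k"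
    and g: "ptime (idx X k) (ext e) (\<lambda>z. g (fst z) (snd z))"
  shows "ptime X e (\<lambda>a. enc_list (g a) [0..<k a])"
proof -
  have "ptime X e (\<lambda>a. enc_list (g a) [k a - k a..<k a])"
  proof (rule ptime_for[OF k pb, where D = "\<lambda>a i. enc_list (g a) [k a - i..<k a]"])
    show "ptime X e (\<lambda>a. enc_list (g a) [k a - 0..<k a])" using ptime_nat[of X e 0] by simp
    let ?e = "\<lambda>z. Node (e (fst z)) (Node (Leaf (snd z))
      (enc_list (g (fst z)) [k (fst z) - snd z..<k (fst z)]))"
    have "ptime (idx X k) ?e (\<lambda>z. Node (g (fst z) (k (fst z) - Suc (snd z)))
        (enc_list (g (fst z)) [k (fst z) - snd z..<k (fst z)]))"
      by (intro ptime_pair ptime_loop_acc ptime_for_down[OF k g, unfolded fst_conv snd_conv])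
    then show "ptime (idx X k) ?e (\<lambda>z. enc_list (g (fst z)) [k (fst z) - Suc (snd z)..<k (fst z)])"
      by (rule ptime_cong) (auto simp: upt_diff_Suc)
    show "poly_bounded X e (\<lambda>a. 1 + (\<Sum>i<k a. Suc (data_size (g a i))))"
      by (intro bounded_add bounded_const bounded_sum bounded_Suc ptime_size[OF g] pb)
    show "data_size (enc_list (g a) [k a - i..<k a]) \<le> 1 + (\<Sum>i<k a. Suc (data_size (g a i)))" for a i
      unfolding data_size_enc_list
      by (auto simp: interv_sum_list_conv_sum_set_nat simp del: sum_Suc intro!: sum_mono2)
  qed
  then show ?thesis by simp
qed

lemma ptime_filter:
  assumes k: "ptime X e (\<lambda>a. Leaf (k a))" and pb: "poly_bounded X e k"
    and P: "ptime (idx X k) (ext e) (\<lambda>z. Leaf (of_bool (P (fst z) (snd z))))"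
  shows "ptime X e (\<lambda>a. enc_list Leaf (filter (P a) [0..<k a]))"
proof -
  have "ptime X e (\<lambda>a. enc_list Leaf (filter (P a) [k a - k a..<k a]))"
  proof (rule ptime_for[OF k pb, where D = "\<lambda>a i. enc_list Leaf (filter (P a) [k a - i..<k a])"])
    show "ptime X e (\<lambda>a. enc_list Leaf (filter (P a) [k a - 0..<k a]))" using ptime_nat[of X e 0] by simp
    let ?e = "\<lambda>z. Node (e (fst z)) (Node (Leaf (snd z))
      (enc_list Leaf (filter (P (fst z)) [k (fst z) - snd z..<k (fst z)])))"
    have "ptime (idx X k) ?e (\<lambda>z. if P (fst z) (k (fst z) - Suc (snd z))
        then Node (Leaf (k (fst z) - Suc (snd z)))
          (enc_list Leaf (filter (P (fst z)) [k (fst z) - snd z..<k (fst z)]))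
        else enc_list Leaf (filter (P (fst z)) [k (fst z) - snd z..<k (fst z)]))"
    proof (intro ptime_if ptime_pair ptime_loop_acc)
      show "ptime (idx X k) ?e (\<lambda>z. Leaf (of_bool (P (fst z) (k (fst z) - Suc (snd z)))))"
        by (rule ptime_for_down[OF k P, unfolded fst_conv snd_conv])
      have "ptime (idx X k) ?e (\<lambda>z. Leaf (k (fst z) - Suc (snd z)))"
        by (rule ptime_for_down[OF k ptime_snd, unfolded fst_conv snd_conv])
      then show "ptime {z \<in> idx X k. P (fst z) (k (fst z) - Suc (snd z))} ?e
          (\<lambda>z. Leaf (k (fst z) - Suc (snd z)))"
        by (rule ptime_subset) blast
    qed
    then show "ptime (idx X k) ?e
        (\<lambda>z. enc_list Leaf (filter (P (fst z)) [k (fst z) - Suc (snd z)..<k (fst z)]))"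
      by (rule ptime_cong) (auto simp: upt_diff_Suc)
    show "poly_bounded X e (\<lambda>a. 1 + k a * (2 + k a))"
      by (intro bounded_add bounded_mult bounded_const pb)
    show "data_size (enc_list Leaf (filter (P a) [k a - i..<k a])) \<le> 1 + k a * (2 + k a)"
      if "i \<le> k a" for a i
    proof -
      have "data_size (enc_list Leaf (filter (P a) [k a - i..<k a])) \<le>
          1 + length (filter (P a) [k a - i..<k a]) * Suc (Suc (k a))"
        by (rule data_size_enc_list_le) (auto intro: order_trans[OF floorlog2_le])
      moreover have "length (filter (P a) [k a - i..<k a]) \<le> k a"
        by (rule order_trans[OF length_filter_le]) (use that in auto)
      moreover from this have "length (filter (P a) [k a - i..<k a]) * Suc (Suc (k a)) \<le> k a * (2 + k a)"
        by (intro mult_mono) auto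
      ultimately show ?thesis by linarith
    qed
  qed
  then show ?thesis by simp
qed

section \<open>List access, logarithms and binary search\<close>

lemma ptime_drop:
  assumes l: "ptime X e (\<lambda>a. enc_list (E a) (l a))" and i: "ptime X e (\<lambda>a. Leaf (i a))"
    and pb: "poly_bounded X e i"
  shows "ptime X e (\<lambda>a. enc_list (E a) (drop (i a) (l a)))"
proof (rule ptime_for[OF i pb, where D = "\<lambda>a i. enc_list (E a) (drop i (l a))"])
  show "ptime X e (\<lambda>a. enc_list (E a) (drop 0 (l a)))" using l by simp
  show "ptime (idx X i) (\<lambda>z. Node (e (fst z)) (Node (Leaf (snd z)) (enc_list (E (fst z)) (drop (snd z) (l (fst z))))))
     (\<lambda>z. enc_list (E (fst z)) (drop (Suc (snd z)) (l (fst z))))"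
    unfolding right_enc_list_drop[symmetric] by (intro ptime_right ptime_loop_acc)
qed (use ptime_size[OF l] data_size_enc_list_drop in auto)

lemma bounded_length:
  assumes "ptime X e (\<lambda>a. enc_list (E a) (l a))"
  shows "poly_bounded X e (\<lambda>a. length (l a))"
  by (rule bounded_mono[OF ptime_size[OF assms]]) (rule length_le_data_size)

lemma ptime_nth:
  assumes "ptime X e (\<lambda>a. enc_list (E a) (l a))" "ptime X e (\<lambda>a. Leaf (i a))"
    and "\<And>a. a \<in> X \<Longrightarrow> i a < length (l a)"
  shows "ptime X e (\<lambda>a. E a (l a ! i a))"
proof -
  have "poly_bounded X e i"
    by (rule bounded_mono[OF bounded_length[OF assms(1)]]) (use assms(3) in \<open>auto intro: less_imp_le\<close>)
  from ptime_left[OF ptime_drop[OF assms(1,2) this]] show ?thesis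
    by (rule ptime_cong) (use assms(3) in \<open>auto simp flip: Cons_nth_drop_Suc\<close>)
qed

lemma ptime_lookup:
  assumes "ptime X e (\<lambda>a. enc_list (g a) [0..<k a])" "ptime X e (\<lambda>a. Leaf (i a))"
    and "\<And>a. a \<in> X \<Longrightarrow> i a < k a"
  shows "ptime X e (\<lambda>a. g a (i a))"
  by (rule ptime_cong, rule ptime_nth[OF assms(1,2)]) (use assms(3) in auto)

text \<open>The number of rounds is the very result, so no counted loop is available. The state
  consists of the remaining list and a counter, and the test asks whether the list is still a
  node.\<close>

lemma ptime_length:
  assumes l: "ptime X e (\<lambda>a. enc_list (E a) (l a))"
  shows "ptime X e (\<lambda>a. Leaf (length (l a)))"
proof -
  let ?D = "\<lambda>a i. Node (enc_list (E a) (drop i (l a))) (Leaf i)"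
  have "ptime X e (\<lambda>a. ?D a (length (l a)))"
  proof (rule ptime_while[OF bounded_length[OF l]])
    have "poly_bounded {z. fst z \<in> X \<and> snd z \<le> length (l (fst z))} (\<lambda>z. e (fst z))
        (\<lambda>z. data_size (enc_list (E (fst z)) (l (fst z))) + length (l (fst z)) + 2)"
      by (intro bounded_add bounded_const bounded_reindex[OF ptime_size[OF l]] bounded_reindex[OF bounded_length[OF l]]) auto
    then show "poly_bounded {z. fst z \<in> X \<and> snd z \<le> length (l (fst z))} (\<lambda>z. e (fst z))
        (\<lambda>z. data_size (?D (fst z) (snd z)))"
      by (rule bounded_mono)
        (auto intro!: add_mono data_size_enc_list_drop intro: order_trans[OF floorlog2_le])
    show "ptime X e (\<lambda>a. ?D a 0)" using l by (intro ptime_pair ptime_nat) simp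
    let ?e = "\<lambda>z. Node (e (fst z)) (?D (fst z) (snd z))"
    have "ptime {z. fst z \<in> X \<and> snd z \<le> length (l (fst z))} ?e
       (\<lambda>z. Leaf (of_bool (is_node (enc_list (E (fst z)) (drop (snd z) (l (fst z)))))))"
      by (intro ptime_is_node ptime_trans[OF ptime_snd ptime_fst])
    then show "ptime {z. fst z \<in> X \<and> snd z \<le> length (l (fst z))} ?e
       (\<lambda>z. Leaf (of_bool (snd z < length (l (fst z)))))"
    proof (rule ptime_cong)
      fix z
      show "Leaf (of_bool (snd z < length (l (fst z)))) =
        Leaf (of_bool (is_node (enc_list (E (fst z)) (drop (snd z) (l (fst z))))))"
        by (cases "drop (snd z) (l (fst z))") (auto simp: not_less dest: arg_cong[where f = length])
    qed
    have "ptime (idx X (\<lambda>a. length (l a))) ?e (\<lambda>z. Node (enc_list (E (fst z)) (drop (Suc (snd z)) (l (fst z))))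
       (Leaf (snd z + 1)))"
      unfolding right_enc_list_drop[symmetric]
      by (intro ptime_pair ptime_right ptime_add ptime_nat ptime_trans[OF ptime_snd ptime_fst] ptime_trans[OF ptime_snd ptime_snd])
    then show "ptime (idx X (\<lambda>a. length (l a))) ?e (\<lambda>z. ?D (fst z) (Suc (snd z)))" by simp
  qed
  from ptime_right[OF this] show ?thesis by simp
qed

lemma div_power_less_floorlog: "0 < m div 2 ^ i \<longleftrightarrow> i < floorlog 2 m"
  using floorlog_le_iff[of 2 m i] by (cases "m < 2 ^ i") (auto simp: div_greater_zero_iff)

text \<open>Halving until zero takes as many rounds as there are bits. The result is the number of
  rounds of the binary search in \<open>ptime_Least\<close>.\<close>

lemma ptime_floorlog:
  assumes m: "ptime X e (\<lambda>a. Leaf (m a))"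
  shows "ptime X e (\<lambda>a. Leaf (floorlog 2 (m a)))"
proof -
  let ?D = "\<lambda>a i. Node (Leaf (m a div 2 ^ i)) (Leaf i)"
  have pb: "poly_bounded X e (\<lambda>a. floorlog 2 (m a))" by (rule bounded_mono[OF ptime_size[OF m]]) simp
  have "ptime X e (\<lambda>a. ?D a (floorlog 2 (m a)))"
  proof (rule ptime_while[OF pb])
    have "poly_bounded {z. fst z \<in> X \<and> snd z \<le> floorlog 2 (m (fst z))} (\<lambda>z. e (fst z))
        (\<lambda>z. floorlog 2 (m (fst z)) + floorlog 2 (m (fst z)) + 3)"
      by (intro bounded_add bounded_const bounded_reindex[OF pb]) auto
    then show "poly_bounded {z. fst z \<in> X \<and> snd z \<le> floorlog 2 (m (fst z))} (\<lambda>z. e (fst z))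
        (\<lambda>z. data_size (?D (fst z) (snd z)))"
    proof (rule bounded_mono)
      fix z assume "z \<in> {z. fst z \<in> X \<and> snd z \<le> floorlog 2 (m (fst z))}"
      then show "data_size (?D (fst z) (snd z)) \<le> floorlog 2 (m (fst z)) + floorlog 2 (m (fst z)) + 3"
        using floorlog2_le[of "snd z"] floorlog_mono[of "m (fst z) div 2 ^ snd z" "m (fst z)" 2] by simp
    qed
    show "ptime X e (\<lambda>a. ?D a 0)" using m by (intro ptime_pair ptime_nat) simp
    let ?e = "\<lambda>z. Node (e (fst z)) (?D (fst z) (snd z))"
    have "ptime {z. fst z \<in> X \<and> snd z \<le> floorlog 2 (m (fst z))} ?e
       (\<lambda>z. Leaf (of_bool (0 < m (fst z) div 2 ^ snd z)))"
      by (intro ptime_less ptime_nat ptime_trans[OF ptime_snd ptime_fst])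
    then show "ptime {z. fst z \<in> X \<and> snd z \<le> floorlog 2 (m (fst z))} ?e
       (\<lambda>z. Leaf (of_bool (snd z < floorlog 2 (m (fst z)))))"
      by (simp only: div_power_less_floorlog)
    have "ptime (idx X (\<lambda>a. floorlog 2 (m a))) ?e (\<lambda>z. Node (Leaf (m (fst z) div 2 ^ snd z div 2))
       (Leaf (snd z + 1)))"
      by (intro ptime_pair ptime_div ptime_add ptime_nat ptime_trans[OF ptime_snd ptime_fst] ptime_trans[OF ptime_snd ptime_snd])
    then show "ptime (idx X (\<lambda>a. floorlog 2 (m a))) ?e (\<lambda>z. ?D (fst z) (Suc (snd z)))"
      by (simp add: div_mult2_eq[symmetric] mult.commute)
  qed
  from ptime_right[OF this] show ?thesis by simp
qed

text \<open>Rounding down to a multiple of \<open>2 ^ j\<close> instead of \<open>2 ^ Suc j\<close>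
  reveals bit \<open>j\<close>. A comparison with the largest number that has the same higher bits
  and bit \<open>j\<close> clear reads this bit.\<close>

lemma div_power_step:
  "(x::nat) div 2 ^ j * 2 ^ j =
    (if x \<le> x div 2 ^ Suc j * 2 ^ Suc j + (2 ^ j - 1) then x div 2 ^ Suc j * 2 ^ Suc j
     else x div 2 ^ Suc j * 2 ^ Suc j + 2 ^ j)"
proof -
  define y where "y = x div 2 ^ j"
  define b :: nat where "b = 2 ^ j"
  have b: "0 < b" by (simp add: b_def)
  have x: "x = y * b + x mod b" "x mod b < b"
    using b div_mult_mod_eq[of x b] by (simp_all add: y_def flip: b_def)
  have s: "x div 2 ^ Suc j = y div 2"
    unfolding y_def power_Suc2 div_mult2_eq ..
  have e: "x div 2 ^ Suc j * 2 ^ Suc j = 2 * (y div 2) * b" by (simp only: s) (simp add: b_def)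
  have "y * b = (if x \<le> 2 * (y div 2) * b + (b - 1) then 2 * (y div 2) * b else 2 * (y div 2) * b + b)"
  proof (cases "even y")
    case True
    then have "2 * (y div 2) * b = y * b" by simp
    moreover have "x \<le> y * b + (b - 1)" using x by linarith
    ultimately show ?thesis by (simp only: if_True)
  next
    case False
    then have "y = 2 * (y div 2) + 1" by simp
    then have "y * b = 2 * (y div 2) * b + b" by (metis add_mult_distrib mult_1)
    moreover from this have "\<not> x \<le> 2 * (y div 2) * b + (b - 1)" using x b by linarith
    ultimately show ?thesis by (simp only: if_False)
  qed
  then show ?thesis unfolding e by (simp only: y_def b_def)
qed

text \<open>Monotonicity turns \<open>P a m\<close> into the comparison of the minimum with
  \<open>m\<close>, so the bits of the minimum can be read from the top, one test each. The tests go
  to arbitrary numbers \<open>m\<close>, whence the unrestricted context in the first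
  premise.\<close>

lemma ptime_Least:
  assumes P: "ptime {z. fst z \<in> X} (ext e) (\<lambda>z. Leaf (of_bool (P (fst z) (snd z))))"
    and mono: "\<And>a m m'. a \<in> X \<Longrightarrow> P a m \<Longrightarrow> m \<le> m' \<Longrightarrow> P a m'"
    and M: "ptime X e (\<lambda>a. Leaf (M a))" "\<And>a. a \<in> X \<Longrightarrow> P a (M a)"
  shows "ptime X e (\<lambda>a. Leaf (LEAST m. P a m))"
proof -
  define L where "L a = (LEAST m. P a m)" for a
  define K where "K a = floorlog 2 (M a)" for a
  have P_iff: "P a m \<longleftrightarrow> L a \<le> m" if "a \<in> X" for a m
    using LeastI[of "P a", OF M(2)[OF that]] Least_le[of "P a" m] mono[OF that] unfolding L_def by blast
  have LK: "L a < 2 ^ K a" if "a \<in> X" for a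
    using P_iff[OF that, of "M a"] M(2)[OF that] floorlog_leD[of 2 "M a" "K a"] by (simp add: K_def)
  have K: "ptime X e (\<lambda>a. Leaf (K a))" unfolding K_def by (rule ptime_floorlog[OF M(1)])
  have pb: "poly_bounded X e K" unfolding K_def by (rule bounded_mono[OF ptime_size[OF M(1)]]) simp
  \<comment> \<open>The leading \<open>i\<close> of the \<open>K a\<close> bits of the minimum: zero
    at the start, the minimum itself after \<open>K a\<close> rounds.\<close>
  let ?D = "\<lambda>a i. L a div 2 ^ (K a - i) * 2 ^ (K a - i)"
  have "ptime X e (\<lambda>a. Leaf (?D a (K a)))"
  proof (rule ptime_for[OF K pb, where D = "\<lambda>a i. Leaf (?D a i)"])
    show "ptime X e (\<lambda>a. Leaf (?D a 0))"
      by (rule ptime_cong[OF ptime_nat[of X e 0]]) (simp add: LK)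
    let ?e = "\<lambda>z. Node (e (fst z)) (Node (Leaf (snd z)) (Leaf (?D (fst z) (snd z))))"
    let ?b = "\<lambda>z. 2 ^ (K (fst z) - (snd z + 1))"
    have D: "ptime (idx X K) ?e (\<lambda>z. Leaf (?D (fst z) (snd z)))" by (rule ptime_loop_acc)
    have i: "ptime (idx X K) ?e (\<lambda>z. Leaf (snd z))" by (rule ptime_loop_index[OF ptime_snd])
    have b: "ptime (idx X K) ?e (\<lambda>z. Leaf (?b z))"
    proof (intro ptime_power ptime_nat ptime_diff ptime_add i ptime_weak[OF K])
      show "poly_bounded (idx X K) ?e (\<lambda>z. K (fst z) - (snd z + 1))"
        by (rule bounded_mono[OF bounded_weak[OF pb]]) auto
    qed auto
    have e: "ptime (idx X K) ?e (\<lambda>z. e (fst z))" by (rule ptime_fst)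
    have "ptime (idx X K) ?e (\<lambda>z. Node (e (fst z)) (Leaf (?D (fst z) (snd z) + (?b z - 1))))"
      by (intro ptime_pair ptime_add ptime_diff D b e ptime_nat)
    moreover have "ptime (idx X K) (\<lambda>z. Node (e (fst z)) (Leaf (?D (fst z) (snd z) + (?b z - 1))))
       (\<lambda>z. Leaf (of_bool (P (fst z) (?D (fst z) (snd z) + (?b z - 1)))))"
      using ptime_reindex[OF P, of "idx X K" "\<lambda>z. (fst z, ?D (fst z) (snd z) + (?b z - 1))"] by simp
    ultimately have test: "ptime (idx X K) ?e
       (\<lambda>z. Leaf (of_bool (P (fst z) (?D (fst z) (snd z) + (?b z - 1)))))"
      by (rule ptime_trans)
    have "ptime (idx X K) ?e (\<lambda>z. Leaf (if P (fst z) (?D (fst z) (snd z) + (?b z - 1))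
       then ?D (fst z) (snd z) else ?D (fst z) (snd z) + ?b z))"
      by (intro ptime_if_nat test ptime_add D b)
    then show "ptime (idx X K) ?e (\<lambda>z. Leaf (?D (fst z) (Suc (snd z))))"
    proof (rule ptime_cong)
      fix z assume "z \<in> idx X K"
      then have z: "fst z \<in> X" "K (fst z) - snd z = Suc (K (fst z) - (snd z + 1))" by auto
      show "Leaf (?D (fst z) (Suc (snd z))) = Leaf (if P (fst z) (?D (fst z) (snd z) + (?b z - 1))
          then ?D (fst z) (snd z) else ?D (fst z) (snd z) + ?b z)"
        unfolding P_iff[OF z(1)] z(2) using div_power_step[of "L (fst z)" "K (fst z) - (snd z + 1)"]
        by simp
    qed
    show "poly_bounded X e (\<lambda>a. 1 + K a)" by (intro bounded_add bounded_const pb)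
    show "data_size (Leaf (?D a i)) \<le> 1 + K a" if "a \<in> X" for a i
    proof -
      have "?D a i \<le> L a" by simp
      also note LK[OF that]
      finally have "floorlog 2 (?D a i) \<le> K a" by (intro floorlog_leI) auto
      then show ?thesis by simp
    qed
  qed
  then show ?thesis by (simp add: L_def)
qed

end

section \<open>Turns at a vertex form a cycle\<close>

fun path_pairs :: "'a list \<Rightarrow> 'a set multiset" where
  "path_pairs (x # y # xs) = add_mset {x, y} (path_pairs (y # xs))"
| "path_pairs _ = {#}"

text \<open>A multiset, because a cycle through two elements uses their pair twice. This happens at
  a vertex of degree 2, where both visits make the same turn.\<close>

definition cycle_pairs :: "'a list \<Rightarrow> 'a set multiset" where
  "cycle_pairs p = {#{p ! i, p ! (Suc i mod length p)}. i \<in># mset_set {..<length p}#}"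

definition pair_degree :: "'a set multiset \<Rightarrow> 'a \<Rightarrow> nat" where
  "pair_degree N x = size (filter_mset (\<lambda>P. x \<in> P) N)"

lemma pair_degree_empty [simp]: "pair_degree {#} x = 0"
  and pair_degree_add [simp]: "pair_degree (add_mset P N) x = of_bool (x \<in> P) + pair_degree N x"
  by (auto simp: pair_degree_def)

lemma pair_degree_union: "pair_degree (M + N) x = pair_degree M x + pair_degree N x"
  by (simp add: pair_degree_def)

lemma pair_degree_diff: "M \<subseteq># N \<Longrightarrow> pair_degree (N - M) x = pair_degree N x - pair_degree M x"
  by (metis add_diff_cancel_left' pair_degree_union subset_mset.add_diff_inverse)

lemma pair_degree_mono: "M \<subseteq># N \<Longrightarrow> pair_degree M x \<le> pair_degree N x"
  by (metis le_add1 pair_degree_union subset_mset.add_diff_inverse)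

lemma pair_degree_0: "pair_degree N x = 0 \<Longrightarrow> P \<in># N \<Longrightarrow> x \<notin> P"
  by (auto simp: pair_degree_def filter_mset_eq_mempty_iff)

lemma pair_degree_pos: "0 < pair_degree N x \<Longrightarrow> \<exists>P. P \<in># N \<and> x \<in> P"
  unfolding pair_degree_def by (metis filter_mset_eq_mempty_iff gr_implies_not0 size_empty)

lemma path_pairs_conv_nth:
  "path_pairs xs = {#{xs ! i, xs ! Suc i}. i \<in># mset_set {..<length xs - 1}#}"
proof (induction xs rule: path_pairs.induct)
  case (1 x y xs)
  have "{..<length (x # y # xs) - 1} = insert 0 (Suc ` {..<length (y # xs) - 1})"
    using lessThan_Suc_eq_insert_0 by simp
  then show ?case using 1 by (simp add: mset_set.insert_remove image_mset_mset_set[symmetric]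
        multiset.map_comp comp_def)
qed auto

lemma cycle_pairs_conv_path:
  assumes "p \<noteq> []"
  shows "cycle_pairs p = add_mset {hd p, last p} (path_pairs p)"
proof -
  obtain n where n: "length p = Suc n" using assms by (cases p) auto
  have "mset_set {..<length p} = add_mset n (mset_set {..<n})"
    by (simp add: n lessThan_Suc)
  moreover have "{#{p ! i, p ! (Suc i mod length p)}. i \<in># mset_set {..<n}#} =
      {#{p ! i, p ! Suc i}. i \<in># mset_set {..<n}#}"
    by (rule image_mset_cong) (auto simp: n)
  moreover have "last p = p ! n" "hd p = p ! 0"
    using assms n by (auto simp: last_conv_nth hd_conv_nth)
  ultimately show ?thesis
    by (simp add: cycle_pairs_def path_pairs_conv_nth n insert_commute)
qed

lemma path_pairs_subset: "P \<in># path_pairs p \<Longrightarrow> P \<subseteq> set p"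
  by (induction p rule: path_pairs.induct) auto

lemma cycle_pairs_subset: "P \<in># cycle_pairs p \<Longrightarrow> P \<subseteq> set p"
  by (cases "p = []") (auto simp: cycle_pairs_conv_path cycle_pairs_def dest!: path_pairs_subset)

lemma path_pairs_card: "distinct p \<Longrightarrow> P \<in># path_pairs p \<Longrightarrow> card P = 2"
  by (induction p rule: path_pairs.induct) auto

text \<open>Each end of a path lacks one pair. Adding the end terms on the left avoids subtraction
  and also covers the one-element path, which is both of its ends.\<close>

lemma pair_degree_path:
  assumes "distinct p" "p \<noteq> []"
  shows "pair_degree (path_pairs p) x + of_bool (x = hd p) + of_bool (x = last p) = 2 * of_bool (x \<in> set p)"
  using assms
proof (induction p rule: path_pairs.induct)
  case (1 y z p)
  have "last (z # p) \<in> set (z # p)" by (rule last_in_set) simp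
  then show ?case using 1 by (auto simp del: last.simps simp: last_ConsR)
qed auto

lemma cycle_pairs_card:
  assumes "distinct p" "2 \<le> length p" "P \<in># cycle_pairs p"
  shows "card P = 2"
proof -
  have "hd p \<noteq> last p" using assms(1,2) by (cases p) (auto split: if_splits)
  moreover have "p \<noteq> []" using assms(2) by auto
  ultimately show ?thesis using assms(3) path_pairs_card[OF assms(1)]
    by (auto simp: cycle_pairs_conv_path)
qed

lemma pair_degree_cycle:
  assumes "distinct p" "2 \<le> length p"
  shows "pair_degree (cycle_pairs p) x = 2 * of_bool (x \<in> set p)"
proof -
  have "p \<noteq> []" using assms(2) by auto
  moreover have "hd p \<noteq> last p" using assms(1,2) by (cases p) (auto split: if_splits)
  ultimately show ?thesis
    using pair_degree_path[OF assms(1), of x] by (auto simp: cycle_pairs_conv_path)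
qed

lemma path_pairs_connected:
  assumes "x \<in> set p"
  shows "(hd p, x) \<in> {(x, y). {x, y} \<in># path_pairs p}\<^sup>*"
  using assms
proof (induction p rule: path_pairs.induct)
  case (1 y z p)
  show ?case
  proof (cases "x = y")
    case False
    then have "(z, x) \<in> {(x, y). {x, y} \<in># path_pairs (z # p)}\<^sup>*" using 1 by simp
    then have "(z, x) \<in> {(x, y'). {x, y'} \<in># path_pairs (y # z # p)}\<^sup>*"
      by (rule rtrancl_mono[THEN subsetD, rotated]) auto
    then show ?thesis by (auto intro: converse_rtrancl_into_rtrancl)
  qed simp
qed auto

lemma sym_pairs: "sym {(x, y). {x, y} \<in> F}"
  by (auto simp: sym_def insert_commute)

lemma cycle_pairs_connected: "connected_graph (set p) (set_mset (cycle_pairs p))"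
  unfolding connected_graph_def
proof (intro ballI)
  fix x y assume xy: "x \<in> set p" "y \<in> set p"
  let ?r = "{(x, y). {x, y} \<in># cycle_pairs p}"
  have "p \<noteq> []" using xy by auto
  then have "{(x, y). {x, y} \<in># path_pairs p} \<subseteq> ?r" by (auto simp: cycle_pairs_conv_path)
  then have *: "(hd p, z) \<in> ?r\<^sup>*" if "z \<in> set p" for z
    using rtrancl_mono path_pairs_connected[OF that] by blast
  moreover from *[OF xy(1)] have "(x, hd p) \<in> ?r\<^sup>*"
    by (rule symD[OF sym_rtrancl[OF sym_pairs]])
  ultimately show "(x, y) \<in> ?r\<^sup>*" using xy by (meson rtrancl_trans)
qed

text \<open>A longest path must close up to a cycle, which by connectedness is everything.\<close>

lemma two_regular_connected_is_cycle:
  assumes "finite S" "S \<noteq> {}"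
    and sub: "\<And>P. P \<in># N \<Longrightarrow> P \<subseteq> S \<and> card P = 2"
    and deg: "\<And>x. x \<in> S \<Longrightarrow> pair_degree N x = 2"
    and conn: "connected_graph S (set_mset N)"
  shows "\<exists>p. distinct p \<and> set p = S \<and> cycle_pairs p = N"
proof -
  define path where "path p \<longleftrightarrow> p \<noteq> [] \<and> distinct p \<and> set p \<subseteq> S \<and> path_pairs p \<subseteq># N" for p
  have "length p \<le> card S" if "path p" for p
    using that \<open>finite S\<close> by (auto simp: path_def distinct_card[symmetric] intro: card_mono)
  moreover obtain s where "s \<in> S" using \<open>S \<noteq> {}\<close> by blast
  then have "path [s]" by (simp add: path_def)
  ultimately obtain p where p: "path p" and max: "\<And>q. path q \<Longrightarrow> length q \<le> length p"
    using ex_has_greatest_nat[of path "[s]" length "Suc (card S)"] by (auto simp: le_imp_less_Suc)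
  have p': "p \<noteq> []" "distinct p" "set p \<subseteq> S" "path_pairs p \<subseteq># N" using p by (auto simp: path_def)
  let ?x = "hd p"
  have x: "?x \<in> set p" using p' by simp
  \<comment> \<open>The head is an end of the path, so at most one of its two pairs is used and a
    further pair \<open>P\<close> is left over.\<close>
  have "pair_degree (path_pairs p) ?x \<le> 1"
    using pair_degree_path[OF p'(2,1), of ?x] x by simp
  moreover have "?x \<in> S" using x p'(3) by blast
  ultimately have "0 < pair_degree (N - path_pairs p) ?x"
    using deg[of ?x] p'(4) by (simp add: pair_degree_diff)
  then obtain P where P: "P \<in># N - path_pairs p" "?x \<in> P" by (blast dest: pair_degree_pos)
  then have "card P = 2" "P \<subseteq> S" using sub in_diffD by fast+
  then obtain y where y: "P = {?x, y}" "y \<noteq> ?x" "y \<in> S"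
    using P(2) by (auto simp: card_2_iff)
  have PN: "add_mset P (path_pairs p) \<subseteq># N"
    using P(1) p'(4) by (metis add_mset_add_single insert_subset_eq_iff mset_subset_eq_single
        subset_mset.add_diff_inverse subset_mset.add_le_cancel_left)
  have "y \<in> set p"
  proof (rule ccontr)
    assume "y \<notin> set p"
    moreover have "path_pairs (y # p) = add_mset P (path_pairs p)"
      using y p'(1) by (cases p) (auto simp: insert_commute)
    ultimately have "path (y # p)" using p' y PN by (auto simp: path_def)
    with max show False by fastforce
  qed
  \<comment> \<open>Any other position than the two ends already has both of its pairs in the path;
    together with \<open>P\<close> its degree would be 3.\<close>
  have "y = last p"
  proof -
    have "pair_degree (add_mset P (path_pairs p)) y \<le> 2"
      using pair_degree_mono[OF PN, of y] deg[OF y(3)] by simp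
    then show ?thesis
      using pair_degree_path[OF p'(2,1), of y] \<open>y \<in> set p\<close> y by (cases "y = last p") auto
  qed
  then have C: "cycle_pairs p = add_mset P (path_pairs p)"
    using y p' by (simp add: cycle_pairs_conv_path)
  have "2 \<le> length p" using \<open>y = last p\<close> y p' by (cases p; cases "tl p") auto
  \<comment> \<open>The cycle exhausts the degree of each of its elements, so no remaining pair
    touches it; connectedness then cannot lead out of it.\<close>
  have zero: "pair_degree (N - cycle_pairs p) x = 0" if "x \<in> set p" for x
    using pair_degree_cycle[OF p'(2) \<open>2 \<le> length p\<close>, of x] that deg[of x] p'(3) PN
    by (auto simp: pair_degree_diff C)
  have "set p = S"
  proof
    show "S \<subseteq> set p"
    proof
      fix z assume "z \<in> S"
      then have "(?x, z) \<in> {(x, y). {x, y} \<in># N}\<^sup>*"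
        using conn \<open>?x \<in> S\<close> unfolding connected_graph_def by blast
      then show "z \<in> set p"
      proof induction
        case base
        then show ?case by (rule x)
      next
        case (step y z)
        then have "{y, z} \<notin># N - cycle_pairs p" using pair_degree_0[OF zero[of y]] by auto
        moreover have "{y, z} \<in># N" using step by simp
        ultimately have "{y, z} \<in># cycle_pairs p"
          by (metis diff_union_swap multi_member_split union_iff subset_mset.add_diff_inverse PN C)
        then show ?case using cycle_pairs_subset by fastforce
      qed
    qed
  qed (use p' in auto)
  moreover have "N - cycle_pairs p = {#}"
  proof (rule ccontr)
    assume "N - cycle_pairs p \<noteq> {#}"
    then obtain Q where Q: "Q \<in># N - cycle_pairs p" by blast
    then have "card Q = 2" "Q \<subseteq> S" using sub in_diffD by fast+
    then obtain x where "x \<in> Q" "x \<in> S" by (auto simp: card_2_iff)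
    then show False using pair_degree_0[OF zero Q] \<open>set p = S\<close> by auto
  qed
  then have "cycle_pairs p = N"
    using PN C by (metis Multiset.diff_add subset_mset.add_diff_inverse union_commute empty_neutral(1))
  ultimately show ?thesis using p' by blast
qed

section \<open>Turns of a closed walk\<close>

definition turn_degree :: "('a \<times> 'a set) multiset \<Rightarrow> 'a \<Rightarrow> 'a \<Rightarrow> nat" where
  "turn_degree M x y = size (filter_mset (\<lambda>t. fst t = y \<and> x \<in> snd t) M)"

text \<open>Turns of walks are kept as a vertex with the set of its two neighbours on the walk, so
  that cyclic orders can be lists of neighbours. This converts them to the pairs of edges on which
  costs and junction graphs are defined.\<close>

definition edge_turn :: "'a \<times> 'a set \<Rightarrow> 'a set set" where
  "edge_turn t = (\<lambda>u. {u, fst t}) ` snd t"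

definition walk_turns :: "'a list \<Rightarrow> ('a \<times> 'a set) multiset" where
  "walk_turns w = {#(walk_vertex w (Suc i), {walk_vertex w i, walk_vertex w (Suc (Suc i))}).
     i \<in># mset_set {..<length w}#}"

definition turns_at :: "('a \<times> 'a set) multiset \<Rightarrow> 'a \<Rightarrow> 'a set multiset" where
  "turns_at M v = image_mset snd (filter_mset (\<lambda>t. fst t = v) M)"

definition neighbours :: "'a set set \<Rightarrow> 'a \<Rightarrow> 'a set" where
  "neighbours E v = {u. {u, v} \<in> E}"

lemma edge_turn_pair: "edge_turn (y, {x, z}) = {{x, y}, {y, z}}"
  by (auto simp: edge_turn_def)

lemma turn_degree_conv_pair_degree: "turn_degree M x y = pair_degree (turns_at M y) x"
  by (simp add: turn_degree_def turns_at_def pair_degree_def filter_mset_image_mset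
      filter_filter_mset conj_commute comp_def)

lemma count_turns_at: "count (turns_at M v) P = count M (v, P)"
proof -
  have "{x. snd x = P} \<inter> {t. fst t = v} = {(v, P)}" by auto
  then show ?thesis
    by (induction M) (auto simp: turns_at_def)
qed

lemma in_turns_at: "P \<in># turns_at M v \<longleftrightarrow> (v, P) \<in># M"
  by (metis count_turns_at count_greater_zero_iff)

lemma junction_edges_conv:
  "junction_edges w v = image_mset (\<lambda>P. edge_turn (v, P)) (turns_at (walk_turns w) v)"
proof -
  have "mset_set {i. i < length w \<and> walk_vertex w (Suc i) = v} =
      filter_mset (\<lambda>i. walk_vertex w (Suc i) = v) (mset_set {..<length w})"
    by (simp add: filter_mset_mset_set)
  then show ?thesis
    by (auto simp: junction_edges_def turns_at_def walk_turns_def filter_mset_image_mset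
        multiset.map_comp comp_def edge_turn_pair walk_edge_def intro!: image_mset_cong)
qed

lemma walk_cost_conv: "walk_cost \<alpha> w = (\<Sum>t\<in>#walk_turns w. \<alpha> (edge_turn t))"
  by (simp add: walk_cost_def walk_turns_def multiset.map_comp comp_def edge_turn_pair walk_edge_def
      sum_unfold_sum_mset)

text \<open>At a U-turn the preceding and the following vertex agree, so the set of neighbours
  collapses to a singleton.\<close>

lemma no_U_turns_conv: "no_U_turns w \<longleftrightarrow> (\<forall>t\<in>#walk_turns w. card (snd t) = 2)"
  by (auto simp: no_U_turns_def walk_turns_def walk_edge_def doubleton_eq_iff card_2_iff)

lemma sum_cyclic_shift:
  fixes f :: "nat \<Rightarrow> 'b::comm_monoid_add"
  assumes "f n = f 0"
  shows "(\<Sum>i<n. f (Suc i)) = (\<Sum>i<n. f i)"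
proof (cases n)
  case (Suc m)
  have "(\<Sum>i<Suc m. f (Suc i)) = (\<Sum>i<m. f (Suc i)) + f 0" using assms Suc by simp
  also have "\<dots> = (\<Sum>i<Suc m. f i)" by (simp only: sum.lessThan_Suc_shift add.commute)
  finally show ?thesis using Suc by simp
qed simp

lemma walk_vertex_Suc_length:
  "walk_vertex w (length w) = walk_vertex w 0" "walk_edge w (length w) = walk_edge w 0"
  by (auto simp: walk_vertex_def walk_edge_def mod_Suc)

text \<open>Every traversal of \<open>{x, y}\<close> takes part in exactly one turn at \<open>y\<close>.\<close>

lemma turn_degree_walk:
  assumes "no_U_turns w" "x \<noteq> y"
  shows "turn_degree (walk_turns w) x y = traversals w {x, y}"
proof -
  let ?v = "walk_vertex w" and ?e = "walk_edge w"
  have "turn_degree (walk_turns w) x y =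
      (\<Sum>i<length w. of_bool (?v (Suc i) = y \<and> x \<in> {?v i, ?v (Suc (Suc i))}))"
    by (auto simp: turn_degree_def walk_turns_def filter_mset_image_mset filter_mset_mset_set comp_def
        sum_of_bool_eq intro!: arg_cong[where f = card])
  \<comment> \<open>Without U-turns the two edges of a turn differ, so at most one of them is
    \<open>{x, y}\<close> and the disjunction becomes a sum.\<close>
  also have "\<dots> = (\<Sum>i<length w. of_bool (?v (Suc i) = y \<and> ?e i = {x, y}) +
      of_bool (?v (Suc i) = y \<and> ?e (Suc i) = {x, y}))"
    using assms by (intro sum.cong)
      (auto simp: no_U_turns_def walk_edge_def doubleton_eq_iff of_bool_def)
  \<comment> \<open>In the second sum the edge leaves \<open>y\<close>; shifting the index
    cyclically makes both sums run over the same traversals.\<close>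
  also have "\<dots> = (\<Sum>i<length w. of_bool (?v (Suc i) = y \<and> ?e i = {x, y})) +
      (\<Sum>i<length w. of_bool (?v i = y \<and> ?e i = {x, y}))"
    unfolding sum.distrib
    by (rule arg_cong[where f = "(+) _"], rule sum_cyclic_shift) (simp add: walk_vertex_Suc_length)
  \<comment> \<open>As \<open>x\<close> and \<open>y\<close> differ, each traversal either enters
    \<open>y\<close> or leaves it.\<close>
  also have "\<dots> = (\<Sum>i<length w. of_bool (?e i = {x, y}))"
    unfolding sum.distrib[symmetric] using assms(2)
    by (intro sum.cong) (auto simp: walk_edge_def doubleton_eq_iff)
  also have "\<dots> = traversals w {x, y}"
    by (auto simp: traversals_def sum_of_bool_eq intro!: arg_cong[where f = card])
  finally show ?thesis .
qed

text \<open>Junction graphs live on the edges at a vertex, cycles on its neighbours; this transfers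
  connectedness along the injection from neighbours to edges.\<close>

lemma connected_graph_image:
  assumes "inj f"
  shows "connected_graph (f ` S) ((`) f ` F) \<longleftrightarrow> connected_graph S F"
proof -
  let ?r = "{(x, y). {x, y} \<in> F}" and ?r' = "{(x, y). {x, y} \<in> (`) f ` F}"
  have 1: "(f x, f y) \<in> ?r'\<^sup>*" if "(x, y) \<in> ?r\<^sup>*" for x y
    using that
  proof induction
    case (step y z)
    then have "f ` {y, z} \<in> (`) f ` F" by blast
    then have "(f y, f z) \<in> ?r'" by simp
    with step show ?case by (meson rtrancl_into_rtrancl)
  qed simp
  have 2: "\<exists>y. b = f y \<and> (x, y) \<in> ?r\<^sup>*" if "(f x, b) \<in> ?r'\<^sup>*" for x b
    using that
  proof induction
    case (step b c)
    then obtain y P where y: "b = f y" "(x, y) \<in> ?r\<^sup>*" and P: "{b, c} = f ` P" "P \<in> F" by auto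
    obtain z where z: "c = f z" using P(1) by blast
    have "f ` P = f ` {y, z}" using P(1) y z by simp
    then have "P = {y, z}" by (simp only: inj_image_eq_iff[OF assms])
    then show ?case using P y z by (auto intro: rtrancl_into_rtrancl)
  qed auto
  have "(f x, f y) \<in> ?r'\<^sup>* \<longleftrightarrow> (x, y) \<in> ?r\<^sup>*" for x y
    using 1[of x y] 2[of x "f y"] injD[OF assms, of y] by blast
  then show ?thesis unfolding connected_graph_def ball_simps by simp
qed

lemma edge_set_card_2:
  assumes "admissible_graph V E" "{x, y} \<in> E"
  shows "x \<noteq> y" "x \<in> V" "y \<in> V"
  using assms by (auto simp: admissible_graph_def)

lemma incident_edges_conv:
  assumes "admissible_graph V E"
  shows "incident_edges E v = (\<lambda>u. {u, v}) ` neighbours E v"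
proof -
  have "e \<in> (\<lambda>u. {u, v}) ` neighbours E v" if "e \<in> E" "v \<in> e" for e
  proof -
    have "card e = 2" using that assms by (auto simp: admissible_graph_def)
    then obtain u where "e = {u, v}" using \<open>v \<in> e\<close> by (auto simp: card_2_iff)
    then show ?thesis using that by (auto simp: neighbours_def)
  qed
  then show ?thesis by (auto simp: incident_edges_def neighbours_def)
qed

lemma inj_edge: "inj (\<lambda>u. {u, v})"
  by (auto simp: inj_def doubleton_eq_iff)

lemma neighbours_admissible:
  assumes "admissible_graph V E" "v \<in> V"
  shows "finite (neighbours E v)" "2 \<le> card (neighbours E v)" "neighbours E v \<subseteq> V"
proof -
  show "neighbours E v \<subseteq> V" using edge_set_card_2(2)[OF assms(1)] by (auto simp: neighbours_def)
  then show "finite (neighbours E v)" using assms(1) finite_subset by (auto simp: admissible_graph_def)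
  have "card (incident_edges E v) = card (neighbours E v)"
    unfolding incident_edges_conv[OF assms(1)] by (rule card_image[OF inj_on_subset[OF inj_edge]]) simp
  then show "2 \<le> card (neighbours E v)" using assms by (auto simp: admissible_graph_def)
qed

lemma closed_walk_turn:
  assumes "closed_walk V E w" "t \<in># walk_turns w"
  shows "snd t \<subseteq> neighbours E (fst t)" "fst t \<in> V"
proof -
  obtain i where i: "i < length w"
    "t = (walk_vertex w (Suc i), {walk_vertex w i, walk_vertex w (Suc (Suc i))})"
    using assms(2) by (auto simp: walk_turns_def)
  have "walk_edge w j \<in> E" for j
    using assms(1) unfolding closed_walk_def
    by (metis (no_types, lifting) length_greater_0_conv mod_less_divisor mod_mod_trivial mod_Suc_eq
        walk_edge_def walk_vertex_def)
  from this[of i] this[of "Suc i"] show "snd t \<subseteq> neighbours E (fst t)"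
    using i by (auto simp: neighbours_def walk_edge_def insert_commute)
  have "walk_vertex w (Suc i) \<in> set w"
    unfolding walk_vertex_def using assms(1) by (intro nth_mem) (simp add: closed_walk_def)
  then show "fst t \<in> V" using assms(1) i by (auto simp: closed_walk_def)
qed

text \<open>By \<open>turn_degree_walk\<close> the junction degree of an edge is its number of
  traversals, so double traversal means 2-regularity, and with connectedness a cycle. Conversely,
  the pairs of a cycle have two distinct elements, which excludes U-turns, and its degrees give back
  the two traversals. Apart from being a closed walk, only the multiset of turns matters.\<close>

theorem exactly_double_threading_iff:
  assumes G: "admissible_graph V E"
  shows "exactly_double_threading V E w \<longleftrightarrow> closed_walk V E w \<and>
    (\<forall>v\<in>V. \<exists>p. distinct p \<and> set p = neighbours E v \<and> turns_at (walk_turns w) v = cycle_pairs p)"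
    (is "_ \<longleftrightarrow> _ \<and> ?cycles")
proof -
  have conn: "connected_graph (incident_edges E v) (set_mset (junction_edges w v)) \<longleftrightarrow>
      connected_graph (neighbours E v) (set_mset (turns_at (walk_turns w) v))" for v
    using connected_graph_image[OF inj_edge]
    by (simp add: incident_edges_conv[OF G] junction_edges_conv edge_turn_def)
  show ?thesis
  proof (intro iffI conjI)
    assume w: "exactly_double_threading V E w"
    then show cw: "closed_walk V E w"
      by (auto simp: exactly_double_threading_def threading_def)
    have U: "no_U_turns w" using w by (auto simp: exactly_double_threading_def threading_def)
    show ?cycles
    proof
      fix v assume v: "v \<in> V"
      have "\<exists>p. distinct p \<and> set p = neighbours E v \<and> cycle_pairs p = turns_at (walk_turns w) v"
      proof (rule two_regular_connected_is_cycle)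
        show "finite (neighbours E v)" by (rule neighbours_admissible[OF G v])
        show "neighbours E v \<noteq> {}" using neighbours_admissible(2)[OF G v] by auto
        show "P \<subseteq> neighbours E v \<and> card P = 2" if "P \<in># turns_at (walk_turns w) v" for P
          using closed_walk_turn(1)[OF cw, of "(v, P)"] U that
          by (auto simp: no_U_turns_conv in_turns_at)
        show "pair_degree (turns_at (walk_turns w) v) x = 2" if "x \<in> neighbours E v" for x
        proof -
          have "{x, v} \<in> E" using that by (simp add: neighbours_def)
          then show ?thesis using turn_degree_walk[OF U edge_set_card_2(1)[OF G]] w
            by (auto simp: turn_degree_conv_pair_degree exactly_double_threading_def)
        qed
        show "connected_graph (neighbours E v) (set_mset (turns_at (walk_turns w) v))"
          using w v conn by (auto simp: exactly_double_threading_def threading_def)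
      qed
      then show "\<exists>p. distinct p \<and> set p = neighbours E v \<and> turns_at (walk_turns w) v = cycle_pairs p"
        by metis
    qed
  next
    assume "closed_walk V E w \<and> ?cycles"
    then have cw: "closed_walk V E w" and cyc: ?cycles by auto
    have len: "2 \<le> length p" if "distinct p" "set p = neighbours E v" "v \<in> V" for p v
      using neighbours_admissible(2)[OF G that(3)] that(1,2) by (metis distinct_card)
    have U: "no_U_turns w"
      unfolding no_U_turns_conv
    proof
      fix t assume t: "t \<in># walk_turns w"
      then obtain p where "distinct p" "set p = neighbours E (fst t)"
        "turns_at (walk_turns w) (fst t) = cycle_pairs p"
        using cyc closed_walk_turn(2)[OF cw] by blast
      then show "card (snd t) = 2"
        using cycle_pairs_card[of p "snd t"] len closed_walk_turn(2)[OF cw t] t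
        by (metis in_turns_at prod.collapse)
    qed
    have trav: "traversals w e = 2" if "e \<in> E" for e
    proof -
      have "card e = 2" using that G by (auto simp: admissible_graph_def)
      then obtain x y where e: "e = {x, y}" by (auto simp: card_2_iff)
      note xy = edge_set_card_2[OF G that[unfolded e]]
      obtain p where p: "distinct p" "set p = neighbours E y"
        "turns_at (walk_turns w) y = cycle_pairs p" using cyc xy by blast
      then have "pair_degree (turns_at (walk_turns w) y) x = 2"
        using pair_degree_cycle[OF p(1) len[OF p(1,2)]] xy that by (simp add: neighbours_def e)
      then show ?thesis
        using turn_degree_walk[OF U xy(1)] by (simp add: e turn_degree_conv_pair_degree)
    qed
    have "connected_graph (neighbours E v) (set_mset (turns_at (walk_turns w) v))" if "v \<in> V" for v
      using cyc that by (metis cycle_pairs_connected)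
    then show "exactly_double_threading V E w"
      using cw U trav conn by (auto simp: exactly_double_threading_def threading_def)
  qed
qed

text \<open>Each turn belongs to one vertex; grouping by it is what decouples the vertices.\<close>

lemma walk_cost_conv_vertices:
  assumes "closed_walk V E w" "finite V"
  shows "walk_cost \<alpha> w = (\<Sum>v\<in>V. \<Sum>P\<in>#turns_at (walk_turns w) v. \<alpha> (edge_turn (v, P)))"
proof -
  have "(\<Sum>t\<in>#M. \<alpha> (edge_turn t)) = (\<Sum>v\<in>V. \<Sum>P\<in>#turns_at M v. \<alpha> (edge_turn (v, P)))"
    if "\<And>t. t \<in># M \<Longrightarrow> fst t \<in> V" for M
    using that
  proof (induction M)
    case (add t M)
    obtain v P where t: "t = (v, P)" by (cases t)
    have v: "v \<in> V" using add.prems[of t] t by simp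
    have "(\<Sum>u\<in>V. \<Sum>Q\<in>#turns_at (add_mset t M) u. \<alpha> (edge_turn (u, Q))) =
        (\<Sum>u\<in>V. (if u = v then \<alpha> (edge_turn t) else 0) + (\<Sum>Q\<in>#turns_at M u. \<alpha> (edge_turn (u, Q))))"
      by (intro sum.cong) (auto simp: turns_at_def t)
    then show ?case using add assms(2) v by (auto simp: sum.distrib t)
  qed (simp add: turns_at_def)
  then show ?thesis using closed_walk_turn(2)[OF assms(1)] by (simp add: walk_cost_conv)
qed

section \<open>Tracing a single closed walk\<close>

fun path_turns :: "'a list \<Rightarrow> ('a \<times> 'a set) multiset" where
  "path_turns (x # y # z # xs) = add_mset (y, {x, z}) (path_turns (y # z # xs))"
| "path_turns _ = {#}"

lemma turn_degree_empty [simp]: "turn_degree {#} x y = 0"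
  and turn_degree_add [simp]:
    "turn_degree (add_mset t M) x y = of_bool (fst t = y \<and> x \<in> snd t) + turn_degree M x y"
  by (auto simp: turn_degree_def)

lemma turn_degree_union: "turn_degree (M + N) x y = turn_degree M x y + turn_degree N x y"
  by (simp add: turn_degree_def)

lemma turn_degree_diff:
  "M \<subseteq># N \<Longrightarrow> turn_degree (N - M) x y = turn_degree N x y - turn_degree M x y"
  by (metis add_diff_cancel_left' turn_degree_union subset_mset.add_diff_inverse)

lemma turn_degree_mono: "M \<subseteq># N \<Longrightarrow> turn_degree M x y \<le> turn_degree N x y"
  by (metis le_add1 turn_degree_union subset_mset.add_diff_inverse)

lemma turn_degree_0: "turn_degree M x y = 0 \<Longrightarrow> (y, P) \<in># M \<Longrightarrow> x \<notin> P"
  by (auto simp: turn_degree_def)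

lemma turn_degree_pos: "0 < turn_degree M x y \<Longrightarrow> \<exists>P. (y, P) \<in># M \<and> x \<in> P"
  by (auto simp: turn_degree_def nonempty_has_size[symmetric])

lemma path_turns_conv_nth:
  "path_turns R = {#(R ! Suc i, {R ! i, R ! Suc (Suc i)}). i \<in># mset_set {..<length R - 2}#}"
proof (induction R rule: path_turns.induct)
  case (1 x y z xs)
  have "{..<length (x # y # z # xs) - 2} = insert 0 (Suc ` {..<length (y # z # xs) - 2})"
    using lessThan_Suc_eq_insert_0 by simp
  then show ?case using 1 by (simp add: mset_set.insert_remove image_mset_mset_set[symmetric]
        multiset.map_comp comp_def)
qed auto

lemma size_path_turns: "size (path_turns R) = length R - 2"
  by (simp add: path_turns_conv_nth)

lemma path_turns_snoc:
  "2 \<le> length R \<Longrightarrow>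
    path_turns (R @ [c]) = add_mset (last R, {last (butlast R), c}) (path_turns R)"
  by (induction R rule: path_turns.induct) auto

lemma path_turns_edges:
  "(y, {x, z}) \<in># path_turns R \<Longrightarrow> {x, y} \<in># path_pairs R \<and> {y, z} \<in># path_pairs R"
  by (induction R rule: path_turns.induct) (auto simp: doubleton_eq_iff insert_commute)

text \<open>
  Every traversal of \<open>{x, y}\<close> by a path takes part in one turn at \<open>y\<close>, unless this \<open>y\<close> is one of
  the two ends of the path.
\<close>

lemma turn_degree_path:
  assumes "2 \<le> length R" "x \<noteq> y" "\<And>t. t \<in># path_turns R \<Longrightarrow> card (snd t) = 2"
  shows "turn_degree (path_turns R) x y + of_bool (R ! 0 = y \<and> R ! 1 = x) +
    of_bool (last R = y \<and> last (butlast R) = x) = count (path_pairs R) {x, y}"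
  using assms(1,3)
proof (induction R rule: path_turns.induct)
  case (1 r s t rs)
  have "r \<noteq> t" using "1.prems"(2)[of "(s, {r, t})"] by auto
  have IH: "turn_degree (path_turns (s # t # rs)) x y + of_bool (s = y \<and> t = x) +
    of_bool (last (s # t # rs) = y \<and> last (butlast (s # t # rs)) = x) =
    count (path_pairs (s # t # rs)) {x, y}"
    using 1 by simp
  have "(of_bool ({r, s} = {x, y}) :: nat) = of_bool (r = x \<and> s = y) + of_bool (r = y \<and> s = x)"
    using assms(2) by (auto simp: doubleton_eq_iff)
  moreover have "(of_bool (s = y \<and> x \<in> {r, t}) :: nat) = of_bool (r = x \<and> s = y) + of_bool (s = y \<and> t = x)"
    using \<open>r \<noteq> t\<close> by auto
  moreover have "count (path_pairs (r # s # t # rs)) {x, y} =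
      of_bool ({r, s} = {x, y}) + count (path_pairs (s # t # rs)) {x, y}" by auto
  moreover have "turn_degree (path_turns (r # s # t # rs)) x y =
      of_bool (s = y \<and> x \<in> {r, t}) + turn_degree (path_turns (s # t # rs)) x y" by simp
  ultimately show ?case using IH by simp
qed (use assms(2) in \<open>auto simp: doubleton_eq_iff\<close>)

lemma in_path_pairs: "P \<in># path_pairs R \<Longrightarrow> \<exists>i<length R - 1. P = {R ! i, R ! Suc i}"
  by (auto simp: path_pairs_conv_nth)

text \<open>The path repeats its first edge at its end, in the same direction. Hence dropping the
  last two entries leaves a closed walk, and all cyclic turns of this walk are inner turns of the
  path.\<close>

definition closed_path :: "'a list \<Rightarrow> bool" where
  "closed_path R \<longleftrightarrow> 2 \<le> length R \<and> last R = R ! 1 \<and> last (butlast R) = R ! 0"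

text \<open>The first vertex is dropped and the walk is followed for one more vertex, which is
  \<open>R ! 2\<close>, since the last two entries are \<open>R ! 0\<close> and
  \<open>R ! 1\<close>.\<close>

definition rotate_path :: "'a list \<Rightarrow> 'a list" where
  "rotate_path R = tl R @ [R ! 2]"

locale turn_system =
  fixes n :: nat and E :: "nat set set" and p :: "nat \<Rightarrow> nat list"
  assumes G: "admissible_graph {..<n} E"
    and p: "v < n \<Longrightarrow> distinct (p v)" "v < n \<Longrightarrow> set (p v) = neighbours E v"
begin

text \<open>The turns that a walk realising the cyclic orders \<open>p\<close> has to make, with
  multiplicity.\<close>

definition H :: "(nat \<times> nat set) multiset" where
  "H = (\<Sum>v<n. image_mset (Pair v) (cycle_pairs (p v)))"

lemma length_p: "v < n \<Longrightarrow> 2 \<le> length (p v)"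
  using neighbours_admissible(2)[OF G, of v] p[of v] by (metis distinct_card lessThan_iff)

lemma in_H: "(v, P) \<in># H \<longleftrightarrow> v < n \<and> P \<in># cycle_pairs (p v)"
  by (auto simp: H_def in_Union_mset_iff set_mset_sum)

lemma turns_at_H: "v < n \<Longrightarrow> turns_at H v = cycle_pairs (p v)"
proof -
  have "turns_at (\<Sum>u<m. image_mset (Pair u) (cycle_pairs (p u))) v =
      (if v < m then cycle_pairs (p v) else {#})" for m
    by (induction m) (auto simp: turns_at_def filter_mset_image_mset multiset.map_comp comp_def less_Suc_eq)
  then show "v < n \<Longrightarrow> turns_at H v = cycle_pairs (p v)" by (simp add: H_def)
qed

lemma count_H: "v < n \<Longrightarrow> count H (v, P) = count (cycle_pairs (p v)) P"
  by (metis count_turns_at turns_at_H)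

lemma H_turn: "(v, P) \<in># H \<Longrightarrow> card P = 2 \<and> P \<subseteq> neighbours E v"
  using cycle_pairs_card[of "p v" P] cycle_pairs_subset[of P "p v"] p length_p by (auto simp: in_H)

lemma H_edges:
  assumes "(v, {x, z}) \<in># H"
  shows "{x, v} \<in> E" "{v, z} \<in> E"
  using H_turn[OF assms] by (auto simp: neighbours_def insert_commute)

lemma turn_degree_H:
  assumes "{x, y} \<in> E"
  shows "turn_degree H x y = 2"
proof -
  have y: "y < n" and "x \<in> neighbours E y"
    using edge_set_card_2[OF G assms] assms by (auto simp: neighbours_def)
  then show ?thesis
    using pair_degree_cycle[OF p(1) length_p, OF y y, of x] p(2)[OF y]
    by (simp add: turn_degree_conv_pair_degree turns_at_H)
qed

definition extensions :: "nat list \<Rightarrow> nat list" where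
  "extensions R =
    filter (\<lambda>z. count (path_turns R) (R ! 0, {R ! 1, z}) < count H (R ! 0, {R ! 1, z})) [0..<n]"

text \<open>
  The path grows at its head. When no unused turn continues it, it is closed, and rotating it
  brings another of its edges to the head.
\<close>

definition step :: "nat list \<Rightarrow> nat list" where
  "step R = (if extensions R = [] then rotate_path R else hd (extensions R) # R)"

definition valid :: "nat list \<Rightarrow> bool" where
  "valid R \<longleftrightarrow> 2 \<le> length R \<and> path_turns R \<subseteq># H \<and> {R ! 0, R ! 1} \<in> E"

lemma valid_card: "valid R \<Longrightarrow> t \<in># path_turns R \<Longrightarrow> card (snd t) = 2"
  using H_turn[of "fst t" "snd t"] by (auto simp: valid_def dest: mset_subset_eqD)

lemma valid_ConsE:
  assumes "valid R"
  obtains r s rs where "R = r # s # rs" "{r, s} \<in> E"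
  using assms by (cases R; cases "tl R") (auto simp: valid_def)

lemma extension_iff:
  "z \<in> set (extensions R) \<longleftrightarrow> count (path_turns R) (R ! 0, {R ! 1, z}) < count H (R ! 0, {R ! 1, z})"
proof -
  have "z < n" if "count (path_turns R) (R ! 0, {R ! 1, z}) < count H (R ! 0, {R ! 1, z})"
  proof -
    have "(R ! 0, {R ! 1, z}) \<in># H" using that by (metis count_inI less_zeroE)
    from edge_set_card_2[OF G H_edges(2)[OF this]] show ?thesis by simp
  qed
  then show ?thesis by (auto simp: extensions_def)
qed

lemma valid_extend:
  assumes "valid R" "z \<in> set (extensions R)"
  shows "valid (z # R)"
proof -
  obtain r s rs where R: "R = r # s # rs" "{r, s} \<in> E" using assms(1) by (rule valid_ConsE)
  have z: "count (path_turns R) (r, {s, z}) < count H (r, {s, z})"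
    using assms(2) by (simp add: extension_iff R)
  then have "(r, {s, z}) \<in># H" by (metis count_inI less_zeroE)
  then have "{z, r} \<in> E" using H_edges(2)[of r s z] by (simp add: insert_commute)
  moreover have "path_turns (z # R) = add_mset (r, {s, z}) (path_turns R)"
    by (simp add: R insert_commute)
  then have "path_turns (z # R) \<subseteq># H"
    using z assms(1) by (auto simp: valid_def subseteq_mset_def Suc_le_eq)
  ultimately show ?thesis by (simp add: valid_def R)
qed

lemma stuck_turn_degree:
  assumes "valid R" "extensions R = []"
  shows "turn_degree (H - path_turns R) (R ! 1) (R ! 0) = 0"
proof (rule ccontr)
  assume "turn_degree (H - path_turns R) (R ! 1) (R ! 0) \<noteq> 0"
  then obtain P where P: "(R ! 0, P) \<in># H - path_turns R" "R ! 1 \<in> P"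
    using turn_degree_pos[of "H - path_turns R" "R ! 1" "R ! 0"] by auto
  then have "card P = 2" using H_turn in_diffD by fast
  then obtain z where "P = {R ! 1, z}" using P(2) by (auto simp: card_2_iff)
  then have "z \<in> set (extensions R)" using P(1) by (simp add: extension_iff in_diff_count)
  then show False using assms(2) by simp
qed

text \<open>The traversals of the first edge are counted from both ends. At \<open>r\<close> both
  turns with \<open>s\<close> are used and the start of the path is a third traversal. At
  \<open>s\<close> there are at most two turns with \<open>r\<close>, so the third traversal must be
  accounted for by the end of the path, which therefore runs from \<open>r\<close> to
  \<open>s\<close> as well.\<close>

lemma stuck_closed:
  assumes "valid R" "extensions R = []"
  shows "closed_path R \<and> 3 \<le> length R"
proof -
  obtain r s rs where R: "R = r # s # rs" "{r, s} \<in> E" using assms(1) by (rule valid_ConsE)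
  have rs: "r \<noteq> s" using edge_set_card_2(1)[OF G R(2)] .
  have sub: "path_turns R \<subseteq># H" and len: "2 \<le> length R" using assms(1) by (auto simp: valid_def)
  have "{s, r} \<in> E" using R(2) by (simp add: insert_commute)
  then have ge: "2 \<le> turn_degree (path_turns R) s r"
    using stuck_turn_degree[OF assms] turn_degree_H[of s r]
    unfolding turn_degree_diff[OF sub] by (simp add: R)
  have "turn_degree (path_turns R) s r + of_bool (R ! 0 = r \<and> R ! 1 = s) +
    of_bool (last R = r \<and> last (butlast R) = s) = count (path_pairs R) {s, r}"
    by (rule turn_degree_path[OF len rs[symmetric] valid_card[OF assms(1)]])
  then have "3 \<le> count (path_pairs R) {r, s}"
    using ge by (simp add: R(1) insert_commute)
  moreover have "turn_degree (path_turns R) r s + of_bool (R ! 0 = s \<and> R ! 1 = r) +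
    of_bool (last R = s \<and> last (butlast R) = r) = count (path_pairs R) {r, s}"
    by (rule turn_degree_path[OF len rs valid_card[OF assms(1)]])
  moreover have "turn_degree (path_turns R) r s \<le> 2"
    using turn_degree_mono[OF sub, of r s] turn_degree_H[OF R(2)] by simp
  moreover have "of_bool (R ! 0 = s \<and> R ! 1 = r) = (0::nat)" using rs by (simp add: R(1))
  ultimately have "of_bool (last R = s \<and> last (butlast R) = r) \<noteq> (0::nat)" by linarith
  then have "last R = s \<and> last (butlast R) = r" by (metis of_bool_eq(1))
  moreover have "3 \<le> length R"
    using ge by (cases rs) (auto simp: R(1))
  ultimately show ?thesis using len by (auto simp: closed_path_def R(1))
qed

text \<open>With the head \<open>r\<close> the turn from \<open>r\<close> over \<open>s\<close> to
  \<open>t\<close> is lost. The path ends with \<open>r\<close> and \<open>s\<close>, so appending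
  \<open>t\<close> adds the same turn again.\<close>

lemma rotate_closed:
  assumes "valid R" "closed_path R" "3 \<le> length R"
  shows "valid (rotate_path R)" "closed_path (rotate_path R)"
    "path_turns (rotate_path R) = path_turns R" "length (rotate_path R) = length R"
proof -
  obtain r s t rs where R: "R = r # s # t # rs"
    using assms(3) by (cases R; cases "tl R"; cases "tl (tl R)") auto
  have rot: "rotate_path R = (s # t # rs) @ [t]" by (simp add: rotate_path_def R)
  have last: "last (s # t # rs) = s" "last (butlast (s # t # rs)) = r"
    using assms(2) by (auto simp: closed_path_def R)
  show T: "path_turns (rotate_path R) = path_turns R"
    unfolding rot by (subst path_turns_snoc) (use last in \<open>auto simp: R\<close>)
  have "(s, {r, t}) \<in># H" using assms(1) by (auto simp: valid_def R dest: mset_subset_eqD)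
  then have "{s, t} \<in> E" by (rule H_edges)
  then show "valid (rotate_path R)" using assms(1) T by (auto simp: valid_def rot)
  show "closed_path (rotate_path R)" using last by (auto simp: closed_path_def rot butlast_append)
  show "length (rotate_path R) = length R" by (simp add: rotate_path_def R)
qed

lemma rotate_funpow:
  assumes "valid R" "closed_path R" "3 \<le> length R"
  shows "valid ((rotate_path ^^ i) R) \<and> closed_path ((rotate_path ^^ i) R) \<and>
    path_turns ((rotate_path ^^ i) R) = path_turns R \<and> length ((rotate_path ^^ i) R) = length R"
  by (induction i) (use assms rotate_closed in auto)

lemma rotate_funpow_drop:
  assumes "3 \<le> length R" "i \<le> length R - 2"
  shows "(rotate_path ^^ i) R = drop i R @ take i (drop 2 R)"
  using assms(2)
proof (induction i)
  case (Suc i)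
  have "tl (drop i R @ take i (drop 2 R)) = drop (Suc i) R @ take i (drop 2 R)"
    using Suc.prems by (simp add: drop_Suc tl_drop[symmetric])
  moreover have "(drop i R @ take i (drop 2 R)) ! 2 = drop 2 R ! i"
    using Suc.prems by (cases "2 < length R - i") (auto simp: nth_append)
  moreover have "take (Suc i) (drop 2 R) = take i (drop 2 R) @ [drop 2 R ! i]"
    using Suc.prems by (simp add: take_Suc_conv_app_nth)
  ultimately show ?case using Suc by (simp add: rotate_path_def)
qed simp

lemma rotate_funpow_head:
  assumes "3 \<le> length R" "i \<le> length R - 2"
  shows "(rotate_path ^^ i) R ! 0 = R ! i" "(rotate_path ^^ i) R ! 1 = R ! Suc i"
  unfolding rotate_funpow_drop[OF assms] using assms by (auto simp: nth_append)

text \<open>The first and the last edge agree in position and direction, so the two end corrections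
  in \<open>turn_degree_path\<close> are exchanged when \<open>x\<close> and \<open>y\<close> are.
  The number of traversals is symmetric anyway.\<close>

lemma closed_path_symmetric:
  assumes "valid R" "closed_path R" "x \<noteq> y"
  shows "turn_degree (path_turns R) x y = turn_degree (path_turns R) y x"
proof -
  have len: "2 \<le> length R" using assms(1) by (simp add: valid_def)
  have "{x, y} = {y, x}" by blast
  then show ?thesis
    using turn_degree_path[OF len assms(3) valid_card[OF assms(1)]]
      turn_degree_path[OF len assms(3)[symmetric] valid_card[OF assms(1)]] assms(2,3)
    unfolding closed_path_def by (auto simp: conj_commute)
qed

text \<open>
  If no unused turn continues a traversal, then the edges of the path have no unused turns, so
  neither have the edges adjacent to them in the junction graphs.
\<close>

lemma stuck_complete:
  assumes R: "valid R" "closed_path R" "3 \<le> length R"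
    and stuck: "\<And>i. i \<le> length R - 2 \<Longrightarrow> extensions ((rotate_path ^^ i) R) = []"
  shows "path_turns R = H"
proof -
  have sub: "path_turns R \<subseteq># H" using R(1) by (simp add: valid_def)
  have head: "turn_degree (H - path_turns R) (R ! Suc i) (R ! i) = 0" if "i \<le> length R - 2" for i
    using stuck_turn_degree[OF _ stuck[OF that]] rotate_funpow[OF R, of i]
      rotate_funpow_head[OF R(3) that] by simp
  have free: "turn_degree (H - path_turns R) x y = 0"
    if x_y: "{x, y} \<in># path_pairs R" and that: "{x, y} \<in> E" for x y
  proof -
    obtain i where "i < length R - 1" and i': "{x, y} = {R ! i, R ! Suc i}"
      using in_path_pairs[OF x_y] by blast
    then have i: "i \<le> length R - 2" by simp
    have xy: "x \<noteq> y" by (rule edge_set_card_2(1)[OF G that])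
    \<comment> \<open>Being stuck concerns only turns at the first vertex of a traversal; the
      symmetry of both degrees carries it over to the second.\<close>
    have "turn_degree H x y = turn_degree H y x"
      using turn_degree_H that by (simp add: insert_commute)
    then have "turn_degree (H - path_turns R) x y = turn_degree (H - path_turns R) y x"
      using closed_path_symmetric[OF R(1,2) xy] by (simp add: turn_degree_diff[OF sub])
    then show ?thesis using head[OF i] i' by (auto simp: doubleton_eq_iff)
  qed
  \<comment> \<open>Walking along the cycle \<open>p y\<close>: if the edge to \<open>u\<close> is
    on the path, the next turn of the cycle is not free, so the path makes it and contains the next
    edge too.\<close>
  have adj: "{y, z} \<in># path_pairs R"
    if "{x, y} \<in># path_pairs R" "{x, y} \<in> E" "{y, z} \<in> E" for x y z
  proof -
    have y: "y < n" using edge_set_card_2[OF G that(2)] by simp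
    have "x \<in> set (p y)" "z \<in> set (p y)"
      using that y p(2)[OF y] by (auto simp: neighbours_def insert_commute)
    then have "(x, z) \<in> {(x, z). {x, z} \<in># cycle_pairs (p y)}\<^sup>*"
      using cycle_pairs_connected[of "p y"] by (auto simp: connected_graph_def)
    then show ?thesis
    proof induction
      case base
      then show ?case using that by (simp add: insert_commute)
    next
      case (step u v)
      then have uv: "(y, {u, v}) \<in># H" by (simp add: in_H y)
      then have "{u, y} \<in> E" by (rule H_edges)
      then have "(y, {u, v}) \<notin># H - path_turns R"
        using turn_degree_0[OF free[of u y]] step(3) by (auto simp: insert_commute)
      then have "(y, {u, v}) \<in># path_turns R" using uv
        by (metis in_diff_count not_in_iff count_greater_zero_iff)
      then show ?case using path_turns_edges by fast
    qed
  qed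
  obtain r s rs where rs: "R = r # s # rs" "{r, s} \<in> E" using R(1) by (rule valid_ConsE)
  \<comment> \<open>Connectedness of the graph: \<open>adj\<close> lets the edges of the path spread
    from \<open>{r, s}\<close> across every vertex.\<close>
  have all: "\<exists>x. {x, v} \<in># path_pairs R \<and> {x, v} \<in> E" if "v < n" for v
  proof -
    have "(s, v) \<in> {(x, y). {x, y} \<in> E}\<^sup>*"
      using G edge_set_card_2[OF G rs(2)] that by (auto simp: admissible_graph_def connected_graph_def)
    then show ?thesis
    proof induction
      case base
      then show ?case using rs by auto
    next
      case (step u v)
      then show ?case using adj by blast
    qed
  qed
  have "H - path_turns R = {#}"
  proof (rule ccontr)
    assume "H - path_turns R \<noteq> {#}"
    then obtain y P where t: "(y, P) \<in># H - path_turns R" by fastforce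
    then have "(y, P) \<in># H" by (rule in_diffD)
    note H = H_turn[OF this] this
    then obtain z where z: "z \<in> P" by fastforce
    then have zy: "{z, y} \<in> E" using H by (auto simp: neighbours_def)
    have "y < n" using H by (simp add: in_H)
    then obtain x where "{x, y} \<in># path_pairs R" "{x, y} \<in> E" using all by blast
    then have "{z, y} \<in># path_pairs R" using adj[of x y z] zy by (simp add: insert_commute)
    from turn_degree_0[OF free[OF this zy] t] show False using z by simp
  qed
  then show ?thesis using sub by (metis Multiset.diff_add add_0 subset_mset.diff_add)
qed

text \<open>When the path is stuck, \<open>stuck_complete\<close> yields a rotation with an
  extension. The least one is taken, because \<open>step\<close> rotates only as long as there is
  none.\<close>

lemma progress:
  assumes "valid R" "path_turns R \<noteq> H"
  shows "\<exists>k. k \<le> length R \<and> valid ((step ^^ k) R) \<and> length ((step ^^ k) R) = Suc (length R)"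
proof (cases "extensions R = []")
  case False
  then have "valid (step R)" using valid_extend[OF assms(1)] by (simp add: step_def)
  then show ?thesis using False assms(1) by (intro exI[of _ 1]) (auto simp: step_def valid_def)
next
  case True
  note R = assms(1) stuck_closed[OF assms(1) True, THEN conjunct1]
    stuck_closed[OF assms(1) True, THEN conjunct2]
  obtain i where i: "i \<le> length R - 2" "extensions ((rotate_path ^^ i) R) \<noteq> []"
    using stuck_complete[OF R] assms(2) by blast
  define j where "j = (LEAST i. extensions ((rotate_path ^^ i) R) \<noteq> [])"
  have j: "extensions ((rotate_path ^^ j) R) \<noteq> []" unfolding j_def using i(2) by (rule LeastI)
  have "j \<le> i" unfolding j_def using i(2) by (rule Least_le)
  have before: "extensions ((rotate_path ^^ l) R) = []" if "l < j" for l
    using not_less_Least[of l] that unfolding j_def by blast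
  have rot: "(step ^^ l) R = (rotate_path ^^ l) R" if "l \<le> j" for l
    using that by (induction l) (auto simp: step_def before)
  define S where "S = (rotate_path ^^ j) R"
  have S: "valid S" "length S = length R" "extensions S \<noteq> []"
    using rotate_funpow[OF R, of j] j by (auto simp: S_def)
  have "(step ^^ Suc j) R = hd (extensions S) # S"
    using rot[of j] S(3) by (simp add: step_def S_def)
  moreover have "Suc j \<le> length R" using \<open>j \<le> i\<close> i(1) R(3) by linarith
  ultimately show ?thesis
    using valid_extend[OF S(1), of "hd (extensions S)"] S by (intro exI[of _ "Suc j"]) auto
qed

lemma valid_length: "valid R \<Longrightarrow> length R \<le> size H + 2"
  using size_mset_mono[of "path_turns R" H] by (auto simp: valid_def size_path_turns)

text \<open>A valid path has at most \<open>size H + 2\<close> vertices, and by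
  \<open>progress\<close> each further vertex takes at most that many steps.\<close>

lemma completion:
  assumes "valid R"
  shows "\<exists>k \<le> (size H + 2 - length R) * (size H + 2).
    valid ((step ^^ k) R) \<and> path_turns ((step ^^ k) R) = H"
  using assms
proof (induction "size H + 2 - length R" arbitrary: R)
  case 0
  have "path_turns R = H"
  proof (rule ccontr)
    assume "path_turns R \<noteq> H"
    from progress[OF 0(2) this] obtain k where
      "valid ((step ^^ k) R)" "length ((step ^^ k) R) = Suc (length R)" by blast
    then show False using 0(1) valid_length by fastforce
  qed
  then show ?case using 0 by (intro exI[of _ 0]) simp
next
  case (Suc m)
  show ?case
  proof (cases "path_turns R = H")
    case True
    then show ?thesis using Suc by (intro exI[of _ 0]) simp
  next
    case False
    from progress[OF Suc(3) this] obtain k where k: "k \<le> length R"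
      "valid ((step ^^ k) R)" "length ((step ^^ k) R) = Suc (length R)" by blast
    have m: "m = size H + 2 - length ((step ^^ k) R)" using Suc(2) k(3) by simp
    from Suc(1)[OF m k(2), folded m] obtain l where l: "l \<le> m * (size H + 2)"
      "valid ((step ^^ l) ((step ^^ k) R))" "path_turns ((step ^^ l) ((step ^^ k) R)) = H"
      by blast
    have "l + k \<le> Suc m * (size H + 2)"
      using l(1) k(1) valid_length[OF Suc(3)] by simp
    then show ?thesis using l(2,3) Suc(2)
      by (intro exI[of _ "l + k"]) (simp add: funpow_add)
  qed
qed

lemma complete_stuck: "path_turns R = H \<Longrightarrow> extensions R = []"
  by (simp add: extensions_def)

text \<open>A complete path is merely rotated by further steps. The program may thus run for a fixed
  number of steps and needs no test for completion.\<close>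

lemma complete_persistent:
  assumes "valid R" "path_turns R = H"
  shows "valid ((step ^^ k) R) \<and> path_turns ((step ^^ k) R) = H"
proof (induction k)
  case (Suc k)
  note stuck = complete_stuck[OF Suc[THEN conjunct2]]
  show ?case
    using rotate_closed[of "(step ^^ k) R"] Suc stuck stuck_closed[of "(step ^^ k) R"]
    by (simp add: step_def[of "(step ^^ k) R"])
qed (use assms in simp)

lemma valid_funpow:
  assumes "valid R"
  shows "valid ((step ^^ k) R)"
proof (induction k)
  case (Suc k)
  then show ?case
    using rotate_closed(1)[of "(step ^^ k) R"] stuck_closed[of "(step ^^ k) R"]
      valid_extend[of "(step ^^ k) R" "hd (extensions ((step ^^ k) R))"]
    by (auto simp: step_def[of "(step ^^ k) R"])
qed (use assms in simp)

lemma trace_complete: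
  assumes "valid R" "(size H + 2) * (size H + 2) \<le> k"
  shows "path_turns ((step ^^ k) R) = H" "closed_path ((step ^^ k) R)" "3 \<le> length ((step ^^ k) R)"
proof -
  obtain l where l: "l \<le> (size H + 2 - length R) * (size H + 2)"
    "valid ((step ^^ l) R)" "path_turns ((step ^^ l) R) = H" using completion[OF assms(1)] by blast
  have "(size H + 2 - length R) * (size H + 2) \<le> (size H + 2) * (size H + 2)"
    by (rule mult_right_mono) auto
  then have "l \<le> k" using l(1) assms(2) by linarith
  then obtain m where "k = m + l" by (metis le_iff_add add.commute)
  then show T: "path_turns ((step ^^ k) R) = H"
    using complete_persistent[OF l(2,3), of m] by (simp add: funpow_add)
  note stuck = complete_stuck[OF this]
  show "closed_path ((step ^^ k) R)" "3 \<le> length ((step ^^ k) R)"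
    using stuck_closed[OF valid_funpow[OF assms(1)] stuck] by auto
qed

lemma size_H: "size H \<le> n * n"
proof -
  have "size (cycle_pairs (p v)) \<le> n" if "v < n" for v
  proof -
    have "length (p v) = card (neighbours E v)" using distinct_card[OF p(1)[OF that]] p(2)[OF that] by simp
    also have "\<dots> \<le> card {..<n}"
      using neighbours_admissible(3)[OF G, of v] that by (intro card_mono) auto
    finally show ?thesis by (simp add: cycle_pairs_def)
  qed
  then have "(\<Sum>v<n. size (cycle_pairs (p v))) \<le> (\<Sum>v<n. n)" by (intro sum_mono) auto
  moreover have "size (\<Sum>v<m. image_mset (Pair v) (cycle_pairs (p v))) =
      (\<Sum>v<m. size (cycle_pairs (p v)))" for m
    by (induction m) auto
  ultimately have "size H \<le> (\<Sum>v<n. n)" by (simp add: H_def)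
  then show ?thesis by simp
qed

text \<open>The last two positions of the path wrap around to positions 0 and 1 of the walk. The
  length 4 ensures that the walk has a position 1.\<close>

lemma walk_turns_closed_path:
  assumes "closed_path R" "4 \<le> length R"
  shows "walk_turns (take (length R - 2) R) = path_turns R"
proof -
  let ?w = "take (length R - 2) R"
  have v: "walk_vertex ?w i = R ! i" if i: "i < length R" for i
  proof -
    consider "i < length R - 2" | "i = length R - 2" | "i = length R - 1"
      using i assms(2) by linarith
    then show ?thesis
    proof cases
      case 2
      have "butlast R \<noteq> []" using assms(2) by (simp flip: length_greater_0_conv)
      then show ?thesis using assms 2
        by (simp add: walk_vertex_def closed_path_def last_conv_nth nth_butlast numeral_2_eq_2)
    next
      case 3
      then have "i = Suc (length R - 2)" using assms(2) by linarith
      then have "i mod (length R - 2) = 1" using assms(2) by (simp add: mod_Suc)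
      moreover have "R \<noteq> []" using assms(2) by auto
      ultimately show ?thesis using 3 assms
        by (simp add: walk_vertex_def closed_path_def last_conv_nth)
    qed (simp add: walk_vertex_def)
  qed
  have len: "length ?w = length R - 2" by simp
  show ?thesis
    unfolding walk_turns_def path_turns_conv_nth len
    by (intro image_mset_cong) (simp add: v)
qed

text \<open>Three entries could close up only with the first two equal, and there are no
  loops.\<close>

lemma closed_path_length_4:
  assumes "valid R" "closed_path R" "3 \<le> length R"
  shows "4 \<le> length R"
proof (rule ccontr)
  assume "\<not> 4 \<le> length R"
  then have "length R = 3" using assms(3) by simp
  then obtain r s t where "R = [r, s, t]" by (metis length_0_conv length_Suc_conv numeral_3_eq_3)
  then show False using assms(1,2) edge_set_card_2(1)[OF G, of r r] by (auto simp: closed_path_def valid_def)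
qed

text \<open>The number of steps is expressed by \<open>n\<close> through the bound
  \<open>n * n\<close> on the size of \<open>H\<close>, so that it is easily computed.\<close>

theorem trace_exactly_double:
  fixes \<alpha> :: "nat set set \<Rightarrow> 'c::linordered_field"
  assumes "valid R" "(n * n + 2) * (n * n + 2) \<le> k"
  defines "S \<equiv> (step ^^ k) R"
  defines "w \<equiv> take (length S - 2) S"
  shows "exactly_double_threading {..<n} E w"
    "walk_cost \<alpha> w = (\<Sum>v<n. \<Sum>P\<in>#cycle_pairs (p v). \<alpha> (edge_turn (v, P)))"
proof -
  have "(size H + 2) * (size H + 2) \<le> (n * n + 2) * (n * n + 2)"
    using size_H by (intro mult_mono) auto
  then have "(size H + 2) * (size H + 2) \<le> k" using assms(2) by linarith
  note S = trace_complete[OF assms(1) this, folded S_def]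
  have valid: "valid S" unfolding S_def by (rule valid_funpow[OF assms(1)])
  have len: "4 \<le> length S" by (rule closed_path_length_4[OF valid S(2,3)])
  have turns: "walk_turns w = H"
    unfolding w_def using walk_turns_closed_path[OF S(2) len] S(1) by simp
  have edge: "walk_edge w i \<in> E" "walk_vertex w i < n" if "i < length w" for i
  proof -
    have "(walk_vertex w (Suc i), {walk_vertex w i, walk_vertex w (Suc (Suc i))}) \<in># H"
      unfolding turns[symmetric] walk_turns_def using that by auto
    from H_edges(1)[OF this] show "walk_edge w i \<in> E" by (simp add: walk_edge_def)
    then show "walk_vertex w i < n" using edge_set_card_2(2)[OF G] by (auto simp: walk_edge_def)
  qed
  have cw: "closed_walk {..<n} E w"
    unfolding closed_walk_def
  proof (intro conjI)
    show "w \<noteq> []" using len by (auto simp: w_def)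
    show "set w \<subseteq> {..<n}"
    proof
      fix x assume "x \<in> set w"
      then obtain i where "i < length w" "x = w ! i" by (auto simp: in_set_conv_nth)
      then show "x \<in> {..<n}" using edge(2)[of i] by (simp add: walk_vertex_def)
    qed
  qed (use edge in auto)
  show "exactly_double_threading {..<n} E w"
    unfolding exactly_double_threading_iff[OF G] turns using cw p turns_at_H by auto
  show "walk_cost \<alpha> w = (\<Sum>v<n. \<Sum>P\<in>#cycle_pairs (p v). \<alpha> (edge_turn (v, P)))"
    using walk_cost_conv_vertices[OF cw] turns_at_H by (simp add: turns)
qed

end

section \<open>Costs of threadings as sums over cyclic orders\<close>

lemma tour_length_conv_cycle_pairs:
  assumes "distinct q" "2 \<le> length q"
    and "\<And>i j. i \<in> set q \<Longrightarrow> j \<in> set q \<Longrightarrow> i \<noteq> j \<Longrightarrow> d i j = f {g i, g j}"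
  shows "tour_length d q = (\<Sum>P\<in>#cycle_pairs (map g q). f P)"
proof -
  have "d (q ! i) (q ! (Suc i mod length q)) = f {g (q ! i), g (q ! (Suc i mod length q))}"
    if "i < length q" for i
  proof (rule assms(3))
    have *: "Suc i mod length q < length q" by (rule mod_less_divisor) (use that in linarith)
    show "q ! i \<in> set q" "q ! (Suc i mod length q) \<in> set q" using that * by auto
    have "Suc i mod length q \<noteq> i" using that assms(2) by (auto simp: mod_Suc)
    then show "q ! i \<noteq> q ! (Suc i mod length q)"
      using that * assms(1) by (simp add: nth_eq_iff_index_eq)
  qed
  moreover have "Suc i mod length q < length q" if "i < length q" for i
    by (rule mod_less_divisor) (use that in linarith)
  ultimately show ?thesis
    by (auto simp: tour_length_def cycle_pairs_def multiset.map_comp comp_def sum_unfold_sum_mset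
        intro!: arg_cong[where f = sum_mset] image_mset_cong)
qed

context turn_system
begin

lemma exists_valid: "\<exists>R. valid R"
proof -
  have "0 < n" using G by (auto simp: admissible_graph_def)
  then have "neighbours E 0 \<noteq> {}" using neighbours_admissible(2)[OF G, of 0] by auto
  then obtain x where "{x, 0} \<in> E" by (auto simp: neighbours_def)
  then have "valid [x, 0]" by (simp add: valid_def)
  then show ?thesis ..
qed

text \<open>Every family of cyclic orders is realised, so the vertices can be optimised
  independently.\<close>

lemma exists_exactly_double_threading:
  fixes \<alpha> :: "nat set set \<Rightarrow> 'c::linordered_field"
  shows "\<exists>w. exactly_double_threading {..<n} E w \<and>
    walk_cost \<alpha> w = (\<Sum>v<n. \<Sum>P\<in>#cycle_pairs (p v). \<alpha> (edge_turn (v, P)))"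
proof -
  obtain R where "valid R" using exists_valid by blast
  from trace_exactly_double(1)[OF this order_refl]
    trace_exactly_double(2)[OF this order_refl, where \<alpha> = \<alpha>] show ?thesis by blast
qed

end

text \<open>The converse of realisability: no threading is cheaper than the best orders at the
  single vertices.\<close>

lemma exactly_double_threading_cost:
  fixes n :: nat
  assumes "admissible_graph {..<n} E" "exactly_double_threading {..<n} E w"
  shows "\<exists>p. (\<forall>v<n. distinct (p v) \<and> set (p v) = neighbours E v) \<and>
    walk_cost \<alpha> w = (\<Sum>v<n. \<Sum>P\<in>#cycle_pairs (p v). \<alpha> (edge_turn (v, P)))"
proof -
  have cw: "closed_walk {..<n} E w"
    using assms by (simp add: exactly_double_threading_iff)
  have "\<forall>v<n. \<exists>p. distinct p \<and> set p = neighbours E v \<and> turns_at (walk_turns w) v = cycle_pairs p"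
    using assms by (simp add: exactly_double_threading_iff)
  then obtain p where p: "\<forall>v<n. distinct (p v) \<and> set (p v) = neighbours E v \<and>
    turns_at (walk_turns w) v = cycle_pairs (p v)" by metis
  then show ?thesis using walk_cost_conv_vertices[OF cw finite_lessThan, of \<alpha>]
    by (intro exI[of _ p]) auto
qed

section \<open>From tours to threadings\<close>

definition complete_edges :: "nat \<Rightarrow> nat set set" where
  "complete_edges k = {{u, v} | u v. u < k \<and> v < k \<and> u \<noteq> v}"

text \<open>Vertex \<open>m\<close> is the only one with costly turns; the cities are the edges incident to it.\<close>

definition hub_cost :: "nat \<Rightarrow> (nat \<Rightarrow> nat \<Rightarrow> rat) \<Rightarrow> nat set set \<Rightarrow> rat" where
  "hub_cost m d \<tau> = (if m \<in> \<Inter>\<tau> then d (Min (\<Union>\<tau> - {m})) (Max (\<Union>\<tau> - {m})) else 0)"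

lemma in_complete_edges: "{u, v} \<in> complete_edges k \<longleftrightarrow> u < k \<and> v < k \<and> u \<noteq> v"
  by (auto simp: complete_edges_def doubleton_eq_iff)

lemma neighbours_complete: "v < k \<Longrightarrow> neighbours (complete_edges k) v = {..<k} - {v}"
  by (auto simp: neighbours_def in_complete_edges)

lemma incident_complete:
  assumes "v < k"
  shows "incident_edges (complete_edges k) v = (\<lambda>u. {u, v}) ` ({..<k} - {v})"
  using assms by (auto simp: incident_edges_def complete_edges_def insert_commute image_iff)

lemma admissible_complete:
  assumes "3 \<le> k"
  shows "admissible_graph {..<k} (complete_edges k)"
  unfolding admissible_graph_def
proof (intro conjI ballI)
  show "{..<k} \<noteq> {}" using assms by (simp add: lessThan_empty_iff)
  show "connected_graph {..<k} (complete_edges k)"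
    unfolding connected_graph_def
  proof (intro ballI)
    fix u v assume "u \<in> {..<k}" "v \<in> {..<k}"
    then show "(u, v) \<in> {(x, y). {x, y} \<in> complete_edges k}\<^sup>*"
      by (cases "u = v") (auto simp: in_complete_edges)
  qed
  fix v assume v: "v \<in> {..<k}"
  have "card (incident_edges (complete_edges k) v) = card ({..<k} - {v})"
    unfolding incident_complete[OF v[unfolded lessThan_iff]]
    by (rule card_image[OF inj_on_subset[OF inj_edge]]) simp
  then show "2 \<le> card (incident_edges (complete_edges k) v)" using v assms by simp
qed (auto simp: complete_edges_def)

lemma turn_complete_iff:
  assumes "u < k" "v < k" "w < k"
  shows "{{u, v}, {v, w}} \<in> turns (complete_edges k) v \<longleftrightarrow> u \<noteq> v \<and> w \<noteq> v \<and> u \<noteq> w"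
proof
  assume "{{u, v}, {v, w}} \<in> turns (complete_edges k) v"
  then obtain e f where "{{u, v}, {v, w}} = {e, f}" "e \<in> complete_edges k" "f \<in> complete_edges k" "e \<noteq> f"
    by (auto simp: turns_def incident_edges_def)
  then have "{u, v} \<in> complete_edges k \<and> {v, w} \<in> complete_edges k \<and> {u, v} \<noteq> {v, w}"
    by (metis doubleton_eq_iff insert_iff singletonD)
  then show "u \<noteq> v \<and> w \<noteq> v \<and> u \<noteq> w" by (auto simp: in_complete_edges doubleton_eq_iff)
next
  assume "u \<noteq> v \<and> w \<noteq> v \<and> u \<noteq> w"
  then have "{u, v} \<in> incident_edges (complete_edges k) v" "{v, w} \<in> incident_edges (complete_edges k) v"
    "{u, v} \<noteq> {v, w}"
    using assms by (auto simp: incident_edges_def in_complete_edges doubleton_eq_iff)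
  then show "{{u, v}, {v, w}} \<in> turns (complete_edges k) v" unfolding turns_def by blast
qed

text \<open>The vertex of a turn is the intersection of its two edges, and the rest of their union
  is the pair of outer ends. \<open>Min\<close> and \<open>Max\<close> lose the order of this pair,
  which is where the symmetry of \<open>d\<close> enters.\<close>

lemma hub_cost_turn:
  assumes "u \<noteq> v" "w \<noteq> v" "u \<noteq> w" "d u w = d w u"
  shows "hub_cost m d {{u, v}, {v, w}} = (if v = m then d u w else 0)"
proof -
  have I: "\<Inter>{{u, v}, {v, w}} = {v}" using assms by auto
  have U: "\<Union>{{u, v}, {v, w}} - {v} = {u, w}" using assms by auto
  have M: "Min {u, w} = min u w" "Max {u, w} = max u w" by simp_all
  show ?thesis
  proof (cases "v = m")
    case True
    have "hub_cost m d {{u, v}, {v, w}} = d (min u w) (max u w)"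
      unfolding hub_cost_def True[symmetric] I U M by (simp only: singletonI if_True)
    then show ?thesis using assms(4) True by (cases "u \<le> w") (simp_all add: min_def max_def)
  next
    case False
    then show ?thesis unfolding hub_cost_def I by simp
  qed
qed

lemma hub_cost_nonneg:
  assumes "\<And>i j. 0 \<le> d i j"
  shows "0 \<le> hub_cost m d \<tau>"
  using assms by (simp add: hub_cost_def)

text \<open>The cyclic orders away from the hub cost nothing, and the one at the hub is a tour of
  all other vertices.\<close>

lemma hub_threading_cost:
  assumes m: "2 \<le> m" and d: "\<And>i j. d i j = d j i"
    and p: "\<And>v. v < Suc m \<Longrightarrow> distinct (p v)" "\<And>v. v < Suc m \<Longrightarrow> set (p v) = {..<Suc m} - {v}"
  shows "(\<Sum>v<Suc m. \<Sum>P\<in>#cycle_pairs (p v). hub_cost m d (edge_turn (v, P))) = tour_length d (p m)"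
proof -
  have len: "2 \<le> length (p v)" if "v < Suc m" for v
    using distinct_card[OF p(1)[OF that]] p(2)[OF that] that m by simp
  have eq: "hub_cost m d (edge_turn (v, P)) = (if v = m then d (Min P) (Max P) else 0)"
    if v: "v < Suc m" and P: "P \<in># cycle_pairs (p v)" for v P
  proof -
    have "card P = 2" by (rule cycle_pairs_card[OF p(1)[OF v] len[OF v] P])
    moreover have "P \<subseteq> {..<Suc m} - {v}" using cycle_pairs_subset[OF P] p(2)[OF v] by simp
    ultimately obtain x z where xz: "P = {x, z}" "x \<noteq> z" "x \<noteq> v" "z \<noteq> v"
      by (auto simp: card_2_iff)
    then have "hub_cost m d (edge_turn (v, P)) = (if v = m then d x z else 0)"
      unfolding xz(1) edge_turn_pair using d by (intro hub_cost_turn) auto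
    moreover have "d (Min P) (Max P) = d x z" using xz d by (simp add: min_def max_def)
    ultimately show ?thesis by simp
  qed
  have "(\<Sum>v<Suc m. \<Sum>P\<in>#cycle_pairs (p v). hub_cost m d (edge_turn (v, P))) =
      (\<Sum>v<Suc m. \<Sum>P\<in>#cycle_pairs (p v). if v = m then d (Min P) (Max P) else 0)"
    by (intro sum.cong refl arg_cong[where f = sum_mset] image_mset_cong eq) auto
  also have "\<dots> = (\<Sum>P\<in>#cycle_pairs (map id (p m)). d (Min P) (Max P))" by simp
  also have "\<dots> = tour_length d (p m)"
    by (rule tour_length_conv_cycle_pairs[symmetric]) (use p(1)[of m] len[of m] d in \<open>simp_all add: min_def max_def\<close>)
  finally show ?thesis .
qed

lemma hub_threading_iff_tour:
  assumes m: "2 \<le> m" and d: "\<And>i j. d i j = d j i"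
  shows "(\<exists>w. exactly_double_threading {..<Suc m} (complete_edges (Suc m)) w \<and>
      walk_cost (hub_cost m d) w \<le> C) \<longleftrightarrow> (\<exists>q. tour m q \<and> tour_length d q \<le> C)"
proof
  have hub: "{..<Suc m} - {m} = {..<m}" by auto
  have G: "admissible_graph {..<Suc m} (complete_edges (Suc m))"
    using m by (intro admissible_complete) simp
  {
    assume "\<exists>w. exactly_double_threading {..<Suc m} (complete_edges (Suc m)) w \<and>
      walk_cost (hub_cost m d) w \<le> C"
    then obtain w where w: "exactly_double_threading {..<Suc m} (complete_edges (Suc m)) w"
      "walk_cost (hub_cost m d) w \<le> C" by blast
    obtain p where p: "\<forall>v<Suc m. distinct (p v) \<and> set (p v) = neighbours (complete_edges (Suc m)) v"
      and c: "walk_cost (hub_cost m d) w =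
        (\<Sum>v<Suc m. \<Sum>P\<in>#cycle_pairs (p v). hub_cost m d (edge_turn (v, P)))"
      using exactly_double_threading_cost[OF G w(1)] by blast
    have p': "distinct (p v)" "set (p v) = {..<Suc m} - {v}" if "v < Suc m" for v
      using p that by (auto simp: neighbours_complete)
    have "tour m (p m)" using p'[of m] by (simp add: tour_def hub)
    moreover have "tour_length d (p m) \<le> C"
      using w(2) hub_threading_cost[of m d p, OF m d p'] unfolding c by simp
    ultimately show "\<exists>q. tour m q \<and> tour_length d q \<le> C" by blast
  }
  {
    assume "\<exists>q. tour m q \<and> tour_length d q \<le> C"
    then obtain q where q: "tour m q" "tour_length d q \<le> C" by blast
    \<comment> \<open>Away from the hub any order will do, here the sorted one.\<close>
    define p where "p v = (if v = m then q else sorted_list_of_set ({..<Suc m} - {v}))" for v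
    have pd: "distinct (p v)" "set (p v) = {..<Suc m} - {v}" if "v < Suc m" for v
      using q(1) that by (simp_all add: p_def tour_def hub)
    interpret turn_system "Suc m" "complete_edges (Suc m)" p
      using G pd by unfold_locales (auto simp: neighbours_complete)
    from exists_exactly_double_threading[of "hub_cost m d"] obtain w where
      "exactly_double_threading {..<Suc m} (complete_edges (Suc m)) w"
      "walk_cost (hub_cost m d) w = tour_length d (p m)"
      using hub_threading_cost[of m d p, OF m d pd] by auto
    then show "\<exists>w. exactly_double_threading {..<Suc m} (complete_edges (Suc m)) w \<and>
      walk_cost (hub_cost m d) w \<le> C" using q(2) by (auto simp: p_def)
  }
qed

text \<open>Zero distances outside the given cities make \<open>d\<close> symmetric and nonnegative
  everywhere and allow for an additional city.\<close>

definition pad :: "nat \<Rightarrow> (nat \<Rightarrow> nat \<Rightarrow> rat) \<Rightarrow> nat \<Rightarrow> nat \<Rightarrow> rat" where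
  "pad n d i j = (if i < n \<and> j < n then d i j else 0)"

lemma tour_length_cong:
  assumes "tour n q" "\<And>i j. i < n \<Longrightarrow> j < n \<Longrightarrow> d i j = d' i j"
  shows "tour_length d q = tour_length d' q"
proof -
  have "q ! i < n" if "i < length q" for i
    using that \<open>tour n q\<close> nth_mem[of i q] by (auto simp: tour_def)
  moreover have "Suc i mod length q < length q" if "i < length q" for i
    by (rule mod_less_divisor) (use that in linarith)
  ultimately show ?thesis
    unfolding tour_length_def by (intro sum.cong) (auto intro!: assms(2))
qed

text \<open>The hub needs degree 2, so a single city receives a companion at distance 0; then both
  instances have tours of length 0. From two cities on nothing is changed.\<close>

lemma tour_pad_iff:
  assumes "1 \<le> n" "0 \<le> C" "\<And>i. i < n \<Longrightarrow> d i i = 0"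
  shows "(\<exists>q. tour (max n 2) q \<and> tour_length (pad n d) q \<le> C) \<longleftrightarrow> (\<exists>q. tour n q \<and> tour_length d q \<le> C)"
proof (cases "2 \<le> n")
  case True
  then have "tour_length (pad n d) q = tour_length d q" if "tour n q" for q
    using that by (intro tour_length_cong[of n]) (auto simp: pad_def)
  then show ?thesis using True by (auto simp: max_def)
next
  case False
  then have n: "n = 1" using assms(1) by simp
  have "tour (max n 2) [0, 1] \<and> tour_length (pad n d) [0, 1] \<le> C"
    using assms by (auto simp: tour_def tour_length_def pad_def n lessThan_Suc numeral_2_eq_2)
  moreover have "tour n [0] \<and> tour_length d [0] \<le> C"
    using assms by (auto simp: tour_def tour_length_def n)
  ultimately show ?thesis by blast
qed

definition to_threading ::
    "nat \<times> (nat \<Rightarrow> nat \<Rightarrow> rat) \<times> rat \<Rightarrow> (nat \<times> nat set set \<times> (nat set set \<Rightarrow> rat)) \<times> rat" where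
  "to_threading = (\<lambda>(n, d, C).
    ((Suc (max n 2), complete_edges (Suc (max n 2)), hub_cost (max n 2) (pad n d)), C))"

lemma to_threading_correct:
  assumes i: "i \<in> instances traveling_salesperson"
  shows "to_threading i \<in> instances exactly_double_threading_decision"
    and "answer traveling_salesperson i y \<longleftrightarrow>
      answer exactly_double_threading_decision (to_threading i) y"
proof -
  obtain n d C where i_eq: "i = (n, d, C)" by (cases i)
  have n: "1 \<le> n" "0 \<le> C" and d: "\<And>i. i < n \<Longrightarrow> d i i = 0"
    "\<And>i j. i < n \<Longrightarrow> j < n \<Longrightarrow> 0 \<le> d i j \<and> d i j = d j i"
    using i by (auto simp: i_eq traveling_salesperson_def decision_problem_def)
  have "turn_costs {..<Suc (max n 2)} (complete_edges (Suc (max n 2))) (hub_cost (max n 2) (pad n d))"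
    unfolding turn_costs_def by (intro ballI hub_cost_nonneg) (use d in \<open>auto simp: pad_def\<close>)
  then show "to_threading i \<in> instances exactly_double_threading_decision"
    using n admissible_complete[of "Suc (max n 2)"]
    by (simp add: i_eq to_threading_def exactly_double_threading_decision_def decision_problem_def
        graph_instances_def)
  have "pad n d i j = pad n d j i" for i j using d(2) by (auto simp: pad_def)
  from hub_threading_iff_tour[of "max n 2" "pad n d" C, OF _ this] tour_pad_iff[of n C d, OF n d(1)]
  show "answer traveling_salesperson i y \<longleftrightarrow>
      answer exactly_double_threading_decision (to_threading i) y"
    by (simp add: i_eq to_threading_def exactly_double_threading_decision_def decision_problem_def
        traveling_salesperson_def)
qed

section \<open>The instance of the threading problem as the output of a program\<close>

context oracles
begin

lemma ptime_ext: "ptime X e f \<Longrightarrow> ptime (idx X k) (ext e) (\<lambda>z. f (fst z))"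
  by (rule ptime_weak) auto

lemma bounded_ext_weak: "poly_bounded X e f \<Longrightarrow> poly_bounded (idx X k) (ext e) (\<lambda>z. f (fst z))"
  by (rule bounded_weak) auto

lemma enc_rat_0: "enc_rat 0 = Node (Leaf 0) (Leaf 1)"
  by (simp add: enc_rat_def)

lemma ptime_to_threading:
  "ptime (instances traveling_salesperson) (encode traveling_salesperson)
    (\<lambda>i. encode exactly_double_threading_decision (to_threading i))"
proof -
  define X where "X = instances traveling_salesperson"
  define e where "e = encode traveling_salesperson"
  define N where "N i = fst i" for i :: "nat \<times> (nat \<Rightarrow> nat \<Rightarrow> rat) \<times> rat"
  define d where "d i = fst (snd i)" for i :: "nat \<times> (nat \<Rightarrow> nat \<Rightarrow> rat) \<times> rat"
  define m where "m i = max (N i) 2" for i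
  define k where "k i = m i + 1" for i
  have e: "e i = Node (Leaf (N i)) (Node (enc_list (\<lambda>u. enc_list (\<lambda>w. enc_rat (d i u w)) [0..<N i]) [0..<N i])
      (enc_rat (snd (snd i))))" for i
    by (cases i) (simp add: e_def traveling_salesperson_def decision_problem_def N_def d_def)
  have d_sym: "d i u w = d i w u" if "i \<in> X" "u < N i" "w < N i" for i u w
    using that by (auto simp: X_def traveling_salesperson_def decision_problem_def N_def d_def)
  have N: "ptime X e (\<lambda>i. Leaf (N i))" using ptime_left[OF ptime_id, of X e] by (simp add: e)
  have matrix: "ptime X e (\<lambda>i. enc_list (\<lambda>u. enc_list (\<lambda>w. enc_rat (d i u w)) [0..<N i]) [0..<N i])"
    using ptime_left[OF ptime_right[OF ptime_id, of X e]] by (simp add: e)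
  have C: "ptime X e (\<lambda>i. enc_rat (snd (snd i)))"
    using ptime_right[OF ptime_right[OF ptime_id, of X e]] by (simp add: e)
  have pbN: "poly_bounded X e N" using bounded_length[OF matrix] by simp
  have m: "ptime X e (\<lambda>i. Leaf (m i))" unfolding m_def by (intro ptime_max N ptime_nat)
  have k: "ptime X e (\<lambda>i. Leaf (k i))" unfolding k_def by (intro ptime_add m ptime_nat)
  have pbk: "poly_bounded X e k"
    by (rule bounded_mono[OF bounded_add[OF pbN bounded_const[of _ _ 3]]]) (simp add: k_def m_def)
  have adj: "ptime X e (\<lambda>i. enc_list (\<lambda>u. enc_list (\<lambda>v. Leaf (of_bool (\<not> u = v))) [0..<k i]) [0..<k i])"
    by (intro ptime_tabulate k pbk ptime_ext bounded_ext_weak ptime_not ptime_eq ptime_snd)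
  \<comment> \<open>Exactly the entries of the cost table that copy a distance: turns at the hub
    between two original cities. All others are 0.\<close>
  define b where "b i v u w \<longleftrightarrow> (v = m i \<and> (u < N i \<and> w < N i)) \<and> (\<not> u = v \<and> (\<not> w = v \<and> \<not> u = w))" for i v u w
  have costs: "ptime X e (\<lambda>i. enc_list (\<lambda>v. enc_list (\<lambda>u. enc_list (\<lambda>w.
      if b i v u w then enc_rat (d i u w) else Node (Leaf 0) (Leaf 1)) [0..<k i]) [0..<k i]) [0..<k i])"
  proof (intro ptime_tabulate k pbk ptime_ext bounded_ext_weak)
    let ?I = "idx (idx (idx X k) (\<lambda>z. k (fst z))) (\<lambda>z. k (base2 z))"
    let ?e = "ext (ext (ext e))"
    have u: "ptime ?I ?e (\<lambda>z. Leaf (snd (fst z)))" and v: "ptime ?I ?e (\<lambda>z. Leaf (snd (base2 z)))"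
      and w: "ptime ?I ?e (\<lambda>z. Leaf (snd z))"
      by (rule ptime_ext ptime_ext[OF ptime_ext] ptime_snd ptime_ext[OF ptime_snd] ptime_ext[OF ptime_ext[OF ptime_snd]])+
    note up = ptime_ext[OF ptime_ext[OF ptime_ext]]
    have b: "ptime ?I ?e (\<lambda>z. Leaf (of_bool (b (base3 z) (snd (base2 z)) (snd (fst z)) (snd z))))"
      unfolding b_def by (intro ptime_conj ptime_not ptime_eq ptime_less u v w up[OF m] up[OF N])
    let ?J = "{z \<in> ?I. b (base3 z) (snd (base2 z)) (snd (fst z)) (snd z)}"
    have J: "?J \<subseteq> ?I" by blast
    \<comment> \<open>The loop indices exceed the rows of the distance matrix; the access is in
      range only where \<open>b\<close> holds.\<close>
    have "ptime ?J ?e (\<lambda>z. enc_list (\<lambda>w. enc_rat (d (base3 z) (snd (fst z)) w)) [0..<N (base3 z)])"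
      by (rule ptime_lookup[OF ptime_subset[OF up[OF matrix] J] ptime_subset[OF u J]]) (auto simp: b_def)
    from ptime_lookup[OF this ptime_subset[OF w J]]
    have "ptime ?J ?e (\<lambda>z. enc_rat (d (base3 z) (snd (fst z)) (snd z)))"
      by (auto simp: b_def)
    then show "ptime ?I ?e (\<lambda>z. if b (base3 z) (snd (base2 z)) (snd (fst z)) (snd z)
       then enc_rat (d (base3 z) (snd (fst z)) (snd z)) else Node (Leaf 0) (Leaf 1))"
      by (intro ptime_if b ptime_pair ptime_nat)
  qed
  have "ptime X e (\<lambda>i. Node (Node (Leaf (k i))
      (Node (enc_list (\<lambda>u. enc_list (\<lambda>v. Leaf (of_bool (\<not> u = v))) [0..<k i]) [0..<k i])
        (enc_list (\<lambda>v. enc_list (\<lambda>u. enc_list (\<lambda>w.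
      if b i v u w then enc_rat (d i u w) else Node (Leaf 0) (Leaf 1)) [0..<k i]) [0..<k i]) [0..<k i])))
      (enc_rat (snd (snd i))))"
    by (intro ptime_pair k adj costs C)
  then show ?thesis unfolding X_def[symmetric] e_def[symmetric]
  proof (rule ptime_cong)
    fix i assume i: "i \<in> X"
    have t: "to_threading i = ((k i, complete_edges (k i), hub_cost (m i) (pad (N i) (d i))), snd (snd i))"
      by (cases i) (simp add: to_threading_def k_def m_def N_def d_def)
    have "enc_rat (if {{u, v}, {v, w}} \<in> turns (complete_edges (k i)) v
        then hub_cost (m i) (pad (N i) (d i)) {{u, v}, {v, w}} else 0) =
      (if b i v u w then enc_rat (d i u w) else Node (Leaf 0) (Leaf 1))"
      if "u < k i" "v < k i" "w < k i" for u v w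
    proof -
      have "pad (N i) (d i) u w = pad (N i) (d i) w u" using d_sym[OF i] by (auto simp: pad_def)
      then show ?thesis
        by (auto simp: turn_complete_iff[OF that] hub_cost_turn b_def pad_def enc_rat_0)
    qed
    then show "encode exactly_double_threading_decision (to_threading i) = Node (Node (Leaf (k i))
      (Node (enc_list (\<lambda>u. enc_list (\<lambda>v. Leaf (of_bool (\<not> u = v))) [0..<k i]) [0..<k i])
        (enc_list (\<lambda>v. enc_list (\<lambda>u. enc_list (\<lambda>w.
      if b i v u w then enc_rat (d i u w) else Node (Leaf 0) (Leaf 1)) [0..<k i]) [0..<k i]) [0..<k i])))
      (enc_rat (snd (snd i)))"
      unfolding t by (auto simp: exactly_double_threading_decision_def decision_problem_def enc_graph_def
          in_complete_edges intro!: enc_list_cong)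
  qed
qed

end

theorem traveling_salesperson_many_one_reducible:
  "polytime_many_one_reducible traveling_salesperson exactly_double_threading_decision"
proof -
  \<comment> \<open>With the empty oracle as the only one, a program that terminates makes no
    query.\<close>
  interpret oracles "{Map.empty}" by unfold_locales simp
  from ptime_to_threading obtain p T where p: "\<And>i. i \<in> instances traveling_salesperson \<Longrightarrow>
    \<exists>t. eval Map.empty [encode traveling_salesperson i] p
      (encode exactly_double_threading_decision (to_threading i)) t \<and>
      t \<le> poly T (data_size (encode traveling_salesperson i))"
    unfolding ptime_def by blast
  show ?thesis unfolding polytime_many_one_reducible_def
    using p to_threading_correct by (intro exI[of _ p] exI[of _ T]) blast
qed

section \<open>Reading an optimal tour off its length\<close>

lemma base4_sum_less:
  fixes a :: "nat \<Rightarrow> nat"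
  assumes "\<And>i. a i \<le> 3"
  shows "(\<Sum>i<K. a i * 4 ^ i) < 4 ^ K"
proof (induction K)
  case (Suc K)
  have "a K * 4 ^ K \<le> 3 * 4 ^ K" using assms[of K] by simp
  then show ?case using Suc unfolding sum.lessThan_Suc power_Suc by linarith
qed simp

text \<open>Digits up to 3 produce no carry, and a multiple of \<open>4 ^ K\<close> does not reach
  the digits below position \<open>K\<close>. Hence the multiplicities can be read while the cost
  sits on top.\<close>

lemma base4_digit:
  fixes a :: "nat \<Rightarrow> nat"
  assumes "\<And>i. a i \<le> 3" "j < K"
  shows "(c * 4 ^ K + (\<Sum>i<K. a i * 4 ^ i)) div 4 ^ j mod 4 = a j"
  using assms
proof (induction j arbitrary: K a)
  case 0
  then obtain L where K: "K = Suc L" by (cases K) auto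
  define X where "X = c * 4 ^ L + (\<Sum>i<L. a (Suc i) * 4 ^ i)"
  have "c * 4 ^ K + (\<Sum>i<K. a i * 4 ^ i) = a 0 + 4 * X"
    unfolding K sum.lessThan_Suc_shift X_def by (simp add: sum_distrib_left algebra_simps)
  then show ?case using 0(1)[of 0] by simp
next
  case (Suc j)
  then obtain L where K: "K = Suc L" by (cases K) auto
  define X where "X = c * 4 ^ L + (\<Sum>i<L. a (Suc i) * 4 ^ i)"
  have "c * 4 ^ K + (\<Sum>i<K. a i * 4 ^ i) = a 0 + 4 * X"
    unfolding K sum.lessThan_Suc_shift X_def by (simp add: sum_distrib_left algebra_simps)
  then have "(c * 4 ^ K + (\<Sum>i<K. a i * 4 ^ i)) div 4 = X"
    using Suc(2)[of 0] by simp
  then have "(c * 4 ^ K + (\<Sum>i<K. a i * 4 ^ i)) div 4 ^ Suc j = X div 4 ^ j"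
    unfolding power_Suc div_mult2_eq by (rule arg_cong)
  then show ?case using Suc(1)[of "\<lambda>i. a (Suc i)" L] Suc(2,3) by (simp add: K X_def)
qed

lemma sum_mset_power4:
  assumes "\<And>x. x \<in># M \<Longrightarrow> x < K"
  shows "(\<Sum>x\<in>#M. 4 ^ x) = (\<Sum>i<K. count M i * 4 ^ i :: nat)"
  using assms
proof (induction M)
  case (add x M)
  have "(\<Sum>i<K. count (add_mset x M) i * 4 ^ i) =
      (\<Sum>i<K. (if i = x then 4 ^ x else 0) + count M i * 4 ^ i :: nat)"
    by (intro sum.cong) auto
  also have "\<dots> = 4 ^ x + (\<Sum>i<K. count M i * 4 ^ i)"
    using add.prems[of x] by (simp add: sum.distrib)
  finally show ?case using add by simp
qed simp

lemma count_le_pair_degree: "x \<in> P \<Longrightarrow> count N P \<le> pair_degree N x"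
  by (induction N) auto

definition numer :: "rat \<Rightarrow> nat" where
  "numer q = nat (fst (quotient_of q))"

definition denom :: "rat \<Rightarrow> nat" where
  "denom q = nat (snd (quotient_of q))"

lemma enc_rat_conv: "enc_rat q = Node (Leaf (numer q)) (Leaf (denom q))"
  by (simp add: enc_rat_def numer_def denom_def split: prod.splits)

lemma denom_pos: "0 < denom q"
  using quotient_of_denom_pos'[of q] by (simp add: denom_def)

lemma numer_denom:
  assumes "0 \<le> q"
  shows "of_nat (numer q) = q * of_nat (denom q)"
proof -
  obtain a b where ab: "quotient_of q = (a, b)" by fastforce
  have b: "0 < b" using quotient_of_denom_pos[OF ab] .
  have q: "q = of_int a / of_int b" by (rule quotient_of_div[OF ab])
  have "0 \<le> a" using assms b by (simp add: q zero_le_divide_iff)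
  then show ?thesis unfolding numer_def denom_def ab using b q by simp
qed

lemma enc_rat_of_nat: "enc_rat (of_nat k) = Node (Leaf k) (Leaf 1)"
  using quotient_of_int[of "int k"] by (simp add: enc_rat_def)

definition turn_rat :: "nat set set \<Rightarrow> (nat set set \<Rightarrow> rat) \<Rightarrow> nat \<Rightarrow> nat \<Rightarrow> nat \<Rightarrow> rat" where
  "turn_rat E \<alpha> v u w = (if {{u, v}, {v, w}} \<in> turns E v then \<alpha> {{u, v}, {v, w}} else 0)"

text \<open>A common denominator. The plain product is enough: its length is at most the total
  length of the factors, and a loop computes it.\<close>

definition scale :: "nat \<Rightarrow> nat set set \<Rightarrow> (nat set set \<Rightarrow> rat) \<Rightarrow> nat" where
  "scale n E \<alpha> = (\<Prod>v<n. \<Prod>u<n. \<Prod>w<n. denom (turn_rat E \<alpha> v u w))"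

definition int_cost :: "nat \<Rightarrow> nat set set \<Rightarrow> (nat set set \<Rightarrow> rat) \<Rightarrow> nat \<Rightarrow> nat \<Rightarrow> nat \<Rightarrow> nat" where
  "int_cost n E \<alpha> v u w =
    numer (turn_rat E \<alpha> v u w) * (scale n E \<alpha> div denom (turn_rat E \<alpha> v u w))"

text \<open>Sorting the pair makes its position symmetric; as a two-digit number in base
  \<open>n\<close> it is injective on unordered pairs and below \<open>n * n\<close>.\<close>

definition pair_pos :: "nat \<Rightarrow> nat \<Rightarrow> nat \<Rightarrow> nat" where
  "pair_pos n u w = min u w * n + max u w"

text \<open>
  The lower-order part makes the length of a tour determine the tour: its base 4 digits are the
  multiplicities of the pairs of consecutive cities, which are at most 2.
\<close>

definition weight :: "nat \<Rightarrow> nat set set \<Rightarrow> (nat set set \<Rightarrow> rat) \<Rightarrow> nat \<Rightarrow> nat \<Rightarrow> nat \<Rightarrow> nat" where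
  "weight n E \<alpha> v u w = int_cost n E \<alpha> v u w * 4 ^ (n * n) + 4 ^ pair_pos n u w"

definition cities :: "nat \<Rightarrow> nat set set \<Rightarrow> nat \<Rightarrow> nat list" where
  "cities n E v = filter (\<lambda>u. {u, v} \<in> E) [0..<n]"

text \<open>Cities are positions in the list of neighbours, as the instances are numbered from 0.
  The diagonal has to be set to 0 separately, since \<open>weight\<close> is positive there.\<close>

definition city_dist :: "nat \<Rightarrow> nat set set \<Rightarrow> (nat set set \<Rightarrow> rat) \<Rightarrow> nat \<Rightarrow> nat \<Rightarrow> nat \<Rightarrow> nat" where
  "city_dist n E \<alpha> v i j =
    (if i = j then 0 else weight n E \<alpha> v (cities n E v ! i) (cities n E v ! j))"

definition tour_within :: "nat \<Rightarrow> nat set set \<Rightarrow> (nat set set \<Rightarrow> rat) \<Rightarrow> nat \<Rightarrow> nat \<Rightarrow> bool" where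
  "tour_within n E \<alpha> v m \<longleftrightarrow> (\<exists>q. tour (length (cities n E v)) q \<and>
    tour_length (\<lambda>i j. of_nat (city_dist n E \<alpha> v i j)) q \<le> of_nat m)"

definition opt :: "nat \<Rightarrow> nat set set \<Rightarrow> (nat set set \<Rightarrow> rat) \<Rightarrow> nat \<Rightarrow> nat" where
  "opt n E \<alpha> v = (LEAST m. tour_within n E \<alpha> v m)"

lemma pair_pos_commute: "pair_pos n u w = pair_pos n w u"
  by (simp add: pair_pos_def min.commute max.commute)

lemma turn_rat_commute: "turn_rat E \<alpha> v u w = turn_rat E \<alpha> v w u"
proof -
  have "{{u, v}, {v, w}} = {{w, v}, {v, u}}" by auto
  then show ?thesis by (simp add: turn_rat_def)
qed

lemma weight_commute: "weight n E \<alpha> v u w = weight n E \<alpha> v w u"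
  by (simp add: weight_def int_cost_def turn_rat_commute[of E \<alpha> v u w] pair_pos_commute[of n u w])

lemma pair_pos_less: "u < n \<Longrightarrow> w < n \<Longrightarrow> pair_pos n u w < n * n"
proof -
  assume "u < n" "w < n"
  then have "min u w * n + max u w < Suc (min u w) * n" by simp
  also have "\<dots> \<le> n * n" using \<open>u < n\<close> by (intro mult_right_mono) auto
  finally show ?thesis by (simp add: pair_pos_def)
qed

lemma pair_pos_inject:
  assumes "u < n" "w < n" "u' < n" "w' < n" "pair_pos n u w = pair_pos n u' w'"
  shows "{u, w} = {u', w'}"
proof -
  have "(min u w * n + max u w) div n = min u w" "(min u w * n + max u w) mod n = max u w"
    "(min u' w' * n + max u' w') div n = min u' w'" "(min u' w' * n + max u' w') mod n = max u' w'"
    using assms by auto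
  then have "min u w = min u' w'" "max u w = max u' w'"
    using assms(5) by (metis pair_pos_def)+
  then show ?thesis by (auto simp: min_def max_def split: if_splits)
qed

text \<open>The tracing procedure, with turns counted and looked up as a program does it.\<close>

definition occurrences :: "nat list \<Rightarrow> nat \<Rightarrow> nat \<Rightarrow> nat \<Rightarrow> nat" where
  "occurrences R y x z = (\<Sum>i<length R - 2. of_bool (R ! (i + 1) = y \<and>
    ((R ! i = x \<and> R ! (i + 2) = z) \<or> (R ! i = z \<and> R ! (i + 2) = x))))"

definition free_turns :: "nat \<Rightarrow> nat set set \<Rightarrow> (nat set set \<Rightarrow> rat) \<Rightarrow> nat list \<Rightarrow> nat list" where
  "free_turns n E \<alpha> R = filter (\<lambda>z. occurrences R (R ! 0) (R ! 1) z <
    opt n E \<alpha> (R ! 0) div 4 ^ pair_pos n (R ! 1) z mod 4) [0..<n]"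

definition trace_step :: "nat \<Rightarrow> nat set set \<Rightarrow> (nat set set \<Rightarrow> rat) \<Rightarrow> nat list \<Rightarrow> nat list" where
  "trace_step n E \<alpha> R = (if free_turns n E \<alpha> R = [] then rotate_path R else hd (free_turns n E \<alpha> R) # R)"

definition trace :: "nat \<Rightarrow> nat set set \<Rightarrow> (nat set set \<Rightarrow> rat) \<Rightarrow> nat \<Rightarrow> nat list" where
  "trace n E \<alpha> k = (trace_step n E \<alpha> ^^ k) [hd (cities n E 0), 0]"

lemma count_path_turns: "count (path_turns R) (y, {x, z}) = occurrences R y x z"
proof -
  have "count (path_turns R) (y, {x, z}) =
      card {i \<in> {..<length R - 2}. (R ! Suc i, {R ! i, R ! Suc (Suc i)}) = (y, {x, z})}"
    unfolding count_conv_size_mset path_turns_conv_nth filter_mset_image_mset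
    by (simp add: filter_mset_mset_set comp_def)
  also have "\<dots> = occurrences R y x z"
    by (auto simp: occurrences_def doubleton_eq_iff intro!: arg_cong[where f = card])
  finally show ?thesis .
qed

section \<open>Correctness of the optimisation at each vertex\<close>

locale threading_instance =
  fixes n :: nat and E :: "nat set set" and \<alpha> :: "nat set set \<Rightarrow> rat"
  assumes inst: "(n, E, \<alpha>) \<in> graph_instances"
begin

lemma G: "admissible_graph {..<n} E" and costs: "turn_costs {..<n} E \<alpha>"
  using inst by (auto simp: graph_instances_def)

lemma set_cities: "set (cities n E v) = neighbours E v"
  using edge_set_card_2(2)[OF G] by (auto simp: cities_def neighbours_def)

lemma distinct_cities: "distinct (cities n E v)"
  by (simp add: cities_def)

lemma length_cities: "v < n \<Longrightarrow> 2 \<le> length (cities n E v)"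
  using neighbours_admissible(2)[OF G, of v] distinct_card[OF distinct_cities, of v]
  by (simp add: set_cities)

lemma cities_nth: "i < length (cities n E v) \<Longrightarrow> cities n E v ! i < n"
  using nth_mem[of i "cities n E v"] by (auto simp: cities_def)

lemma turn_rat_nonneg: "0 \<le> turn_rat E \<alpha> v u w"
proof (cases "{{u, v}, {v, w}} \<in> turns E v")
  case True
  then obtain e where "e \<in> E" "v \<in> e" by (auto simp: turns_def incident_edges_def)
  then have "v < n" using G by (auto simp: admissible_graph_def)
  then show ?thesis using True costs by (auto simp: turn_rat_def turn_costs_def)
qed (simp add: turn_rat_def)

lemma turn_rat_eq:
  assumes "u \<in> neighbours E v" "w \<in> neighbours E v" "u \<noteq> w"
  shows "turn_rat E \<alpha> v u w = \<alpha> {{u, v}, {v, w}}"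
proof -
  have "{u, v} \<in> incident_edges E v" "{v, w} \<in> incident_edges E v" "{u, v} \<noteq> {v, w}"
    using assms by (auto simp: neighbours_def incident_edges_def insert_commute doubleton_eq_iff)
  then have "{{u, v}, {v, w}} \<in> turns E v" unfolding turns_def by blast
  then show ?thesis by (simp add: turn_rat_def)
qed

text \<open>Each denominator is a factor of \<open>scale\<close>, so the integer division is
  exact.\<close>

lemma int_cost_eq:
  assumes "v < n" "u < n" "w < n"
  shows "of_nat (int_cost n E \<alpha> v u w) = of_nat (scale n E \<alpha>) * turn_rat E \<alpha> v u w"
proof -
  let ?d = "denom (turn_rat E \<alpha> v u w)"
  have "?d dvd (\<Prod>w<n. denom (turn_rat E \<alpha> v u w))" using assms by (intro dvd_prodI) auto
  also have "\<dots> dvd (\<Prod>u<n. \<Prod>w<n. denom (turn_rat E \<alpha> v u w))"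
    using assms by (intro dvd_prodI[of _ u "\<lambda>u. \<Prod>w<n. denom (turn_rat E \<alpha> v u w)"]) auto
  also have "\<dots> dvd scale n E \<alpha>" unfolding scale_def
    using assms by (intro dvd_prodI[of _ v "\<lambda>v. \<Prod>u<n. \<Prod>w<n. denom (turn_rat E \<alpha> v u w)"]) auto
  finally have "scale n E \<alpha> = scale n E \<alpha> div ?d * ?d" by simp
  then have "(of_nat (scale n E \<alpha>) :: rat) = of_nat (scale n E \<alpha> div ?d) * of_nat ?d"
    by (metis of_nat_mult)
  then show ?thesis
    using numer_denom[OF turn_rat_nonneg, of v u w] by (simp add: int_cost_def)
qed

lemma scale_pos: "0 < scale n E \<alpha>"
  unfolding scale_def by (intro prod_pos ballI denom_pos)

definition pair_cost :: "nat \<Rightarrow> nat set \<Rightarrow> nat" where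
  "pair_cost v P = int_cost n E \<alpha> v (Min P) (Max P)"

definition pos :: "nat set \<Rightarrow> nat" where
  "pos P = pair_pos n (Min P) (Max P)"

definition cycle_at :: "nat \<Rightarrow> nat list \<Rightarrow> bool" where
  "cycle_at v p \<longleftrightarrow> distinct p \<and> set p = neighbours E v"

definition cycle_cost :: "nat \<Rightarrow> nat list \<Rightarrow> nat" where
  "cycle_cost v p = (\<Sum>P\<in>#cycle_pairs p. pair_cost v P)"

definition cycle_code :: "nat list \<Rightarrow> nat" where
  "cycle_code p = (\<Sum>P\<in>#cycle_pairs p. 4 ^ pos P)"

lemma pos_pair: "pos {u, w} = pair_pos n u w"
  by (auto simp: pos_def pair_pos_def min_def max_def)

lemma cycle_at_length: "v < n \<Longrightarrow> cycle_at v p \<Longrightarrow> 2 \<le> length p"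
  using length_cities[of v] distinct_card[OF distinct_cities, of v] distinct_card[of p]
  by (simp add: cycle_at_def set_cities)

lemma cycle_at_pair:
  assumes "v < n" "cycle_at v p" "P \<in># cycle_pairs p"
  obtains u w where "P = {u, w}" "u \<noteq> w" "u \<in> neighbours E v" "w \<in> neighbours E v" "u < n" "w < n"
proof -
  have "card P = 2"
    using assms cycle_at_length[OF assms(1,2)] by (intro cycle_pairs_card) (auto simp: cycle_at_def)
  moreover have "P \<subseteq> neighbours E v" using cycle_pairs_subset[OF assms(3)] assms(2) by (simp add: cycle_at_def)
  moreover have "neighbours E v \<subseteq> {..<n}" using neighbours_admissible(3)[OF G, of v] assms(1) by simp
  moreover from calculation obtain u w where "P = {u, w}" "u \<noteq> w" by (auto simp: card_2_iff)
  ultimately show ?thesis by (intro that[of u w]) auto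
qed

text \<open>The two summands of \<open>weight\<close> add up separately along the cycle: the scaled
  cost on top, the code of the cycle below \<open>4 ^ (n * n)\<close>.\<close>

lemma tour_of_cities:
  assumes v: "v < n" and q: "tour (length (cities n E v)) q"
  shows "cycle_at v (map ((!) (cities n E v)) q)"
    "tour_length (\<lambda>i j. of_nat (city_dist n E \<alpha> v i j)) q =
      of_nat (cycle_cost v (map ((!) (cities n E v)) q) * 4 ^ (n * n) +
        cycle_code (map ((!) (cities n E v)) q))"
proof -
  let ?c = "cities n E v"
  have q': "distinct q" "set q = {..<length ?c}" using q by (auto simp: tour_def)
  have "(!) ?c ` {..<length ?c} = set ?c" by (auto simp: set_conv_nth)
  then have "set (map ((!) ?c) q) = set ?c" by (simp add: q'(2))
  moreover have "distinct (map ((!) ?c) q)"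
    using q' distinct_cities by (auto simp: distinct_map inj_on_def nth_eq_iff_index_eq)
  ultimately show "cycle_at v (map ((!) ?c) q)" by (simp add: cycle_at_def set_cities)
  have "2 \<le> length q" using distinct_card[OF q'(1)] q'(2) length_cities[OF v] by simp
  then have "tour_length (\<lambda>i j. of_nat (city_dist n E \<alpha> v i j)) q =
      (\<Sum>P\<in>#cycle_pairs (map ((!) ?c) q). of_nat (weight n E \<alpha> v (Min P) (Max P)))"
  proof (rule tour_length_conv_cycle_pairs[OF q'(1)])
    fix i j :: nat assume "i \<noteq> j"
    then show "of_nat (city_dist n E \<alpha> v i j) =
        of_nat (weight n E \<alpha> v (Min {?c ! i, ?c ! j}) (Max {?c ! i, ?c ! j}))"
      using weight_commute[of n E \<alpha> v "?c ! i" "?c ! j"]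
      by (simp add: city_dist_def min_def max_def)
  qed
  also have "\<dots> = of_nat (\<Sum>P\<in>#cycle_pairs (map ((!) ?c) q). weight n E \<alpha> v (Min P) (Max P))"
    by (simp add: multiset.map_comp comp_def)
  also have "(\<Sum>P\<in>#cycle_pairs (map ((!) ?c) q). weight n E \<alpha> v (Min P) (Max P)) =
      cycle_cost v (map ((!) ?c) q) * 4 ^ (n * n) + cycle_code (map ((!) ?c) q)"
    by (simp add: weight_def cycle_cost_def cycle_code_def pair_cost_def pos_def
        sum_mset.distrib sum_mset_distrib_right)
  finally show "tour_length (\<lambda>i j. of_nat (city_dist n E \<alpha> v i j)) q =
      of_nat (cycle_cost v (map ((!) ?c) q) * 4 ^ (n * n) + cycle_code (map ((!) ?c) q))" .
qed

lemma cities_of_cycle: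
  assumes "cycle_at v p"
  shows "\<exists>q. tour (length (cities n E v)) q \<and> p = map ((!) (cities n E v)) q"
proof -
  let ?c = "cities n E v"
  have "\<forall>x\<in>set p. \<exists>i<length ?c. ?c ! i = x"
    using assms by (auto simp: cycle_at_def in_set_conv_nth simp flip: set_cities)
  then obtain f where f: "\<And>x. x \<in> set p \<Longrightarrow> f x < length ?c \<and> ?c ! f x = x" by metis
  have p: "map ((!) ?c) (map f p) = p" using f by (auto intro: map_idI)
  have "distinct (map f p)"
    using p assms distinct_map[of "(!) ?c" "map f p"] by (simp add: cycle_at_def)
  moreover have "set (map f p) = {..<length ?c}"
  proof (rule card_subset_eq)
    show "card (set (map f p)) = card {..<length ?c}"
      using distinct_card[OF calculation] distinct_card[of p] distinct_card[OF distinct_cities, of v] assms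
      by (simp add: cycle_at_def set_cities)
  qed (use f in auto)
  ultimately show ?thesis using p by (auto simp: tour_def intro!: exI[of _ "map f p"])
qed

lemma tour_within_iff:
  assumes "v < n"
  shows "tour_within n E \<alpha> v m \<longleftrightarrow> (\<exists>p. cycle_at v p \<and> cycle_cost v p * 4 ^ (n * n) + cycle_code p \<le> m)"
proof
  assume "tour_within n E \<alpha> v m"
  then obtain q where q: "tour (length (cities n E v)) q"
    "tour_length (\<lambda>i j. of_nat (city_dist n E \<alpha> v i j)) q \<le> (of_nat m :: rat)"
    by (auto simp: tour_within_def)
  then show "\<exists>p. cycle_at v p \<and> cycle_cost v p * 4 ^ (n * n) + cycle_code p \<le> m"
    using tour_of_cities[OF assms q(1)] unfolding tour_of_cities(2)[OF assms q(1)] of_nat_le_iff by blast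
next
  assume "\<exists>p. cycle_at v p \<and> cycle_cost v p * 4 ^ (n * n) + cycle_code p \<le> m"
  then obtain p where p: "cycle_at v p" "cycle_cost v p * 4 ^ (n * n) + cycle_code p \<le> m" by blast
  obtain q where q: "tour (length (cities n E v)) q" "p = map ((!) (cities n E v)) q"
    using cities_of_cycle[OF p(1)] by blast
  then show "tour_within n E \<alpha> v m"
    unfolding tour_within_def using tour_of_cities(2)[OF assms q(1)] p(2)
    by (intro exI[of _ q]) (simp only: q(2) of_nat_le_iff simp_thms)
qed

lemma tour_within_mono: "tour_within n E \<alpha> v m \<Longrightarrow> m \<le> m' \<Longrightarrow> tour_within n E \<alpha> v m'"
  unfolding tour_within_def by (meson of_nat_mono order_trans)

text \<open>The tour in numerical order supplies an explicit bound at which the binary search can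
  start.\<close>

lemma tour_within_identity:
  "tour_within n E \<alpha> v (\<Sum>i<length (cities n E v). city_dist n E \<alpha> v i (Suc i mod length (cities n E v)))"
proof -
  let ?d = "length (cities n E v)"
  have "tour ?d [0..<?d]" by (auto simp: tour_def)
  moreover have "tour_length (\<lambda>i j. of_nat (city_dist n E \<alpha> v i j)) [0..<?d] =
      (of_nat (\<Sum>i<?d. city_dist n E \<alpha> v i (Suc i mod ?d)) :: rat)"
    unfolding tour_length_def of_nat_sum
  proof (intro sum.cong)
    fix i assume "i \<in> {..<?d}"
    then have "i < ?d" "Suc i mod ?d < ?d" by (auto intro!: mod_less_divisor)
    then show "of_nat (city_dist n E \<alpha> v ([0..<?d] ! i) ([0..<?d] ! (Suc i mod length [0..<?d]))) =
        (of_nat (city_dist n E \<alpha> v i (Suc i mod ?d)) :: rat)" by simp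
  qed simp
  ultimately show ?thesis unfolding tour_within_def by (metis order_refl)
qed

lemma opt_cycle:
  assumes "v < n"
  shows "\<exists>p. cycle_at v p \<and> opt n E \<alpha> v = cycle_cost v p * 4 ^ (n * n) + cycle_code p"
proof -
  have "tour_within n E \<alpha> v (opt n E \<alpha> v)"
    unfolding opt_def using tour_within_identity by (rule LeastI)
  then obtain p where p: "cycle_at v p" "cycle_cost v p * 4 ^ (n * n) + cycle_code p \<le> opt n E \<alpha> v"
    using assms by (auto simp: tour_within_iff)
  moreover have "opt n E \<alpha> v \<le> cycle_cost v p * 4 ^ (n * n) + cycle_code p"
    unfolding opt_def using p(1) assms by (intro Least_le) (auto simp: tour_within_iff)
  ultimately show ?thesis by (metis order_antisym)
qed

lemma opt_le:
  assumes "v < n" "cycle_at v p"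
  shows "opt n E \<alpha> v \<le> cycle_cost v p * 4 ^ (n * n) + cycle_code p"
  unfolding opt_def using assms by (intro Least_le) (auto simp: tour_within_iff)

text \<open>By injectivity of \<open>pair_pos\<close> the multiplicity of a position is that of a
  single pair, which the 2-regularity of the cycle bounds.\<close>

lemma cycle_code_digits:
  assumes v: "v < n" and p: "cycle_at v p"
  defines "M \<equiv> image_mset pos (cycle_pairs p)"
  shows "cycle_code p = (\<Sum>i<n * n. count M i * 4 ^ i)"
    "count M i \<le> 3"
    "u < n \<Longrightarrow> w < n \<Longrightarrow> count M (pair_pos n u w) = count (cycle_pairs p) {u, w}"
proof -
  have "x < n * n" if x: "x \<in># M" for x
  proof -
    obtain P where P: "P \<in># cycle_pairs p" "x = pos P" using x by (auto simp: M_def)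
    obtain u w where "P = {u, w}" "u < n" "w < n" using cycle_at_pair[OF v p P(1)] by metis
    then show ?thesis using pair_pos_less P(2) by (simp add: pos_pair)
  qed
  then show "cycle_code p = (\<Sum>i<n * n. count M i * 4 ^ i)"
    using sum_mset_power4[of M "n * n"] by (simp add: cycle_code_def M_def multiset.map_comp comp_def)
  have inj: "count M (pair_pos n u w) = count (cycle_pairs p) {u, w}" if "u < n" "w < n" for u w
  proof -
    have unique: "P = {u, w}" if P: "P \<in># cycle_pairs p" "pos P = pair_pos n u w" for P
    proof -
      obtain u' w' where "P = {u', w'}" "u' < n" "w' < n" using cycle_at_pair[OF v p P(1)] by metis
      then show ?thesis using pair_pos_inject[of u' n w' u w] P(2) \<open>u < n\<close> \<open>w < n\<close> by (simp add: pos_pair)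
    qed
    have "count M (pair_pos n u w) = size (filter_mset (\<lambda>P. pos P = pair_pos n u w) (cycle_pairs p))"
      unfolding M_def count_conv_size_mset filter_mset_image_mset by (simp add: comp_def)
    also have "filter_mset (\<lambda>P. pos P = pair_pos n u w) (cycle_pairs p) =
        filter_mset (\<lambda>P. P = {u, w}) (cycle_pairs p)"
    proof (rule filter_mset_cong[OF refl])
      fix P assume "P \<in># cycle_pairs p"
      then show "pos P = pair_pos n u w \<longleftrightarrow> P = {u, w}" using unique[of P] pos_pair by blast
    qed
    also have "size \<dots> = count (cycle_pairs p) {u, w}"
      by (simp add: count_conv_size_mset)
    finally show ?thesis .
  qed
  then show "u < n \<Longrightarrow> w < n \<Longrightarrow> count M (pair_pos n u w) = count (cycle_pairs p) {u, w}" .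
  show "count M i \<le> 3"
  proof (cases "i \<in># M")
    case True
    then obtain P where P: "P \<in># cycle_pairs p" "i = pos P" by (auto simp: M_def)
    obtain u w where uw: "P = {u, w}" "u < n" "w < n" using cycle_at_pair[OF v p P(1)] by metis
    have "count M i = count (cycle_pairs p) P" using inj[OF uw(2,3)] by (simp add: P uw pos_pair)
    also have "\<dots> \<le> pair_degree (cycle_pairs p) u" by (rule count_le_pair_degree) (simp add: uw)
    also have "\<dots> \<le> 2" using pair_degree_cycle[of p u] p cycle_at_length[OF v p] by (simp add: cycle_at_def)
    finally show ?thesis by simp
  qed (simp add: not_in_iff)
qed

lemma cycle_code_less:
  assumes "v < n" "cycle_at v p"
  shows "cycle_code p < 4 ^ (n * n)"
  unfolding cycle_code_digits(1)[OF assms] by (rule base4_sum_less) (rule cycle_code_digits(2)[OF assms])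

text \<open>Any choice will do: \<open>opt\<close> determines the multiset of pairs by its digits,
  and only this multiset enters the walk and its cost. The program never needs the list.\<close>

definition best :: "nat \<Rightarrow> nat list" where
  "best v = (SOME p. cycle_at v p \<and> opt n E \<alpha> v = cycle_cost v p * 4 ^ (n * n) + cycle_code p)"

lemma best:
  assumes "v < n"
  shows "cycle_at v (best v)"
    "opt n E \<alpha> v = cycle_cost v (best v) * 4 ^ (n * n) + cycle_code (best v)"
  using someI_ex[OF opt_cycle[OF assms]] by (auto simp: best_def)

lemma opt_div: "v < n \<Longrightarrow> opt n E \<alpha> v div 4 ^ (n * n) = cycle_cost v (best v)"
  using best(2) cycle_code_less[OF _ best(1)] by simp

text \<open>Codes are below \<open>4 ^ (n * n)\<close>, so division by this number removes them. It
  is monotone, and so minimising the perturbed length also minimises the cost.\<close>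

lemma best_optimal:
  assumes "v < n" "cycle_at v p"
  shows "cycle_cost v (best v) \<le> cycle_cost v p"
proof -
  have "opt n E \<alpha> v div 4 ^ (n * n) \<le> (cycle_cost v p * 4 ^ (n * n) + cycle_code p) div 4 ^ (n * n)"
    by (intro div_le_mono opt_le assms)
  then show ?thesis using cycle_code_less[OF assms] opt_div[OF assms(1)] by simp
qed

lemma opt_digit:
  assumes "v < n" "u < n" "w < n"
  shows "opt n E \<alpha> v div 4 ^ pair_pos n u w mod 4 = count (cycle_pairs (best v)) {u, w}"
  unfolding best(2)[OF assms(1)] cycle_code_digits(1)[OF assms(1) best(1)[OF assms(1)]]
  using base4_digit[of "count (image_mset pos (cycle_pairs (best v)))" "pair_pos n u w" "n * n",
      OF cycle_code_digits(2)[OF assms(1) best(1)[OF assms(1)]] pair_pos_less[OF assms(2,3)]]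
    cycle_code_digits(3)[OF assms(1) best(1)[OF assms(1)] assms(2,3)] by simp

lemma cycle_cost_eq:
  assumes "v < n" "cycle_at v p"
  shows "of_nat (cycle_cost v p) =
    of_nat (scale n E \<alpha>) * (\<Sum>P\<in>#cycle_pairs p. \<alpha> (edge_turn (v, P)))"
proof -
  have "of_nat (pair_cost v P) = of_nat (scale n E \<alpha>) * \<alpha> (edge_turn (v, P))" if P: "P \<in># cycle_pairs p" for P
  proof -
    obtain u w where uw: "P = {u, w}" "u \<noteq> w" "u \<in> neighbours E v" "w \<in> neighbours E v" "u < n" "w < n"
      using cycle_at_pair[OF assms P] .
    have "turn_rat E \<alpha> v (min u w) (max u w) = turn_rat E \<alpha> v u w"
      by (simp add: min_def max_def turn_rat_commute)
    then show ?thesis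
      using int_cost_eq[of v "min u w" "max u w"] assms(1) uw
      by (simp add: pair_cost_def edge_turn_pair turn_rat_eq)
  qed
  then have "(\<Sum>P\<in>#cycle_pairs p. of_nat (pair_cost v P)) =
      (\<Sum>P\<in>#cycle_pairs p. of_nat (scale n E \<alpha>) * \<alpha> (edge_turn (v, P)))"
    by (intro arg_cong[where f = sum_mset] image_mset_cong) auto
  then show ?thesis by (simp add: cycle_cost_def multiset.map_comp comp_def sum_mset_distrib_left)
qed

sublocale turn_system n E best
  using G best(1) by unfold_locales (auto simp: cycle_at_def)

definition min_cost :: nat where
  "min_cost = (\<Sum>v<n. opt n E \<alpha> v div 4 ^ (n * n))"

lemma min_cost_eq:
  "of_nat min_cost =
    of_nat (scale n E \<alpha>) * (\<Sum>v<n. \<Sum>P\<in>#cycle_pairs (best v). \<alpha> (edge_turn (v, P)))"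
  unfolding min_cost_def of_nat_sum sum_distrib_left
  by (intro sum.cong refl) (simp add: opt_div cycle_cost_eq best(1))

text \<open>Any threading has a cyclic order at each vertex, and each of them costs at least as much
  as \<open>best\<close>.\<close>

lemma min_cost_le:
  assumes "exactly_double_threading {..<n} E w"
  shows "of_nat min_cost \<le> of_nat (scale n E \<alpha>) * walk_cost \<alpha> w"
proof -
  obtain p where "\<forall>v<n. distinct (p v) \<and> set (p v) = neighbours E v" and
    w: "walk_cost \<alpha> w = (\<Sum>v<n. \<Sum>P\<in>#cycle_pairs (p v). \<alpha> (edge_turn (v, P)))"
    using exactly_double_threading_cost[OF G assms, of \<alpha>] by blast
  then have p: "cycle_at v (p v)" if "v < n" for v using that by (simp add: cycle_at_def)
  have "min_cost \<le> (\<Sum>v<n. cycle_cost v (p v))"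
    unfolding min_cost_def by (intro sum_mono) (simp add: opt_div best_optimal p)
  then have "of_nat min_cost \<le> (of_nat (\<Sum>v<n. cycle_cost v (p v)) :: rat)" by (rule of_nat_mono)
  also have "\<dots> = of_nat (scale n E \<alpha>) * walk_cost \<alpha> w"
    unfolding of_nat_sum w sum_distrib_left by (intro sum.cong refl) (simp add: cycle_cost_eq p)
  finally show ?thesis .
qed

lemma trace_optimal:
  assumes "valid R" "(n * n + 2) * (n * n + 2) \<le> k"
  defines "S \<equiv> (step ^^ k) R"
  defines "w \<equiv> take (length S - 2) S"
  shows "exactly_double_threading {..<n} E w"
    and "exactly_double_threading {..<n} E w' \<Longrightarrow> walk_cost \<alpha> w \<le> walk_cost \<alpha> w'"
proof -
  show "exactly_double_threading {..<n} E w"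
    unfolding w_def S_def by (rule trace_exactly_double(1)[OF assms(1,2)])
  assume "exactly_double_threading {..<n} E w'"
  from min_cost_le[OF this] have "of_nat (scale n E \<alpha>) * walk_cost \<alpha> w \<le> of_nat (scale n E \<alpha>) * walk_cost \<alpha> w'"
    unfolding w_def S_def min_cost_eq trace_exactly_double(2)[OF assms(1,2)] .
  then show "walk_cost \<alpha> w \<le> walk_cost \<alpha> w'" using scale_pos by simp
qed

text \<open>Every vertex beyond the first two is an end of a turn in \<open>H\<close>. The bound
  keeps the table lookups of the program in range.\<close>

lemma valid_set:
  assumes "valid R"
  shows "set R \<subseteq> {..<n}"
proof
  fix x assume "x \<in> set R"
  then obtain i where i: "i < length R" "x = R ! i" by (auto simp: in_set_conv_nth)
  have edge: "{R ! 0, R ! 1} \<in> E" using assms by (simp add: valid_def)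
  consider "i = 0" | "i = 1" | j where "i = Suc (Suc j)" by (metis One_nat_def not0_implies_Suc)
  then show "x \<in> {..<n}"
  proof cases
    case 3
    then have "(R ! Suc j, {R ! j, R ! i}) \<in># path_turns R"
      using i(1) by (auto simp: path_turns_conv_nth)
    then have "(R ! Suc j, {R ! j, R ! i}) \<in># H" using assms by (auto simp: valid_def dest: mset_subset_eqD)
    from H_edges(2)[OF this] show ?thesis using edge_set_card_2[OF G] i(2) by blast
  qed (use edge edge_set_card_2[OF G edge] i in auto)
qed

lemma free_turns_eq:
  assumes "valid R"
  shows "free_turns n E \<alpha> R = extensions R"
  unfolding free_turns_def extensions_def
proof (rule filter_cong[OF refl])
  fix z assume z: "z \<in> set [0..<n]"
  have "2 \<le> length R" using assms by (simp add: valid_def)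
  then have "R ! 0 \<in> set R" "R ! 1 \<in> set R" by (auto intro!: nth_mem)
  then have "R ! 0 < n" "R ! 1 < n" using valid_set[OF assms] by auto
  then show "(occurrences R (R ! 0) (R ! 1) z < opt n E \<alpha> (R ! 0) div 4 ^ pair_pos n (R ! 1) z mod 4) =
      (count (path_turns R) (R ! 0, {R ! 1, z}) < count H (R ! 0, {R ! 1, z}))"
    using z by (simp add: count_path_turns count_H opt_digit)
qed

lemma n_pos: "0 < n"
  using G by (auto simp: admissible_graph_def)

lemma valid_start: "valid [hd (cities n E 0), 0]"
proof -
  have "hd (cities n E 0) \<in> set (cities n E 0)"
    using length_cities[OF n_pos] by (intro hd_in_set) auto
  then show ?thesis by (simp add: set_cities neighbours_def valid_def)
qed

lemma trace_eq: "trace n E \<alpha> k = (step ^^ k) [hd (cities n E 0), 0]"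
  unfolding trace_def
proof (induction k)
  case (Suc k)
  let ?R = "(step ^^ k) [hd (cities n E 0), 0]"
  have "trace_step n E \<alpha> ?R = step ?R"
    unfolding trace_step_def step_def[of ?R] free_turns_eq[OF valid_funpow[OF valid_start]] ..
  then show ?case using Suc by simp
qed simp

lemma valid_trace: "valid (trace n E \<alpha> k)"
  unfolding trace_eq by (rule valid_funpow[OF valid_start])

text \<open>The upper bound limits the loop state of the tracing program; the last claim puts
  \<open>R ! 2\<close> in range whenever a rotation is due.\<close>

lemma length_trace: "2 \<le> length (trace n E \<alpha> k)" "length (trace n E \<alpha> k) \<le> n * n + 2"
  "free_turns n E \<alpha> (trace n E \<alpha> k) = [] \<Longrightarrow> 3 \<le> length (trace n E \<alpha> k)"
  using valid_length[OF valid_trace[of k]] size_H stuck_closed[OF valid_trace[of k]]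
    free_turns_eq[OF valid_trace[of k]] valid_trace[of k] by (auto simp: valid_def)

lemmas trace_threading = trace_optimal[OF valid_start, folded trace_eq]

text \<open>Both \<open>scale\<close> and the denominator of \<open>c\<close> are positive, so they
  can be cleared and the comparison takes place in the naturals, where a program can make
  it.\<close>

lemma threading_within_iff:
  assumes "0 \<le> c"
  shows "(\<exists>w. exactly_double_threading {..<n} E w \<and> walk_cost \<alpha> w \<le> c) \<longleftrightarrow>
    min_cost * denom c \<le> scale n E \<alpha> * numer c"
proof -
  have s: "0 < (of_nat (scale n E \<alpha>) :: rat)" "0 < (of_nat (denom c) :: rat)"
    using scale_pos denom_pos by auto
  have "min_cost * denom c \<le> scale n E \<alpha> * numer c \<longleftrightarrow>
      of_nat min_cost * of_nat (denom c) \<le> (of_nat (scale n E \<alpha>) * of_nat (numer c) :: rat)"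
    by (simp only: of_nat_mult[symmetric] of_nat_le_iff)
  also have "\<dots> \<longleftrightarrow> of_nat min_cost \<le> of_nat (scale n E \<alpha>) * c"
    using s by (simp add: numer_denom[OF assms] mult.assoc[symmetric])
  also have "\<dots> \<longleftrightarrow> (\<exists>w. exactly_double_threading {..<n} E w \<and> walk_cost \<alpha> w \<le> c)"
  proof
    assume "of_nat min_cost \<le> of_nat (scale n E \<alpha>) * c"
    moreover obtain w where "exactly_double_threading {..<n} E w"
      "walk_cost \<alpha> w = (\<Sum>v<n. \<Sum>P\<in>#cycle_pairs (best v). \<alpha> (edge_turn (v, P)))"
      using exists_exactly_double_threading[of \<alpha>] by blast
    ultimately show "\<exists>w. exactly_double_threading {..<n} E w \<and> walk_cost \<alpha> w \<le> c"
      using s(1) by (auto simp: min_cost_eq)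
  next
    assume "\<exists>w. exactly_double_threading {..<n} E w \<and> walk_cost \<alpha> w \<le> c"
    then obtain w where w: "exactly_double_threading {..<n} E w" "walk_cost \<alpha> w \<le> c" by blast
    have "of_nat (scale n E \<alpha>) * walk_cost \<alpha> w \<le> of_nat (scale n E \<alpha>) * c"
      using w(2) s(1) by (intro mult_left_mono) auto
    then show "of_nat min_cost \<le> of_nat (scale n E \<alpha>) * c" using min_cost_le[OF w(1)] by linarith
  qed
  finally show ?thesis ..
qed

end

section \<open>Threading with an algorithm for tours\<close>

context oracles
begin

text \<open>A subroutine proved in a context of the form \<open>ext e\<close> is called from another
  context that can compute its input and its index. The further call lemmas treat other numbers of
  indices.\<close>

lemma ptime_call1:
  assumes "ptime (idx X k) (ext e) (\<lambda>z. f (fst z) (snd z))"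
    and "ptime Y e' (\<lambda>y. e (h y))" "ptime Y e' (\<lambda>y. Leaf (i y))"
    and "\<And>y. y \<in> Y \<Longrightarrow> h y \<in> X" "\<And>y. y \<in> Y \<Longrightarrow> i y < k (h y)"
  shows "ptime Y e' (\<lambda>y. f (h y) (i y))"
proof (rule ptime_trans[OF ptime_pair[OF assms(2,3)]])
  show "ptime Y (\<lambda>y. Node (e (h y)) (Leaf (i y))) (\<lambda>y. f (h y) (i y))"
    using ptime_reindex[OF assms(1), of Y "\<lambda>y. (h y, i y)"] assms(4,5) by simp
qed

lemma ptime_call2:
  assumes "ptime (idx (idx X k) l) (ext (ext e)) (\<lambda>z. f (base2 z) (snd (fst z)) (snd z))"
    and "ptime Y e' (\<lambda>y. e (h y))" "ptime Y e' (\<lambda>y. Leaf (i y))" "ptime Y e' (\<lambda>y. Leaf (j y))"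
    and "\<And>y. y \<in> Y \<Longrightarrow> h y \<in> X" "\<And>y. y \<in> Y \<Longrightarrow> i y < k (h y)" "\<And>y. y \<in> Y \<Longrightarrow> j y < l (h y, i y)"
  shows "ptime Y e' (\<lambda>y. f (h y) (i y) (j y))"
proof (rule ptime_trans[OF ptime_pair[OF ptime_pair[OF assms(2,3)] assms(4)]])
  show "ptime Y (\<lambda>y. Node (Node (e (h y)) (Leaf (i y))) (Leaf (j y))) (\<lambda>y. f (h y) (i y) (j y))"
    using ptime_reindex[OF assms(1), of Y "\<lambda>y. ((h y, i y), j y)"] assms(5-7) by simp
qed

lemma ptime_call3:
  assumes "ptime (idx (idx (idx X k) l) m) (ext (ext (ext e)))
      (\<lambda>z. f (base3 z) (snd (base2 z)) (snd (fst z)) (snd z))"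
    and "ptime Y e' (\<lambda>y. e (h y))" "ptime Y e' (\<lambda>y. Leaf (i y))" "ptime Y e' (\<lambda>y. Leaf (j y))"
      "ptime Y e' (\<lambda>y. Leaf (u y))"
    and "\<And>y. y \<in> Y \<Longrightarrow> h y \<in> X" "\<And>y. y \<in> Y \<Longrightarrow> i y < k (h y)" "\<And>y. y \<in> Y \<Longrightarrow> j y < l (h y, i y)"
      "\<And>y. y \<in> Y \<Longrightarrow> u y < m ((h y, i y), j y)"
  shows "ptime Y e' (\<lambda>y. f (h y) (i y) (j y) (u y))"
proof (rule ptime_trans[OF ptime_pair[OF ptime_pair[OF ptime_pair[OF assms(2,3)] assms(4)] assms(5)]])
  show "ptime Y (\<lambda>y. Node (Node (Node (e (h y)) (Leaf (i y))) (Leaf (j y))) (Leaf (u y)))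
      (\<lambda>y. f (h y) (i y) (j y) (u y))"
    using ptime_reindex[OF assms(1), of Y "\<lambda>y. (((h y, i y), j y), u y)"] assms(6-9) by simp
qed

lemma bounded_call:
  assumes "poly_bounded X e k" "ptime Y e' (\<lambda>y. e (h y))" "\<And>y. y \<in> Y \<Longrightarrow> h y \<in> X"
  shows "poly_bounded Y e' (\<lambda>y. k (h y))"
  by (rule bounded_trans[OF ptime_size[OF assms(2)] bounded_reindex[OF assms(1,3)]])

lemma ptime_call0:
  assumes "ptime X e f" "ptime Y e' (\<lambda>y. e (h y))" "\<And>y. y \<in> Y \<Longrightarrow> h y \<in> X"
  shows "ptime Y e' (\<lambda>y. f (h y))"
  by (rule ptime_trans[OF assms(2) ptime_reindex[OF assms(1,3)]])

end

text \<open>The graph only has to be computable from the input \<open>e a\<close>, so that the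
  optimisation problem and the decision problem, whose encoding also contains the bound, share all
  programs.\<close>

locale threading_program = oracles Os for Os +
  fixes X :: "'a set" and e :: "'a \<Rightarrow> data"
    and n :: "'a \<Rightarrow> nat" and E :: "'a \<Rightarrow> nat set set" and \<alpha> :: "'a \<Rightarrow> nat set set \<Rightarrow> rat"
  assumes input: "ptime X e (\<lambda>a. enc_graph (n a, E a, \<alpha> a))"
    and inst: "a \<in> X \<Longrightarrow> (n a, E a, \<alpha> a) \<in> graph_instances"
    and orc: "orc \<in> Os \<Longrightarrow> solves orc traveling_salesperson"
begin

lemma instance_at: "a \<in> X \<Longrightarrow> threading_instance (n a) (E a) (\<alpha> a)"
  using inst by unfold_locales

abbreviation "I1 \<equiv> idx X n"
abbreviation "I2 \<equiv> idx I1 (\<lambda>z. n (fst z))"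
abbreviation "I3 \<equiv> idx I2 (\<lambda>z. n (base2 z))"

section \<open>Computing the instances at the vertices\<close>

lemma ptime_n: "ptime X e (\<lambda>a. Leaf (n a))"
  using ptime_left[OF input] by (simp add: enc_graph_def)

lemma ptime_matrix: "ptime X e (\<lambda>a. enc_list (\<lambda>u. enc_list (\<lambda>v. Leaf (of_bool ({u, v} \<in> E a))) [0..<n a]) [0..<n a])"
  using ptime_left[OF ptime_right[OF input]] by (simp add: enc_graph_def)

lemma ptime_costs: "ptime X e (\<lambda>a. enc_list (\<lambda>v. enc_list (\<lambda>u. enc_list (\<lambda>w.
    enc_rat (turn_rat (E a) (\<alpha> a) v u w)) [0..<n a]) [0..<n a]) [0..<n a])"
  using ptime_right[OF ptime_right[OF input]] by (simp add: enc_graph_def turn_rat_def)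

lemma bounded_n: "poly_bounded X e n"
  using bounded_length[OF ptime_matrix] by simp

lemma ptime_adjacent: "ptime I2 (ext (ext e)) (\<lambda>z. Leaf (of_bool ({snd (fst z), snd z} \<in> E (base2 z))))"
proof -
  have "ptime I2 (ext (ext e)) (\<lambda>z. enc_list (\<lambda>v. Leaf (of_bool ({snd (fst z), v} \<in> E (base2 z)))) [0..<n (base2 z)])"
    by (rule ptime_lookup[OF ptime_ext[OF ptime_ext[OF ptime_matrix]] ptime_ext[OF ptime_snd]]) auto
  from ptime_lookup[OF this ptime_snd] show ?thesis by auto
qed

lemma ptime_turn_rat: "ptime I3 (ext (ext (ext e)))
  (\<lambda>z. enc_rat (turn_rat (E (base3 z)) (\<alpha> (base3 z)) (snd (base2 z)) (snd (fst z)) (snd z)))"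
proof -
  have "ptime I3 (ext (ext (ext e))) (\<lambda>z. enc_list (\<lambda>u. enc_list (\<lambda>w.
    enc_rat (turn_rat (E (base3 z)) (\<alpha> (base3 z)) (snd (base2 z)) u w))
      [0..<n (base3 z)]) [0..<n (base3 z)])"
    by (rule ptime_lookup[OF ptime_ext[OF ptime_ext[OF ptime_ext[OF ptime_costs]]] ptime_ext[OF ptime_ext[OF ptime_snd]]]) auto
  from ptime_lookup[OF this ptime_ext[OF ptime_snd]]
  have "ptime I3 (ext (ext (ext e))) (\<lambda>z. enc_list (\<lambda>w.
    enc_rat (turn_rat (E (base3 z)) (\<alpha> (base3 z)) (snd (base2 z)) (snd (fst z)) w))
      [0..<n (base3 z)])" by auto
  from ptime_lookup[OF this ptime_snd] show ?thesis by auto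
qed

lemma ptime_numer: "ptime I3 (ext (ext (ext e)))
  (\<lambda>z. Leaf (numer (turn_rat (E (base3 z)) (\<alpha> (base3 z)) (snd (base2 z)) (snd (fst z)) (snd z))))"
  using ptime_left[OF ptime_turn_rat] by (simp add: enc_rat_conv)

lemma ptime_denom: "ptime I3 (ext (ext (ext e)))
  (\<lambda>z. Leaf (denom (turn_rat (E (base3 z)) (\<alpha> (base3 z)) (snd (base2 z)) (snd (fst z)) (snd z))))"
  using ptime_right[OF ptime_turn_rat] by (simp add: enc_rat_conv)

lemma ptime_scale: "ptime X e (\<lambda>a. Leaf (scale (n a) (E a) (\<alpha> a)))"
  unfolding scale_def by (intro ptime_prod ptime_n bounded_n ptime_ext bounded_ext_weak ptime_denom)

lemma ptime_int_cost: "ptime I3 (ext (ext (ext e)))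
  (\<lambda>z. Leaf (int_cost (n (base3 z)) (E (base3 z)) (\<alpha> (base3 z))
    (snd (base2 z)) (snd (fst z)) (snd z)))"
  unfolding int_cost_def
  by (intro ptime_mult ptime_div ptime_numer ptime_denom ptime_ext[OF ptime_ext[OF ptime_ext[OF ptime_scale]]])

lemma ptime_power_square: "ptime X e (\<lambda>a. Leaf (4 ^ (n a * n a)))"
  by (intro ptime_power ptime_nat ptime_mult ptime_n bounded_mult bounded_n)

lemma ptime_power_pos: "ptime I3 (ext (ext (ext e)))
  (\<lambda>z. Leaf (4 ^ pair_pos (n (base3 z)) (snd (fst z)) (snd z)))"
proof (rule ptime_power)
  show "ptime I3 (ext (ext (ext e))) (\<lambda>z. Leaf (pair_pos (n (base3 z)) (snd (fst z)) (snd z)))"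
    unfolding pair_pos_def
    by (intro ptime_add ptime_mult ptime_min ptime_max ptime_ext[OF ptime_ext[OF ptime_ext[OF ptime_n]]] ptime_ext[OF ptime_snd] ptime_snd)
  \<comment> \<open>The exponent is below \<open>n * n\<close>, so the power has polynomially many
    bits.\<close>
  have "poly_bounded I3 (ext (ext (ext e))) (\<lambda>z. n (base3 z) * n (base3 z))"
    by (intro bounded_mult bounded_ext_weak[OF bounded_ext_weak[OF bounded_ext_weak[OF bounded_n]]])
  then show "poly_bounded I3 (ext (ext (ext e))) (\<lambda>z. pair_pos (n (base3 z)) (snd (fst z)) (snd z))"
    by (rule bounded_mono) (auto intro: less_imp_le pair_pos_less)
qed (rule ptime_nat)

lemma ptime_weight: "ptime I3 (ext (ext (ext e)))
  (\<lambda>z. Leaf (weight (n (base3 z)) (E (base3 z)) (\<alpha> (base3 z))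
    (snd (base2 z)) (snd (fst z)) (snd z)))"
  unfolding weight_def
  by (intro ptime_add ptime_mult ptime_int_cost ptime_power_pos ptime_ext[OF ptime_ext[OF ptime_ext[OF ptime_power_square]]])

lemma ptime_cities: "ptime I1 (ext e) (\<lambda>z. enc_list Leaf (cities (n (fst z)) (E (fst z)) (snd z)))"
  unfolding cities_def
proof (rule ptime_filter[OF ptime_ext[OF ptime_n] bounded_ext_weak[OF bounded_n]])
  show "ptime I2 (ext (ext e)) (\<lambda>z. Leaf (of_bool ({snd z, snd (fst z)} \<in> E (base2 z))))"
    using ptime_adjacent by (simp add: insert_commute)
qed

abbreviation "deg \<equiv> \<lambda>z. length (cities (n (fst z)) (E (fst z)) (snd z))"

lemma ptime_deg: "ptime I1 (ext e) (\<lambda>z. Leaf (deg z))"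
  by (rule ptime_length[OF ptime_cities])

lemma bounded_deg: "poly_bounded I1 (ext e) deg"
  by (rule bounded_length[OF ptime_cities])

lemma ptime_city_dist: "ptime (idx (idx I1 deg) (\<lambda>z. deg (fst z))) (ext (ext (ext e)))
  (\<lambda>z. Leaf (city_dist (n (base3 z)) (E (base3 z)) (\<alpha> (base3 z))
    (snd (base2 z)) (snd (fst z)) (snd z)))"
proof -
  let ?J = "idx (idx I1 deg) (\<lambda>z. deg (fst z))" and ?e = "ext (ext (ext e))"
  let ?c = "\<lambda>z. cities (n (base3 z)) (E (base3 z)) (snd (base2 z))"
  have i: "ptime ?J ?e (\<lambda>z. Leaf (snd (fst z)))" by (rule ptime_ext[OF ptime_snd])
  have c: "ptime ?J ?e (\<lambda>z. enc_list Leaf (?c z))" by (rule ptime_ext[OF ptime_ext[OF ptime_cities]])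
  have less: "?c z ! j < n (base3 z)" if "z \<in> ?J" "j < length (?c z)" for z j
    using threading_instance.cities_nth[OF instance_at that(2)] that(1) by auto
  have "ptime ?J ?e (\<lambda>z. Leaf (weight (n (base3 z)) (E (base3 z)) (\<alpha> (base3 z))
      (snd (base2 z)) (?c z ! snd (fst z)) (?c z ! snd z)))"
  proof (rule ptime_call3[OF ptime_weight])
    show "ptime ?J ?e (\<lambda>z. e (base3 z))" by (rule ptime_ext[OF ptime_ext[OF ptime_ext[OF ptime_id]]])
    show "ptime ?J ?e (\<lambda>z. Leaf (snd (base2 z)))" by (rule ptime_ext[OF ptime_ext[OF ptime_snd]])
    show "ptime ?J ?e (\<lambda>z. Leaf (?c z ! snd (fst z)))" by (rule ptime_nth[OF c i]) auto
    show "ptime ?J ?e (\<lambda>z. Leaf (?c z ! snd z))" by (rule ptime_nth[OF c ptime_snd]) auto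
  qed (use less in auto)
  then show ?thesis unfolding city_dist_def by (intro ptime_if_nat ptime_eq i ptime_snd ptime_nat)
qed

abbreviation "tour_bound \<equiv> \<lambda>z. \<Sum>i<deg z. city_dist (n (fst z)) (E (fst z)) (\<alpha> (fst z)) (snd z) i (Suc i mod deg z)"

lemma ptime_tour_bound: "ptime I1 (ext e) (\<lambda>z. Leaf (tour_bound z))"
proof (rule ptime_sum[OF ptime_deg bounded_deg])
  let ?J = "idx I1 deg" and ?e = "ext (ext e)"
  have "ptime ?J ?e (\<lambda>z. Leaf ((snd z + 1) mod deg (fst z)))"
    by (intro ptime_mod ptime_add ptime_snd ptime_nat ptime_ext[OF ptime_deg])
  then have j: "ptime ?J ?e (\<lambda>z. Leaf (Suc (snd z) mod deg (fst z)))" by simp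
  show "ptime ?J ?e (\<lambda>z. Leaf (city_dist (n (base2 z)) (E (base2 z)) (\<alpha> (base2 z)) (snd (fst z))
      (snd z) (Suc (snd z) mod deg (fst z))))"
  proof (rule ptime_call2[OF ptime_city_dist, where h = fst])
    show "ptime ?J ?e (\<lambda>z. ext e (fst z))" by (rule ptime_fst)
    show "ptime ?J ?e (\<lambda>z. Leaf (snd z))" by (rule ptime_snd)
    show "ptime ?J ?e (\<lambda>z. Leaf (Suc (snd z) mod deg (fst z)))" by (rule j)
  qed (auto intro!: mod_less_divisor)
qed

text \<open>The only place where the oracle is used. The bound is arbitrary here because the binary
  search chooses it.\<close>

lemma ptime_tour_within: "ptime {z. fst z \<in> I1} (ext (ext e))
  (\<lambda>z. Leaf (of_bool (tour_within (n (base2 z)) (E (base2 z)) (\<alpha> (base2 z)) (snd (fst z)) (snd z))))"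
proof (rule ptime_query)
  let ?d = "\<lambda>z i j. city_dist (n (fst z)) (E (fst z)) (\<alpha> (fst z)) (snd z) i j"
  let ?q = "\<lambda>z. Node (Leaf (deg (fst z))) (Node (enc_list (\<lambda>i. enc_list (\<lambda>j. Node (Leaf (?d (fst z) i j)) (Leaf 1))
      [0..<deg (fst z)]) [0..<deg (fst z)]) (Node (Leaf (snd z)) (Leaf 1)))"
  have m: "ptime I1 (ext e) (\<lambda>z. enc_list (\<lambda>i. enc_list (\<lambda>j. Node (Leaf (?d z i j)) (Leaf 1)) [0..<deg z]) [0..<deg z])"
    by (intro ptime_tabulate ptime_deg bounded_deg ptime_ext bounded_ext_weak ptime_pair ptime_nat ptime_city_dist)
  show "ptime {z. fst z \<in> I1} (ext (ext e)) ?q"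
    by (intro ptime_pair ptime_snd ptime_nat ptime_weak[OF ptime_deg] ptime_weak[OF m]) auto
  show "poly_bounded {z. fst z \<in> I1} (ext (ext e)) (\<lambda>z. data_size (Leaf (of_bool
      (tour_within (n (base2 z)) (E (base2 z)) (\<alpha> (base2 z)) (snd (fst z)) (snd z)))))"
    by (rule bounded_mono[OF bounded_const[of _ _ 2]]) (auto simp: of_bool_def floorlog_def)
  fix or and z :: "('a \<times> nat) \<times> nat"
  assume or: "or \<in> Os" and z: "z \<in> {z. fst z \<in> I1}"
  obtain a v m where zz: "z = ((a, v), m)" by (cases z) auto
  have a: "a \<in> X" and v: "v < n a" using z zz by auto
  interpret threading_instance "n a" "E a" "\<alpha> a" by (rule instance_at[OF a])
  let ?i = "(deg (a, v), \<lambda>i j. of_nat (?d (a, v) i j) :: rat, of_nat m :: rat)"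
  \<comment> \<open>The oracle is reliable only on legal instances, so symmetry and a zero diagonal
    have to be ensured before the query.\<close>
  have "?d (a, v) i j = ?d (a, v) j i" for i j
    using weight_commute by (simp add: city_dist_def)
  then have "?i \<in> instances traveling_salesperson"
    using length_cities[OF v] by (simp add: traveling_salesperson_def decision_problem_def city_dist_def)
  then obtain y where y: "or (encode traveling_salesperson ?i) = Some y" "answer traveling_salesperson ?i y"
    using orc[OF or] unfolding solves_def by blast
  have "encode traveling_salesperson ?i = ?q z"
    by (simp add: traveling_salesperson_def decision_problem_def enc_rat_of_nat zz)
  moreover have "y = Leaf (of_bool (tour_within (n a) (E a) (\<alpha> a) v m))"
    using y(2) by (simp add: traveling_salesperson_def decision_problem_def tour_within_def)
  ultimately show "or (?q z) = Some (Leaf (of_bool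
      (tour_within (n (base2 z)) (E (base2 z)) (\<alpha> (base2 z)) (snd (fst z)) (snd z))))"
    using y(1) by (simp add: zz)
qed

text \<open>The numbers in the search have exponential values but polynomial length, and the search
  asks one question per bit.\<close>

lemma ptime_opt: "ptime I1 (ext e) (\<lambda>z. Leaf (opt (n (fst z)) (E (fst z)) (\<alpha> (fst z)) (snd z)))"
  unfolding opt_def
proof (rule ptime_Least[OF ptime_tour_within _ ptime_tour_bound])
  show "tour_within (n (fst z)) (E (fst z)) (\<alpha> (fst z)) (snd z) m'"
    if "z \<in> I1" "tour_within (n (fst z)) (E (fst z)) (\<alpha> (fst z)) (snd z) m" "m \<le> m'" for z m m'
    using threading_instance.tour_within_mono[OF instance_at] that by auto
  show "tour_within (n (fst z)) (E (fst z)) (\<alpha> (fst z)) (snd z) (tour_bound z)" if "z \<in> I1" for z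
    using threading_instance.tour_within_identity[OF instance_at] that by auto
qed

lemma ptime_multiplicity: "ptime I3 (ext (ext (ext e)))
  (\<lambda>z. Leaf (opt (n (base3 z)) (E (base3 z)) (\<alpha> (base3 z)) (snd (base2 z)) div
    4 ^ pair_pos (n (base3 z)) (snd (fst z)) (snd z) mod 4))"
  by (intro ptime_mod ptime_div ptime_power_pos ptime_nat ptime_ext[OF ptime_ext[OF ptime_opt]])

lemma ptime_min_cost: "ptime X e (\<lambda>a. Leaf (\<Sum>v<n a. opt (n a) (E a) (\<alpha> a) v div 4 ^ (n a * n a)))"
  by (intro ptime_sum ptime_n bounded_n ptime_div ptime_opt ptime_ext[OF ptime_power_square])

section \<open>The tracing procedure as a program\<close>

lemma ptime_free_turns:
  assumes eh: "ptime Y e' (\<lambda>y. e (h y))" and R: "ptime Y e' (\<lambda>y. enc_list Leaf (R y))"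
    and Y: "\<And>y. y \<in> Y \<Longrightarrow> h y \<in> X \<and> 2 \<le> length (R y) \<and> set (R y) \<subseteq> {..<n (h y)}"
  shows "ptime Y e' (\<lambda>y. enc_list Leaf (free_turns (n (h y)) (E (h y)) (\<alpha> (h y)) (R y)))"
  unfolding free_turns_def
proof (rule ptime_filter)
  have h: "h y \<in> X" if "y \<in> Y" for y using Y that by blast
  show n: "ptime Y e' (\<lambda>y. Leaf (n (h y)))" by (rule ptime_call0[OF ptime_n eh h])
  show "poly_bounded Y e' (\<lambda>y. n (h y))" by (rule bounded_call[OF bounded_n eh h])
  have bounds: "R y ! 0 < n (h y)" "R y ! 1 < n (h y)" if "y \<in> Y" for y
    using Y[OF that] by (auto intro!: subsetD[of "set (R y)" "{..<n (h y)}", unfolded lessThan_iff] nth_mem)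
  have r: "ptime Y e' (\<lambda>y. Leaf (R y ! 0))" "ptime Y e' (\<lambda>y. Leaf (R y ! 1))"
    by (rule ptime_nth[OF R ptime_nat], use Y in force)+
  let ?J = "idx Y (\<lambda>y. n (h y))" and ?f = "ext e'"
  have len: "ptime ?J ?f (\<lambda>z. Leaf (length (R (fst z)) - 2))"
    by (intro ptime_diff ptime_nat ptime_ext[OF ptime_length[OF R]])
  have pb: "poly_bounded ?J ?f (\<lambda>z. length (R (fst z)) - 2)"
    by (rule bounded_mono[OF bounded_ext_weak[OF bounded_length[OF R]]]) simp
  have occ: "ptime ?J ?f (\<lambda>z. Leaf (occurrences (R (fst z)) (R (fst z) ! 0) (R (fst z) ! 1) (snd z)))"
    unfolding occurrences_def
  proof (rule ptime_sum[OF len pb])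
    let ?K = "idx ?J (\<lambda>z. length (R (fst z)) - 2)" and ?g = "ext ?f"
    have RK: "ptime ?K ?g (\<lambda>z. enc_list Leaf (R (base2 z)))" by (rule ptime_ext[OF ptime_ext[OF R]])
    have i: "ptime ?K ?g (\<lambda>z. Leaf (snd z))" by (rule ptime_snd)
    have Ri: "ptime ?K ?g (\<lambda>z. Leaf (R (base2 z) ! snd z))" by (rule ptime_nth[OF RK i]) auto
    have Rj: "ptime ?K ?g (\<lambda>z. Leaf (R (base2 z) ! (snd z + 1)))"
      by (rule ptime_nth[OF RK ptime_add[OF i ptime_nat]]) auto
    have Rk: "ptime ?K ?g (\<lambda>z. Leaf (R (base2 z) ! (snd z + 2)))"
      by (rule ptime_nth[OF RK ptime_add[OF i ptime_nat]]) auto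
    show "ptime ?K ?g (\<lambda>z. Leaf (of_bool (R (base2 z) ! (snd z + 1) = R (base2 z) ! 0 \<and>
       (R (base2 z) ! snd z = R (base2 z) ! 1 \<and> R (base2 z) ! (snd z + 2) = snd (fst z) \<or>
        R (base2 z) ! snd z = snd (fst z) \<and> R (base2 z) ! (snd z + 2) = R (base2 z) ! 1))))"
      by (intro ptime_conj ptime_disj ptime_eq Ri Rj Rk ptime_ext[OF ptime_ext[OF r(1)]] ptime_ext[OF ptime_ext[OF r(2)]]
          ptime_ext[OF ptime_snd])
  qed
  have mult: "ptime ?J ?f (\<lambda>z. Leaf (opt (n (h (fst z))) (E (h (fst z))) (\<alpha> (h (fst z))) (R (fst z) ! 0) div
      4 ^ pair_pos (n (h (fst z))) (R (fst z) ! 1) (snd z) mod 4))"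
  proof (rule ptime_call3[OF ptime_multiplicity])
    show "ptime ?J ?f (\<lambda>z. e (h (fst z)))" by (rule ptime_ext[OF eh])
    show "ptime ?J ?f (\<lambda>z. Leaf (R (fst z) ! 0))" by (rule ptime_ext[OF r(1)])
    show "ptime ?J ?f (\<lambda>z. Leaf (R (fst z) ! 1))" by (rule ptime_ext[OF r(2)])
    show "ptime ?J ?f (\<lambda>z. Leaf (snd z))" by (rule ptime_snd)
  qed (use h bounds in auto)
  show "ptime ?J ?f (\<lambda>z. Leaf (of_bool (occurrences (R (fst z)) (R (fst z) ! 0) (R (fst z) ! 1) (snd z) <
      opt (n (h (fst z))) (E (h (fst z))) (\<alpha> (h (fst z))) (R (fst z) ! 0) div
      4 ^ pair_pos (n (h (fst z))) (R (fst z) ! 1) (snd z) mod 4)))"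
    by (intro ptime_less occ mult)
qed

lemma ptime_rotate_path:
  assumes R: "ptime Y e' (\<lambda>y. enc_list Leaf (R y))" and Y: "\<And>y. y \<in> Y \<Longrightarrow> 3 \<le> length (R y)"
  shows "ptime Y e' (\<lambda>y. enc_list Leaf (rotate_path (R y)))"
proof -
  let ?J = "idx Y (\<lambda>y. length (R y))" and ?f = "ext e'"
  \<comment> \<open>Position of the entry that moves to place \<open>snd z\<close>: the next one,
    except that the last place receives \<open>R ! 2\<close>.\<close>
  let ?i = "\<lambda>z. if snd z + 1 < length (R (fst z)) then snd z + 1 else 2"
  have "ptime Y e' (\<lambda>y. enc_list (\<lambda>i. Leaf (R y ! (if i + 1 < length (R y) then i + 1 else 2))) [0..<length (R y)])"
  proof (rule ptime_tabulate[OF ptime_length[OF R] bounded_length[OF R]], rule ptime_nth[OF ptime_ext[OF R]])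
    show "ptime ?J ?f (\<lambda>z. Leaf (?i z))"
      by (intro ptime_if_nat ptime_less ptime_add ptime_snd ptime_nat ptime_ext[OF ptime_length[OF R]])
  qed (use Y in force)
  then show ?thesis
  proof (rule ptime_cong)
    fix y assume "y \<in> Y"
    then have len: "3 \<le> length (R y)" by (rule Y)
    have "rotate_path (R y) = map (\<lambda>i. R y ! (if i + 1 < length (R y) then i + 1 else 2)) [0..<length (R y)]"
      using len by (intro nth_equalityI) (auto simp: rotate_path_def nth_append nth_tl not_less)
    then show "enc_list Leaf (rotate_path (R y)) =
        enc_list (\<lambda>i. Leaf (R y ! (if i + 1 < length (R y) then i + 1 else 2))) [0..<length (R y)]"
      by (simp only: enc_list_map)
  qed
qed

text \<open>Rotation accesses the third entry, so the length 3 is demanded just where no free turn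
  is left.\<close>

lemma ptime_trace_step:
  assumes eh: "ptime Y e' (\<lambda>y. e (h y))" and R: "ptime Y e' (\<lambda>y. enc_list Leaf (R y))"
    and Y: "\<And>y. y \<in> Y \<Longrightarrow> h y \<in> X \<and> 2 \<le> length (R y) \<and> set (R y) \<subseteq> {..<n (h y)}"
    and stuck: "\<And>y. y \<in> Y \<Longrightarrow> free_turns (n (h y)) (E (h y)) (\<alpha> (h y)) (R y) = [] \<Longrightarrow> 3 \<le> length (R y)"
  shows "ptime Y e' (\<lambda>y. enc_list Leaf (trace_step (n (h y)) (E (h y)) (\<alpha> (h y)) (R y)))"
proof -
  let ?F = "\<lambda>y. free_turns (n (h y)) (E (h y)) (\<alpha> (h y)) (R y)"
  have F: "ptime Y e' (\<lambda>y. enc_list Leaf (?F y))" by (rule ptime_free_turns[OF eh R Y])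
  have node: "is_node (enc_list Leaf xs) \<longleftrightarrow> xs \<noteq> []" for xs by (cases xs) auto
  have empty: "ptime Y e' (\<lambda>y. Leaf (of_bool (?F y = [])))"
    using ptime_not[OF ptime_is_node[OF F]] by (simp add: node)
  have "ptime Y e' (\<lambda>y. if ?F y = [] then enc_list Leaf (rotate_path (R y))
      else Node (left (enc_list Leaf (?F y))) (enc_list Leaf (R y)))"
  proof (rule ptime_if[OF empty])
    show "ptime {y \<in> Y. ?F y = []} e' (\<lambda>y. enc_list Leaf (rotate_path (R y)))"
      by (rule ptime_rotate_path[OF ptime_subset[OF R]]) (use stuck in auto)
    show "ptime {y \<in> Y. ?F y \<noteq> []} e' (\<lambda>y. Node (left (enc_list Leaf (?F y))) (enc_list Leaf (R y)))"
      by (rule ptime_subset[OF ptime_pair[OF ptime_left[OF F] R]]) blast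
  qed
  then show ?thesis
  proof (rule ptime_cong)
    fix y
    show "enc_list Leaf (trace_step (n (h y)) (E (h y)) (\<alpha> (h y)) (R y)) =
        (if ?F y = [] then enc_list Leaf (rotate_path (R y))
         else Node (left (enc_list Leaf (?F y))) (enc_list Leaf (R y)))"
      by (cases "?F y") (auto simp: trace_step_def)
  qed
qed

lemma ptime_trace:
  assumes k: "ptime X e (\<lambda>a. Leaf (k a))" and pb: "poly_bounded X e k"
  shows "ptime X e (\<lambda>a. enc_list Leaf (trace (n a) (E a) (\<alpha> a) (k a)))"
proof -
  let ?T = "\<lambda>a k. trace (n a) (E a) (\<alpha> a) k"
  have n_pos: "0 < n a" if "a \<in> X" for a
    using threading_instance.n_pos[OF instance_at[OF that]] .
  have T: "2 \<le> length (?T a i)" "length (?T a i) \<le> n a * n a + 2" "set (?T a i) \<subseteq> {..<n a}"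
    if "a \<in> X" for a i
    using threading_instance.length_trace[OF instance_at[OF that]]
      threading_instance.valid_set[OF instance_at[OF that] threading_instance.valid_trace[OF instance_at[OF that]]]
    by auto
  show ?thesis
  proof (rule ptime_for[OF k pb, where D = "\<lambda>a i. enc_list Leaf (?T a i)"])
    have c: "ptime X e (\<lambda>a. enc_list Leaf (cities (n a) (E a) 0))"
      by (rule ptime_call1[OF ptime_cities ptime_id ptime_nat]) (use n_pos in auto)
    have "ptime X e (\<lambda>a. Node (left (enc_list Leaf (cities (n a) (E a) 0))) (Node (Leaf 0) (Leaf 0)))"
      by (intro ptime_pair ptime_nat ptime_left c)
    then show "ptime X e (\<lambda>a. enc_list Leaf (?T a 0))"
    proof (rule ptime_cong)
      fix a assume a: "a \<in> X"
      have "cities (n a) (E a) 0 \<noteq> []"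
        using threading_instance.length_cities[OF instance_at[OF a] n_pos[OF a]] by auto
      then show "enc_list Leaf (?T a 0) = Node (left (enc_list Leaf (cities (n a) (E a) 0))) (Node (Leaf 0) (Leaf 0))"
        by (cases "cities (n a) (E a) 0") (auto simp: trace_def)
    qed
    let ?J = "idx X k" and ?f = "\<lambda>z. Node (e (fst z)) (Node (Leaf (snd z)) (enc_list Leaf (?T (fst z) (snd z))))"
    have "ptime ?J ?f (\<lambda>z. enc_list Leaf (trace_step (n (fst z)) (E (fst z)) (\<alpha> (fst z)) (?T (fst z) (snd z))))"
    proof (rule ptime_trace_step[OF ptime_fst ptime_loop_acc])
      fix z assume z: "z \<in> ?J"
      then have "fst z \<in> X" by simp
      note inst = instance_at[OF this]
      show "fst z \<in> X \<and> 2 \<le> length (?T (fst z) (snd z)) \<and> set (?T (fst z) (snd z)) \<subseteq> {..<n (fst z)}"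
        using z T by simp
      show "3 \<le> length (?T (fst z) (snd z))"
        if "free_turns (n (fst z)) (E (fst z)) (\<alpha> (fst z)) (?T (fst z) (snd z)) = []"
        by (rule threading_instance.length_trace(3)[OF inst that])
    qed
    then show "ptime ?J ?f (\<lambda>z. enc_list Leaf (?T (fst z) (Suc (snd z))))"
      by (simp add: trace_def)
    \<comment> \<open>At most \<open>n * n + 2\<close> entries, each of size at most
      \<open>n + 1\<close> plus one for its node.\<close>
    show "poly_bounded X e (\<lambda>a. 1 + (n a * n a + 2) * (n a + 2))"
      by (intro bounded_add bounded_mult bounded_const bounded_n)
    show "data_size (enc_list Leaf (?T a i)) \<le> 1 + (n a * n a + 2) * (n a + 2)" if a: "a \<in> X" for a i
    proof -
      have "data_size (Leaf x) \<le> n a + 1" if "x \<in> set (?T a i)" for x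
        using that T(3)[OF a, of i] floorlog2_le[of x] by fastforce
      then have "data_size (enc_list Leaf (?T a i)) \<le> 1 + length (?T a i) * Suc (n a + 1)"
        by (rule data_size_enc_list_le)
      also have "\<dots> \<le> 1 + (n a * n a + 2) * (n a + 2)"
        using T(2)[OF a, of i] by (intro add_left_mono mult_mono) auto
      finally show ?thesis .
    qed
  qed
qed

abbreviation "steps \<equiv> \<lambda>a. (n a * n a + 2) * (n a * n a + 2)"

abbreviation "threading_walk \<equiv> \<lambda>a. take (length (trace (n a) (E a) (\<alpha> a) (steps a)) - 2) (trace (n a) (E a) (\<alpha> a) (steps a))"

lemma ptime_threading_walk: "ptime X e (\<lambda>a. enc_list Leaf (threading_walk a))"
proof -
  let ?T = "\<lambda>a. trace (n a) (E a) (\<alpha> a) (steps a)"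
  have T: "ptime X e (\<lambda>a. enc_list Leaf (?T a))"
    by (rule ptime_trace) (intro ptime_mult ptime_add ptime_n ptime_nat, intro bounded_mult bounded_add bounded_n bounded_const)
  have "ptime X e (\<lambda>a. enc_list (\<lambda>i. Leaf (?T a ! i)) [0..<length (?T a) - 2])"
  proof (rule ptime_tabulate)
    show "ptime X e (\<lambda>a. Leaf (length (?T a) - 2))" by (intro ptime_diff ptime_length[OF T] ptime_nat)
    show "poly_bounded X e (\<lambda>a. length (?T a) - 2)" by (rule bounded_mono[OF bounded_length[OF T]]) simp
    show "ptime (idx X (\<lambda>a. length (?T a) - 2)) (ext e) (\<lambda>z. Leaf (?T (fst z) ! snd z))"
      by (rule ptime_nth[OF ptime_ext[OF T] ptime_snd]) auto
  qed
  then show ?thesis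
  proof (rule ptime_cong)
    fix a
    have "threading_walk a = map (\<lambda>i. ?T a ! i) [0..<length (?T a) - 2]"
      by (rule nth_equalityI) auto
    then show "enc_list Leaf (threading_walk a) = enc_list (\<lambda>i. Leaf (?T a ! i)) [0..<length (?T a) - 2]"
      by (simp only: enc_list_map)
  qed
qed

lemma threading_walk_optimal:
  assumes "a \<in> X"
  shows "exactly_double_threading {..<n a} (E a) (threading_walk a)"
    and "exactly_double_threading {..<n a} (E a) w' \<Longrightarrow> walk_cost (\<alpha> a) (threading_walk a) \<le> walk_cost (\<alpha> a) w'"
  using threading_instance.trace_threading[OF instance_at[OF assms] order_refl] by auto

end

section \<open>Assembling the reductions\<close>

lemma solver_oracles: "oracles {orc. solves orc traveling_salesperson}"
  using traveling_salesperson_solvable by unfold_locales auto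

lemma polytime_turing_reducibleI:
  assumes ptime: "oracles.ptime {orc. solves orc Q} (instances P) (encode P) f"
    and f: "\<And>i. i \<in> instances P \<Longrightarrow> answer P i (f i)"
    and "oracles {orc. solves orc Q}"
  shows "polytime_turing_reducible P Q"
proof -
  interpret oracles "{orc. solves orc Q}" by fact
  from ptime obtain p T where p: "\<And>orc i. solves orc Q \<Longrightarrow> i \<in> instances P \<Longrightarrow>
    \<exists>t. eval orc [encode P i] p (f i) t \<and> t \<le> poly T (data_size (encode P i))"
    unfolding ptime_def by blast
  then show ?thesis
    unfolding polytime_turing_reducible_def using f by (intro exI[of _ p] exI[of _ T]) blast
qed

theorem exactly_double_threading_turing_reducible:
  "polytime_turing_reducible exactly_double_threading_problem traveling_salesperson"
proof -
  interpret oracles "{orc. solves orc traveling_salesperson}" by (rule solver_oracles)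
  let ?X = "instances exactly_double_threading_problem"
  interpret threading_program "{orc. solves orc traveling_salesperson}" ?X
    "encode exactly_double_threading_problem" fst "\<lambda>G. fst (snd G)" "\<lambda>G. snd (snd G)"
    by unfold_locales (use ptime_id in \<open>auto simp: exactly_double_threading_problem_def\<close>)
  show ?thesis
  proof (rule polytime_turing_reducibleI[OF ptime_threading_walk _ solver_oracles])
    fix G assume G: "G \<in> ?X"
    obtain n E \<alpha> where "G = (n, E, \<alpha>)" by (cases G)
    then show "answer exactly_double_threading_problem G (enc_list Leaf (threading_walk G))"
      using threading_walk_optimal[OF G] by (auto simp: exactly_double_threading_problem_def)
  qed
qed

text \<open>No walk has to be traced: the optimal lengths at the vertices already give the scaled
  minimum, which is compared with the bound.\<close>

theorem exactly_double_threading_decision_turing_reducible: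
  "polytime_turing_reducible exactly_double_threading_decision traveling_salesperson"
proof -
  interpret oracles "{orc. solves orc traveling_salesperson}" by (rule solver_oracles)
  let ?X = "instances exactly_double_threading_decision"
  let ?e = "encode exactly_double_threading_decision"
  have e: "?e = (\<lambda>i. Node (enc_graph (fst i)) (enc_rat (snd i)))"
    by (auto simp: exactly_double_threading_decision_def decision_problem_def)
  interpret threading_program "{orc. solves orc traveling_salesperson}" ?X ?e
    "\<lambda>i. fst (fst i)" "\<lambda>i. fst (snd (fst i))" "\<lambda>i. snd (snd (fst i))"
    by unfold_locales (use ptime_fst in \<open>auto simp: e, auto simp: exactly_double_threading_decision_def decision_problem_def\<close>)
  have c: "ptime ?X ?e (\<lambda>i. enc_rat (snd i))" unfolding e by (rule ptime_snd)
  let ?m = "\<lambda>i. \<Sum>v<fst (fst i). opt (fst (fst i)) (fst (snd (fst i))) (snd (snd (fst i))) v div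
    4 ^ (fst (fst i) * fst (fst i))"
  have "ptime ?X ?e (\<lambda>i. Leaf (of_bool (?m i * denom (snd i) \<le>
      scale (fst (fst i)) (fst (snd (fst i))) (snd (snd (fst i))) * numer (snd i))))"
    using ptime_left[OF c] ptime_right[OF c]
    by (intro ptime_le ptime_mult ptime_min_cost ptime_scale) (simp_all add: enc_rat_conv)
  then show ?thesis
  proof (rule polytime_turing_reducibleI[OF _ _ solver_oracles])
    fix i assume i: "i \<in> ?X"
    interpret threading_instance "fst (fst i)" "fst (snd (fst i))" "snd (snd (fst i))"
      by (rule instance_at[OF i])
    obtain n E \<alpha> c where "i = ((n, E, \<alpha>), c)" by (metis prod.collapse)
    then show "answer exactly_double_threading_decision i (Leaf (of_bool (?m i * denom (snd i) \<le>
      scale (fst (fst i)) (fst (snd (fst i))) (snd (snd (fst i))) * numer (snd i))))"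
      using threading_within_iff[of c, unfolded min_cost_def] i
      by (auto simp: exactly_double_threading_decision_def decision_problem_def)
  qed
qed

theorem theorem16:
  shows "polytime_many_one_reducible traveling_salesperson exactly_double_threading_decision \<and>
    polytime_turing_reducible exactly_double_threading_problem traveling_salesperson \<and>
    polytime_turing_reducible exactly_double_threading_decision traveling_salesperson"
  using traveling_salesperson_many_one_reducible exactly_double_threading_turing_reducible
    exactly_double_threading_decision_turing_reducible by blast

end
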